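(* Let $n\ge 3$ be an odd integer, let $1\to R\to F\xrightarrow{\varepsilon} D_n\to 1$ be the free presentation with $F=\langle s_1,s_2\rangle$ the free group of rank two, $\varepsilon(s_1)=\sigma$, $\varepsilon(s_2)=\tau$, and let $R^{ab}=R/[R,R]$ be the associated relation module. Then there is an isomorphism of $D_n$-lattices $R^{ab}\simeq M_+\oplus\widetilde{M}_+$. Thus $$R^{ab}\oplus\mathbb{Z}\simeq\mathbb{Z}[D_n/\langle\sigma\rangle]\oplus\mathbb{Z}[D_n/\langle\tau\rangle]^{(2)}.$$
   Context: $D_n=\langle\sigma,\tau:\sigma^n=\tau^2=1,\ \tau\sigma\tau^{-1}=\sigma^{-1}\rangle$ is the dihedral group of order $2n$. A $G$-lattice ($G$ a finite group) is a finitely generated $\mathbb{Z}[G]$-module that is torsion-free as an abelian group. Relation module: $R$ is the kernel of $\varepsilon$; $F$ acts on $R$ by conjugation ${}^x r=xrx^{-1}$, which induces an action of $D_n=F/R$ on $R^{ab}=R/[R,R]$, making it a $D_n$-lattice. $\mathbb{Z}$ is the trivial lattice; $\mathbb{Z}[G/S]$ is the permutation lattice on the cosets of a subgroup $S$; $M^{(m)}$ is the direct sum of $m$ copies of $M$. $M_+=\mathrm{Ind}_{\langle\tau\rangle}^{D_n}\mathbb{Z}$ has $\mathbb{Z}$-basis $x_0,\ldots,x_{n-1}$ with (indices modulo $n$) $\sigma:x_i\mapsto x_{i+1}$, $\tau:x_i\mapsto x_{-i}$. $\widetilde{M}_+$ has $\mathbb{Z}$-basis $x_0,\ldots,x_{n-1},w$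 with $\sigma:x_i\mapsto x_{i+1},\ w\mapsto w$ and $\tau:x_i\mapsto x_{-i},\ w\mapsto -w+\sum_{0\le i\le n-1}x_i$. *)

theory Defs
  imports "HOL-Algebra.Algebra" "HOL-Algebra.Free_Abelian_Groups" "HOL-Algebra.Left_Coset"
begin

section \<open>Free groups\<close>

text \<open>The letter \<open>(a, True)\<close> stands for the generator \<open>a\<close> and \<open>(a, False)\<close> for its inverse.
  The free group on \<open>S\<close> is the set of freely reduced words over \<open>S\<close>, multiplied by concatenation
  followed by free reduction.\<close>

definition cancels :: "'a \<times> bool \<Rightarrow> 'a \<times> bool \<Rightarrow> bool" where
  "cancels x y \<longleftrightarrow> fst x = fst y \<and> snd x \<noteq> snd y"

abbreviation reduced :: "('a \<times> bool) list \<Rightarrow> bool" where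
  "reduced \<equiv> successively (\<lambda>x y. \<not> cancels x y)"

fun prepend :: "'a \<times> bool \<Rightarrow> ('a \<times> bool) list \<Rightarrow> ('a \<times> bool) list" where
  "prepend x [] = [x]"
| "prepend x (y # ys) = (if cancels x y then ys else x # y # ys)"

definition free_group :: "'a set \<Rightarrow> ('a \<times> bool) list monoid" where
  "free_group S =
    \<lparr>carrier = {w. reduced w \<and> fst ` set w \<subseteq> S}, monoid.mult = foldr prepend, one = []\<rparr>"

definition free_gen :: "'a \<Rightarrow> ('a \<times> bool) list" where
  "free_gen a = [(a, True)]"

lemma cancels_prepend:
  assumes "reduced w" "cancels x y"
  shows "prepend x (prepend y w) = w"
  using assms
  by (cases w rule: remdups_adj.cases; cases x; cases y) (auto simp: cancels_def)

lemma reduced_prepend: "reduced w \<Longrightarrow> reduced (prepend x w)"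
  by (cases w rule: remdups_adj.cases) (auto simp: cancels_def)

lemma reduced_foldr_prepend: "reduced w \<Longrightarrow> reduced (foldr prepend u w)"
  by (induction u) (auto intro: reduced_prepend)

lemma set_prepend: "set (prepend x w) \<subseteq> insert x (set w)"
  by (cases w) auto

lemma set_foldr_prepend: "set (foldr prepend u w) \<subseteq> set u \<union> set w"
  by (induction u) (use set_prepend in fastforce)+

lemma foldr_prepend_prepend:
  assumes "reduced w" 
  shows "foldr prepend (prepend x v) w = prepend x (foldr prepend v w)"
proof (cases v)
  case (Cons y ys)
  then show ?thesis
    using cancels_prepend[OF reduced_foldr_prepend[OF assms], of x y ys] by auto
qed auto

lemma foldr_prepend_assoc:
  assumes "reduced w"
  shows "foldr prepend (foldr prepend u v) w = foldr prepend u (foldr prepend v w)"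
  by (induction u) (auto simp: foldr_prepend_prepend[OF assms])

lemma foldr_prepend_Nil: "reduced w \<Longrightarrow> foldr prepend w [] = w"
proof (induction w)
  case (Cons x w)
  then have "foldr prepend w [] = w" by (auto simp: successively_Cons)
  with Cons.prems show ?case by (cases w) auto
qed auto

definition inv_word :: "('a \<times> bool) list \<Rightarrow> ('a \<times> bool) list" where
  "inv_word w = rev (map (\<lambda>(a, e). (a, \<not> e)) w)"

lemma reduced_inv_word: "reduced (inv_word w) \<longleftrightarrow> reduced w"
  by (auto simp: inv_word_def successively_rev successively_map cancels_def case_prod_beta
      elim!: successively_mono)

lemma foldr_prepend_inv_word:
  "reduced v \<Longrightarrow> foldr prepend (inv_word w) (foldr prepend w v) = v"
proof (induction w arbitrary: v)
  case (Cons x w)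
  have "prepend (fst x, \<not> snd x) (prepend x (foldr prepend w v)) = foldr prepend w v"
    by (rule cancels_prepend[OF reduced_foldr_prepend[OF Cons.prems]]) (auto simp: cancels_def)
  with Cons show ?case by (auto simp: inv_word_def case_prod_beta)
qed (auto simp: inv_word_def)

lemma group_free_group: "group (free_group S)"
proof (rule groupI)
  fix u v assume "u \<in> carrier (free_group S)" "v \<in> carrier (free_group S)"
  moreover from this have "fst ` set (foldr prepend u v) \<subseteq> S"
    using image_mono[OF set_foldr_prepend[of u v], of fst]
    unfolding free_group_def image_Un partial_object.simps mem_Collect_eq by blast
  ultimately show "u \<otimes>\<^bsub>free_group S\<^esub> v \<in> carrier (free_group S)"
    using reduced_foldr_prepend[of v u] by (simp add: free_group_def)
next
  fix u assume u: "u \<in> carrier (free_group S)"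
  show "\<exists>v\<in>carrier (free_group S). v \<otimes>\<^bsub>free_group S\<^esub> u = \<one>\<^bsub>free_group S\<^esub>"
  proof
    show "inv_word u \<in> carrier (free_group S)"
      using u by (simp add: free_group_def reduced_inv_word)
        (simp add: inv_word_def image_image case_prod_beta)
    show "inv_word u \<otimes>\<^bsub>free_group S\<^esub> u = \<one>\<^bsub>free_group S\<^esub>"
      using u foldr_prepend_inv_word[of "[]" u] by (auto simp: free_group_def foldr_prepend_Nil)
  qed
qed (auto simp: free_group_def foldr_prepend_assoc)

definition free_lift :: "('b, 'c) monoid_scheme \<Rightarrow> ('a \<Rightarrow> 'b) \<Rightarrow> ('a \<times> bool) list \<Rightarrow> 'b" where
  "free_lift H f w =
    foldr (\<lambda>(a, e) h. (if e then f a else inv\<^bsub>H\<^esub> (f a)) \<otimes>\<^bsub>H\<^esub> h) w \<one>\<^bsub>H\<^esub>"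

lemma free_lift_hom:
  assumes "group H" and f: "f \<in> S \<rightarrow> carrier H"
  shows "free_lift H f \<in> hom (free_group S) H"
    and "a \<in> S \<Longrightarrow> free_lift H f (free_gen a) = f a"
proof -
  interpret H: group H by fact
  have fS: "f a \<in> carrier H" if "a \<in> S" for a using f that by auto
  then show "a \<in> S \<Longrightarrow> free_lift H f (free_gen a) = f a"
    by (simp add: free_lift_def free_gen_def)
  have closed: "free_lift H f w \<in> carrier H" if "fst ` set w \<subseteq> S" for w
    using that by (induction w) (auto simp: free_lift_def fS intro!: H.m_closed H.inv_closed)
  have pre: "free_lift H f (prepend x w) = free_lift H f (x # w)"
    if x: "fst x \<in> S" and w: "fst ` set w \<subseteq> S" for x w
  proof (cases w)
    case (Cons y ys)
    have y: "fst y \<in> S" and ys: "fst ` set ys \<subseteq> S" using w Cons by auto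
    have "free_lift H f ys \<in> carrier H" using closed[OF ys] .
    moreover have "f (fst y) \<in> carrier H" using y f by auto
    ultimately show ?thesis
      using Cons x by (cases x; cases y)
        (auto simp: free_lift_def cancels_def H.m_assoc[symmetric])
  qed (auto simp: free_lift_def)
  have "free_lift H f (foldr prepend u v) = free_lift H f u \<otimes>\<^bsub>H\<^esub> free_lift H f v"
    if "fst ` set u \<subseteq> S" "fst ` set v \<subseteq> S" for u v
    using that(1)
  proof (induction u)
    case Nil
    then show ?case using closed[OF that(2)] by (auto simp: free_lift_def)
  next
    case (Cons x u)
    have sub: "fst ` set (foldr prepend u v) \<subseteq> S"
      using image_mono[OF set_foldr_prepend[of u v], of fst] Cons.prems that(2)
      unfolding image_Un list.set image_insert by blast
    have "f (fst x) \<in> carrier H" using Cons.prems f by auto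
    moreover have "free_lift H f u \<in> carrier H" "free_lift H f v \<in> carrier H"
      using closed Cons.prems that(2) by auto
    ultimately show ?case
      using pre[of x "foldr prepend u v", OF _ sub] Cons
      by (cases x) (auto simp: free_lift_def H.m_assoc)
  qed
  then show "free_lift H f \<in> hom (free_group S) H"
    by (intro homI) (auto simp: free_group_def intro!: closed)
qed

lemma generate_free_group: "generate (free_group S) (free_gen ` S) = carrier (free_group S)"
proof
  interpret F: group "free_group S" by (rule group_free_group)
  show "generate (free_group S) (free_gen ` S) \<subseteq> carrier (free_group S)"
    by (rule F.generate_incl) (auto simp: free_gen_def free_group_def)
  have letter: "[(a, e)] \<in> generate (free_group S) (free_gen ` S)" if "a \<in> S" for a e
  proof (cases e)
    case True
    then show ?thesis using that by (auto intro!: generate.incl simp: free_gen_def)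
  next
    case False
    have "inv\<^bsub>free_group S\<^esub> (free_gen a) = [(a, False)]"
      using that by (intro F.inv_equality) (auto simp: free_gen_def free_group_def cancels_def)
    then show ?thesis using that False
      by (metis generate.inv image_eqI)
  qed
  show "carrier (free_group S) \<subseteq> generate (free_group S) (free_gen ` S)"
  proof
    fix w assume "w \<in> carrier (free_group S)"
    then show "w \<in> generate (free_group S) (free_gen ` S)"
    proof (induction w)
      case Nil
      then show ?case using generate.one[of "free_group S"] by (simp add: free_group_def)
    next
      case (Cons x w)
      have w: "w \<in> carrier (free_group S)" and x: "fst x \<in> S"
        using Cons.prems by (auto simp: free_group_def successively_Cons)
      have "[x] \<otimes>\<^bsub>free_group S\<^esub> w = x # w"
        using Cons.prems by (cases w) (auto simp: free_group_def)
      with generate.eng[OF letter[OF x, of "snd x"] Cons.IH[OF w]] show ?case by simp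
    qed
  qed
qed


section \<open>Dihedral groups\<close>

text \<open>The pair \<open>(i, a)\<close> with \<open>0 \<le> i < n\<close> stands for \<open>\<sigma>\<^sup>i\<close> if \<open>a\<close> is false and for \<open>\<sigma>\<^sup>i\<tau>\<close> if
  \<open>a\<close> is true. The lemmas \<open>dihedral_relations\<close>, \<open>generate_dihedral\<close> and \<open>order_dihedral\<close> below
  show that this is the group of order \<open>2n\<close> presented by
  \<open>\<sigma>\<^sup>n = \<tau>\<^sup>2 = 1\<close>, \<open>\<tau>\<sigma>\<tau>\<inverse> = \<sigma>\<inverse>\<close>.\<close>

definition dihedral :: "nat \<Rightarrow> (int \<times> bool) monoid" where
  "dihedral n =
    \<lparr>carrier = {0..<int n} \<times> UNIV,
     monoid.mult = (\<lambda>(i, a) (j, b). ((if a then i - j else i + j) mod int n, a \<noteq> b)),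
     one = (0, False)\<rparr>"

definition dih_sigma :: "nat \<Rightarrow> int \<times> bool" where "dih_sigma n = (1 mod int n, False)"
definition dih_tau :: "int \<times> bool" where "dih_tau = (0, True)"

lemma group_dihedral:
  assumes "0 < n" shows "group (dihedral n)"
proof (rule groupI)
  fix x assume "x \<in> carrier (dihedral n)"
  then show "\<exists>y\<in>carrier (dihedral n). y \<otimes>\<^bsub>dihedral n\<^esub> x = \<one>\<^bsub>dihedral n\<^esub>"
    using assms
    by (intro bexI[of _ "if snd x then x else ((- fst x) mod int n, False)"])
      (auto simp: dihedral_def case_prod_beta mod_simps)
next
  fix x y z :: "int \<times> bool"
  show "x \<otimes>\<^bsub>dihedral n\<^esub> y \<otimes>\<^bsub>dihedral n\<^esub> z = x \<otimes>\<^bsub>dihedral n\<^esub> (y \<otimes>\<^bsub>dihedral n\<^esub> z)"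
    by (auto simp: dihedral_def case_prod_beta mod_simps algebra_simps)
qed (use assms in \<open>auto simp: dihedral_def\<close>)

lemma order_dihedral: "order (dihedral n) = 2 * n"
  by (simp add: order_def dihedral_def)

lemma dihedral_pow_sigma:
  assumes "0 < n"
  shows "dih_sigma n [^]\<^bsub>dihedral n\<^esub> (k::nat) = (int k mod int n, False)"
proof -
  interpret group "dihedral n" using assms by (rule group_dihedral)
  show ?thesis
    by (induction k) (auto simp: dihedral_def dih_sigma_def mod_simps algebra_simps)
qed

lemma dihedral_relations:
  assumes "0 < n"
  shows "dih_sigma n [^]\<^bsub>dihedral n\<^esub> n = \<one>\<^bsub>dihedral n\<^esub>"
    and "dih_tau [^]\<^bsub>dihedral n\<^esub> (2::nat) = \<one>\<^bsub>dihedral n\<^esub>"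
    and "dih_tau \<otimes>\<^bsub>dihedral n\<^esub> dih_sigma n \<otimes>\<^bsub>dihedral n\<^esub> inv\<^bsub>dihedral n\<^esub> dih_tau
      = inv\<^bsub>dihedral n\<^esub> (dih_sigma n)"
proof -
  interpret group "dihedral n" using assms by (rule group_dihedral)
  have c: "dih_tau \<in> carrier (dihedral n)" "dih_sigma n \<in> carrier (dihedral n)"
    using assms by (auto simp: dihedral_def dih_tau_def dih_sigma_def)
  show "dih_sigma n [^]\<^bsub>dihedral n\<^esub> n = \<one>\<^bsub>dihedral n\<^esub>"
    using assms by (simp add: dihedral_pow_sigma) (simp add: dihedral_def)
  have tt: "dih_tau \<otimes>\<^bsub>dihedral n\<^esub> dih_tau = \<one>\<^bsub>dihedral n\<^esub>"
    using assms by (simp add: dihedral_def dih_tau_def)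
  then show "dih_tau [^]\<^bsub>dihedral n\<^esub> (2::nat) = \<one>\<^bsub>dihedral n\<^esub>"
    using c by (simp add: numeral_2_eq_2)
  have "inv\<^bsub>dihedral n\<^esub> dih_tau = dih_tau" using tt c by (simp add: inv_equality)
  moreover have "inv\<^bsub>dihedral n\<^esub> (dih_sigma n) =
      dih_tau \<otimes>\<^bsub>dihedral n\<^esub> dih_sigma n \<otimes>\<^bsub>dihedral n\<^esub> dih_tau"
    by (rule inv_equality)
      (use c in \<open>auto simp: dihedral_def dih_tau_def dih_sigma_def mod_simps\<close>)
  ultimately show "dih_tau \<otimes>\<^bsub>dihedral n\<^esub> dih_sigma n \<otimes>\<^bsub>dihedral n\<^esub> inv\<^bsub>dihedral n\<^esub> dih_tau
      = inv\<^bsub>dihedral n\<^esub> (dih_sigma n)" by simp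
qed

lemma generate_dihedral:
  assumes "0 < n"
  shows "generate (dihedral n) {dih_sigma n, dih_tau} = carrier (dihedral n)"
proof
  interpret group "dihedral n" using assms by (rule group_dihedral)
  have c: "dih_tau \<in> carrier (dihedral n)" "dih_sigma n \<in> carrier (dihedral n)"
    using assms by (auto simp: dihedral_def dih_tau_def dih_sigma_def)
  then show "generate (dihedral n) {dih_sigma n, dih_tau} \<subseteq> carrier (dihedral n)"
    by (intro generate_incl) auto
  have sg: "subgroup (generate (dihedral n) {dih_sigma n, dih_tau}) (dihedral n)"
    using c by (intro generate_is_subgroup) auto
  have pow: "dih_sigma n [^]\<^bsub>dihedral n\<^esub> (k::nat) \<in> generate (dihedral n) {dih_sigma n, dih_tau}" for k
    by (induction k)
      (auto intro: subgroup.one_closed[OF sg] subgroup.m_closed[OF sg] generate.incl)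
  show "carrier (dihedral n) \<subseteq> generate (dihedral n) {dih_sigma n, dih_tau}"
  proof
    fix x assume "x \<in> carrier (dihedral n)"
    then obtain i a where x: "x = (i, a)" "0 \<le> i" "i < int n" by (auto simp: dihedral_def)
    have i: "dih_sigma n [^]\<^bsub>dihedral n\<^esub> nat i = (i, False)"
      using x assms by (simp only: dihedral_pow_sigma) simp
    have "(i, False) \<otimes>\<^bsub>dihedral n\<^esub> dih_tau = (i, True)"
      using x by (simp add: dihedral_def dih_tau_def)
    then show "x \<in> generate (dihedral n) {dih_sigma n, dih_tau}"
      using pow[of "nat i"] generate.incl[of dih_tau "{dih_sigma n, dih_tau}" "dihedral n"]
        subgroup.m_closed[OF sg] x(1) i by (metis (full_types) insertI1 insertI2)
  qed
qed


section \<open>Lattices over a finite group\<close>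

text \<open>The underlying abelian group is a (multiplicatively written) \<open>HOL-Algebra\<close> group.\<close>

record ('m, 'g) gmodule = "'m monoid" +
  action :: "'g \<Rightarrow> 'm \<Rightarrow> 'm"

locale G_lattice = G: group G + M: comm_group M
  for G :: "('g, 'c) monoid_scheme" and M :: "('m, 'g, 'd) gmodule_scheme" +
  assumes finite_group: "finite (carrier G)"
    and action_hom: "g \<in> carrier G \<Longrightarrow> action M g \<in> hom M M"
    and action_one: "m \<in> carrier M \<Longrightarrow> action M \<one>\<^bsub>G\<^esub> m = m"
    and action_mult: "\<lbrakk>g \<in> carrier G; h \<in> carrier G; m \<in> carrier M\<rbrakk> \<Longrightarrow>
      action M (g \<otimes>\<^bsub>G\<^esub> h) m = action M g (action M h m)"
    and finitely_generated: "\<exists>A. finite A \<and> A \<subseteq> carrier M \<and>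
      generate M (\<Union>g\<in>carrier G. action M g ` A) = carrier M"
    and torsion_free: "\<lbrakk>m \<in> carrier M; 0 < k; m [^]\<^bsub>M\<^esub> (k::nat) = \<one>\<^bsub>M\<^esub>\<rbrakk> \<Longrightarrow> m = \<one>\<^bsub>M\<^esub>"

definition lattice_iso ::
  "('g, 'c) monoid_scheme \<Rightarrow> ('m, 'g, 'd) gmodule_scheme \<Rightarrow> ('k, 'g, 'e) gmodule_scheme \<Rightarrow> bool"
where
  "lattice_iso G M N \<longleftrightarrow> G_lattice G M \<and> G_lattice G N \<and>
    (\<exists>f \<in> iso M N. \<forall>g\<in>carrier G. \<forall>m\<in>carrier M. f (action M g m) = action N g (f m))"

definition direct_sum ::
  "('m, 'g, 'd) gmodule_scheme \<Rightarrow> ('k, 'g, 'e) gmodule_scheme \<Rightarrow> ('m \<times> 'k, 'g) gmodule"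
  (infixr "\<oplus>\<^sub>L" 65) where
  "M \<oplus>\<^sub>L N = monoid.extend (M \<times>\<times> N)
    \<lparr>action = (\<lambda>g (x, y). (action M g x, action N g y))\<rparr>"

definition trivial_lattice :: "(int, 'g) gmodule" where
  "trivial_lattice = monoid.extend integer_group \<lparr>action = (\<lambda>_ x. x)\<rparr>"

definition permutation_lattice ::
  "('g, 'c) monoid_scheme \<Rightarrow> 'g set \<Rightarrow> ('g set \<Rightarrow>\<^sub>0 int, 'g) gmodule" where
  "permutation_lattice G S = monoid.extend (free_Abelian_group (lcosets\<^bsub>G\<^esub> S))
    \<lparr>action = (\<lambda>g. frag_extend (\<lambda>C. frag_of (g <#\<^bsub>G\<^esub> C)))\<rparr>"


section \<open>Relation modules\<close>

definition conj_by :: "('a, 'b) monoid_scheme \<Rightarrow> 'a \<Rightarrow> 'a \<Rightarrow> 'a" where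
  "conj_by F x r = x \<otimes>\<^bsub>F\<^esub> r \<otimes>\<^bsub>F\<^esub> inv\<^bsub>F\<^esub> x"

text \<open>For \<open>R\<close> the kernel of \<open>\<epsilon> : F \<rightarrow> G\<close>, the underlying group is \<open>R / [R,R]\<close>, and \<open>g \<in> G\<close> acts by
  conjugation with a preimage of \<open>g\<close> in \<open>F\<close>; the choice is immaterial by
  \<open>relation_module_action\<close> below.\<close>

definition relation_module ::
  "('a, 'b) monoid_scheme \<Rightarrow> ('g, 'c) monoid_scheme \<Rightarrow> ('a \<Rightarrow> 'g) \<Rightarrow> ('a set, 'g) gmodule" where
  "relation_module F G \<epsilon> = monoid.extend
    (F\<lparr>carrier := kernel F G \<epsilon>\<rparr> Mod derived F (kernel F G \<epsilon>))
    \<lparr>action = (\<lambda>g C. conj_by F (SOME x. x \<in> carrier F \<and> \<epsilon> x = g) ` C)\<rparr>"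

lemma relation_module_action:
  assumes "group_hom F G \<epsilon>" and x: "x \<in> carrier F" and r: "r \<in> kernel F G \<epsilon>"
  shows "action (relation_module F G \<epsilon>) (\<epsilon> x) (derived F (kernel F G \<epsilon>) #>\<^bsub>F\<^esub> r)
    = derived F (kernel F G \<epsilon>) #>\<^bsub>F\<^esub> conj_by F x r"
proof -
  interpret group_hom F G \<epsilon> by fact
  let ?R = "kernel F G \<epsilon>"
  let ?D = "derived F ?R"
  have Rn: "?R \<lhd> F" by (rule normal_kernel)
  then have Rs: "subgroup ?R F" by (simp add: normal_imp_subgroup)
  have Rc: "?R \<subseteq> carrier F" using Rs by (rule subgroup.subset)
  have Dn: "?D \<lhd> F" by (rule G.derived_is_normal[OF Rn])
  have Dc: "?D \<subseteq> carrier F" using Rc by (rule G.derived_in_carrier)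
  have Ds: "subgroup ?D F" using Rc by (rule G.derived_is_subgroup)
  have img: "conj_by F y ` (?D #>\<^bsub>F\<^esub> r) = ?D #>\<^bsub>F\<^esub> conj_by F y r" if y: "y \<in> carrier F" for y
  proof -
    have rc: "r \<in> carrier F" using r Rc by auto
    have split: "conj_by F y (d \<otimes>\<^bsub>F\<^esub> r) = conj_by F y d \<otimes>\<^bsub>F\<^esub> conj_by F y r"
      if "d \<in> ?D" for d
    proof -
      have "d \<in> carrier F" using that Dc by auto
      then show ?thesis using y rc
        by (simp add: conj_by_def G.m_assoc G.inv_solve_left)
    qed
    have "conj_by F y ` ?D = ?D"
    proof
      show 1: "conj_by F y ` ?D \<subseteq> ?D"
        using normal.inv_op_closed2[OF Dn y] by (auto simp: conj_by_def)
      have "d \<in> conj_by F y ` ?D" if d: "d \<in> ?D" for d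
      proof (rule image_eqI)
        show "inv\<^bsub>F\<^esub> y \<otimes>\<^bsub>F\<^esub> d \<otimes>\<^bsub>F\<^esub> y \<in> ?D" using normal.inv_op_closed1[OF Dn y d] .
        have "d \<in> carrier F" using d Dc by auto
        then show "d = conj_by F y (inv\<^bsub>F\<^esub> y \<otimes>\<^bsub>F\<^esub> d \<otimes>\<^bsub>F\<^esub> y)"
          using y by (simp add: conj_by_def G.m_assoc) (simp add: G.m_assoc[symmetric])
      qed
      then show "?D \<subseteq> conj_by F y ` ?D" by auto
    qed
    moreover have "conj_by F y ` (?D #>\<^bsub>F\<^esub> r)
        = (\<lambda>d. d \<otimes>\<^bsub>F\<^esub> conj_by F y r) ` (conj_by F y ` ?D)"
      using split by (auto simp: r_coset_def image_iff) 
    ultimately show ?thesis by (auto simp: r_coset_def)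
  qed
  define z where "z = (SOME y. y \<in> carrier F \<and> \<epsilon> y = \<epsilon> x)"
  have z: "z \<in> carrier F" "\<epsilon> z = \<epsilon> x"
    unfolding z_def using someI[of "\<lambda>y. y \<in> carrier F \<and> \<epsilon> y = \<epsilon> x" x] x by auto
  define s where "s = inv\<^bsub>F\<^esub> z \<otimes>\<^bsub>F\<^esub> x"
  have s: "s \<in> ?R" using z x by (auto simp: s_def kernel_def)
  have sc: "s \<in> carrier F" and rc: "r \<in> carrier F" using s r Rc by auto
  have xzs: "x = z \<otimes>\<^bsub>F\<^esub> s" using z x by (simp add: s_def G.m_assoc[symmetric])
  define d where "d = s \<otimes>\<^bsub>F\<^esub> r \<otimes>\<^bsub>F\<^esub> inv\<^bsub>F\<^esub> s \<otimes>\<^bsub>F\<^esub> inv\<^bsub>F\<^esub> r"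
  have d: "d \<in> ?D" using s r by (auto simp: d_def derived_def intro!: generate.incl)
  have dc: "d \<in> carrier F" using d Dc by auto
  have "conj_by F x r = conj_by F z (d \<otimes>\<^bsub>F\<^esub> r)"
    using z(1) sc rc
    by (simp add: xzs conj_by_def d_def G.m_assoc G.inv_mult_group)
  also have "\<dots> = conj_by F z d \<otimes>\<^bsub>F\<^esub> conj_by F z r"
    using z(1) dc rc by (simp add: conj_by_def G.m_assoc G.inv_solve_left)
  finally have eq: "conj_by F x r = conj_by F z d \<otimes>\<^bsub>F\<^esub> conj_by F z r" .
  have zd: "conj_by F z d \<in> ?D" using normal.inv_op_closed2[OF Dn z(1) d] by (simp add: conj_by_def)
  moreover from this have zdc: "conj_by F z d \<in> carrier F" using Dc by auto
  moreover have "conj_by F z r \<in> carrier F" using z(1) rc by (simp add: conj_by_def)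
  ultimately have "?D #>\<^bsub>F\<^esub> conj_by F x r = ?D #>\<^bsub>F\<^esub> conj_by F z r"
    by (simp add: eq G.coset_mult_assoc[OF Dc, symmetric] G.coset_join2[OF zdc Ds zd])
  then show ?thesis
    using img[OF z(1)] by (simp add: relation_module_def monoid.defs z_def)
qed


section \<open>The lattices \<open>M\<^sub>+\<close> and its extension\<close>

text \<open>The action of \<open>D\<^sub>n\<close> determined by the operators \<open>s\<close> of \<open>\<sigma>\<close> and \<open>t\<close> of \<open>\<tau>\<close>.\<close>

definition dihedral_action :: "('m \<Rightarrow> 'm) \<Rightarrow> ('m \<Rightarrow> 'm) \<Rightarrow> int \<times> bool \<Rightarrow> 'm \<Rightarrow> 'm" where
  "dihedral_action s t = (\<lambda>(i, a). (s ^^ nat i) \<circ> (if a then t else id))"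

text \<open>\<open>M\<^sub>+\<close> is the trivial lattice induced from \<open>\<langle>\<tau>\<rangle>\<close>, in its basis \<open>x\<^sub>i\<close> = \<open>frag_of i\<close>
  corresponding to the cosets \<open>\<sigma>\<^sup>i\<langle>\<tau>\<rangle>\<close>.\<close>

definition M_plus :: "nat \<Rightarrow> (int \<Rightarrow>\<^sub>0 int, int \<times> bool) gmodule" where
  "M_plus n = monoid.extend (free_Abelian_group {0..<int n})
    \<lparr>action = dihedral_action
      (frag_extend (\<lambda>i. frag_of ((i + 1) mod int n)))
      (frag_extend (\<lambda>i. frag_of ((- i) mod int n)))\<rparr>"

text \<open>The basis element \<open>x\<^sub>i\<close> is \<open>frag_of (Some i)\<close>, and \<open>w\<close> is \<open>frag_of None\<close>.\<close>

definition M_tilde_plus :: "nat \<Rightarrow> (int option \<Rightarrow>\<^sub>0 int, int \<times> bool) gmodule" where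
  "M_tilde_plus n = monoid.extend (free_Abelian_group (insert None (Some ` {0..<int n})))
    \<lparr>action = dihedral_action
      (frag_extend (\<lambda>b. case b of
          Some i \<Rightarrow> frag_of (Some ((i + 1) mod int n))
        | None \<Rightarrow> frag_of None))
      (frag_extend (\<lambda>b. case b of
          Some i \<Rightarrow> frag_of (Some ((- i) mod int n))
        | None \<Rightarrow> - frag_of None + (\<Sum>i\<in>{0..<int n}. frag_of (Some i))))\<rparr>"

end

theory Submission
  imports Defs
begin

text \<open>Write \<open>s\<^sub>1, s\<^sub>2\<close> for the free generators. The relation module is generated, as a lattice with
\<open>D\<^sub>n\<close>-action, by the classes \<open>w = [s\<^sub>1\<^sup>n]\<close>, \<open>a = [s\<^sub>2\<^sup>2]\<close> and \<open>b = [(s\<^sub>1s\<^sub>2)\<^sup>2]\<close> of the relators of the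
dihedral group. Conjugating a relator by its own root does nothing, so they are fixed by \<open>\<sigma>\<close>, by
\<open>\<tau>\<close> and by \<open>\<sigma>\<tau>\<close> respectively. For odd \<open>n\<close> all reflections are conjugate: with \<open>j = (n - 1) / 2\<close> the
element \<open>\<sigma>\<^sup>jb\<close> is fixed by \<open>\<tau>\<close>, and so is \<open>y = \<sigma>\<^sup>jb - a\<close>. The \<open>\<sigma>\<close>-orbits of \<open>a\<close> and of \<open>y\<close> are then
permuted by \<open>D\<^sub>n\<close> like the basis of \<open>M\<^sub>+\<close>, while the telescoping product
\<open>s\<^sub>1\<^sup>nt\<^sup>n = \<Prod>\<^sub>i s\<^sub>1\<^sup>i(s\<^sub>1t)s\<^sub>1\<^sup>-\<^sup>i\<close> for \<open>t = s\<^sub>2s\<^sub>1s\<^sub>2\<^sup>-\<^sup>1\<close>, together with \<open>[s\<^sub>1t] = b - a\<close>, gives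
\<open>w + \<tau>w = \<Sum>\<^sub>i \<sigma>\<^sup>iy\<close>, the relation that defines the extension \<open>M'\<close> of \<open>M\<^sub>+\<close>. So \<open>x\<^sub>i \<mapsto> \<sigma>\<^sup>ia\<close> on the first
summand and \<open>x\<^sub>i \<mapsto> \<sigma>\<^sup>iy\<close>, \<open>w \<mapsto> w\<close> on the second is an equivariant homomorphism from
\<open>M\<^sub>+ \<oplus> M'\<close> onto a stable subgroup of the relation module.

It is surjective because a stable subgroup that contains the three classes has a normal preimage \<open>H\<close>
in \<open>F\<close>, and the generators of \<open>F / H\<close> satisfy the dihedral relations; hence \<open>F \<rightarrow> F / H\<close> factors through
\<open>D\<^sub>n\<close> and \<open>H\<close> contains the kernel (\<open>stable_subgroup_eq_carrier\<close>, resting on \<open>dihedral_hom\<close>).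
It is injective because the \<open>2n + 1\<close> images are told apart by Fox derivatives: these are crossed
homomorphisms on \<open>F\<close> whose coefficients restrict to homomorphisms from the relation module to the
integers, and on the images they form a triangular system (\<open>lattice_iso_relation_module\<close>).

For the second isomorphism, \<open>M\<^sub>+\<close> is the permutation lattice on the cosets of \<open>\<langle>\<tau>\<rangle>\<close>, and \<open>M'\<close>
plus a trivial summand is \<open>\<int>[D\<^sub>n/\<langle>\<sigma>\<rangle>] \<oplus> M\<^sub>+\<close> (\<open>lattice_iso_M_tilde_plus_trivial\<close>), by a base
change of determinant \<open>2c - n\<close>, which a suitable integer \<open>c\<close> makes equal to \<open>1\<close> since \<open>n\<close> is odd.\<close>

section \<open>Lattices and their isomorphisms\<close>

lemma extend_simps [simp]:
  "carrier (monoid.extend M e) = carrier M"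
  "x \<otimes>\<^bsub>monoid.extend M e\<^esub> y = x \<otimes>\<^bsub>M\<^esub> y"
  "\<one>\<^bsub>monoid.extend M e\<^esub> = \<one>\<^bsub>M\<^esub>"
  "action (monoid.extend M \<lparr>action = a\<rparr>) = a"
  by (simp_all add: monoid.defs)

lemma group_extend [simp]: "group (monoid.extend M e) \<longleftrightarrow> group M"
  unfolding group_def group_axioms_def Group.monoid_def Units_def extend_simps ..

lemma comm_group_extend [simp]: "comm_group (monoid.extend M e) \<longleftrightarrow> comm_group M"
  unfolding comm_group_def comm_monoid_def comm_monoid_axioms_def Group.monoid_def group_extend
    extend_simps ..

lemma hom_extend [simp]:
  "hom (monoid.extend M e) N = hom M N" "hom N (monoid.extend M e) = hom N M"
  by (simp_all add: hom_def)

lemma inv_extend [simp]: "m_inv (monoid.extend M e) x = m_inv M x"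
  by (simp add: m_inv_def)

lemma generate_extend [simp]: "generate (monoid.extend M e) A = generate M A"
proof (intro equalityI subsetI)
  fix x
  show "x \<in> generate M A" if "x \<in> generate (monoid.extend M e) A"
    using that by (induction rule: generate.induct) (auto intro: generate.intros)
  show "x \<in> generate (monoid.extend M e) A" if "x \<in> generate M A"
    using that
  proof (induction rule: generate.induct)
    case one show ?case using generate.one[of "monoid.extend M e" A] by simp
  next
    case (incl h) then show ?case by (rule generate.incl)
  next
    case (inv h) then show ?case using generate.inv[of h A "monoid.extend M e"] by simp
  next
    case (eng h1 h2)
    from generate.eng[OF eng.IH] show ?case by simp
  qed
qed

lemma pow_extend [simp]: "x [^]\<^bsub>monoid.extend M e\<^esub> (k::nat) = x [^]\<^bsub>M\<^esub> k"
  by (simp add: nat_pow_def)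

lemma hom_eq_on_generate:
  assumes "group M" "group N" "f \<in> hom M N" "g \<in> hom M N" "A \<subseteq> carrier M"
    and eq: "\<And>x. x \<in> A \<Longrightarrow> f x = g x" and "y \<in> generate M A"
  shows "f y = g y"
proof -
  interpret f: group_hom M N f using assms by (simp add: group_hom_def group_hom_axioms_def)
  interpret g: group_hom M N g using assms by (simp add: group_hom_def group_hom_axioms_def)
  have c: "z \<in> carrier M" if "z \<in> generate M A" for z
    using f.G.generate_in_carrier[OF \<open>A \<subseteq> carrier M\<close> that] .
  from \<open>y \<in> generate M A\<close> show ?thesis
    using eq c \<open>A \<subseteq> carrier M\<close> by (induction rule: generate.induct) (auto simp: subset_iff)
qed

lemma generate_free_Abelian_group:
  "generate (free_Abelian_group S) (frag_of ` S) = carrier (free_Abelian_group S)"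
proof -
  interpret group "free_Abelian_group S" by simp
  let ?A = "generate (free_Abelian_group S) (frag_of ` S)"
  have sub: "subgroup ?A (free_Abelian_group S)"
    by (rule generate_is_subgroup) auto
  have "x \<in> ?A" if "Poly_Mapping.keys x \<subseteq> S" for x
    using that
  proof (rule free_Abelian_group_induct)
    show "0 \<in> ?A" using subgroup.one_closed[OF sub] by simp
    show "x - y \<in> ?A"
      if "Poly_Mapping.keys x \<subseteq> S" "Poly_Mapping.keys y \<subseteq> S" "x \<in> ?A" "y \<in> ?A" for x y
      using subgroup.m_closed[OF sub that(3) subgroup.m_inv_closed[OF sub that(4)]] that by simp
    show "frag_of a \<in> ?A" if "a \<in> S" for a using that by (auto intro: generate.incl)
  qed
  then show ?thesis using subgroup.subset[OF sub] by auto
qed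

lemma generate_DirProd:
  assumes "group M" "group N" "A \<subseteq> carrier M" "B \<subseteq> carrier N"
    and "generate M A = carrier M" "generate N B = carrier N"
  shows "generate (M \<times>\<times> N) ((\<lambda>x. (x, \<one>\<^bsub>N\<^esub>)) ` A \<union> (\<lambda>y. (\<one>\<^bsub>M\<^esub>, y)) ` B)
    = carrier (M \<times>\<times> N)" (is "generate _ ?Z = _")
proof -
  interpret M: group M by fact
  interpret N: group N by fact
  interpret P: group "M \<times>\<times> N" using assms by (simp add: DirProd_group)
  have Z: "?Z \<subseteq> carrier (M \<times>\<times> N)" using assms by auto
  have 1: "(x, \<one>\<^bsub>N\<^esub>) \<in> generate (M \<times>\<times> N) ?Z" if "x \<in> generate M A" for x
    using that
  proof (induction rule: generate.induct)
    case one then show ?case using generate.one[of "M \<times>\<times> N" ?Z] by simp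
  next
    case (incl h) then show ?case by (auto intro: generate.incl)
  next
    case (inv h)
    then have "inv\<^bsub>M \<times>\<times> N\<^esub> (h, \<one>\<^bsub>N\<^esub>) = (inv\<^bsub>M\<^esub> h, \<one>\<^bsub>N\<^esub>)" using assms by auto
    moreover have "inv\<^bsub>M \<times>\<times> N\<^esub> (h, \<one>\<^bsub>N\<^esub>) \<in> generate (M \<times>\<times> N) ?Z" using inv by (auto intro: generate.inv)
    ultimately show ?case by simp
  next
    case (eng h1 h2)
    from generate.eng[OF eng.IH] show ?case by simp
  qed
  have 2: "(\<one>\<^bsub>M\<^esub>, x) \<in> generate (M \<times>\<times> N) ?Z" if "x \<in> generate N B" for x
    using that
  proof (induction rule: generate.induct)
    case one then show ?case using generate.one[of "M \<times>\<times> N" ?Z] by simp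
  next
    case (incl h) then show ?case by (auto intro: generate.incl)
  next
    case (inv h)
    then have "inv\<^bsub>M \<times>\<times> N\<^esub> (\<one>\<^bsub>M\<^esub>, h) = (\<one>\<^bsub>M\<^esub>, inv\<^bsub>N\<^esub> h)" using assms by auto
    moreover have "inv\<^bsub>M \<times>\<times> N\<^esub> (\<one>\<^bsub>M\<^esub>, h) \<in> generate (M \<times>\<times> N) ?Z" using inv by (auto intro: generate.inv)
    ultimately show ?case by simp
  next
    case (eng h1 h2)
    from generate.eng[OF eng.IH] show ?case by simp
  qed
  have "(x, y) \<in> generate (M \<times>\<times> N) ?Z" if "x \<in> carrier M" "y \<in> carrier N" for x y
    using generate.eng[OF 1[of x] 2[of y]] that assms by simp
  then show ?thesis using P.generate_incl[OF Z] by auto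
qed

lemma frag_extend_hom:
  assumes "\<And>s. s \<in> S \<Longrightarrow> Poly_Mapping.keys (f s) \<subseteq> T"
  shows "frag_extend f \<in> hom (free_Abelian_group S) (free_Abelian_group T)"
proof (rule homI)
  fix x assume "x \<in> carrier (free_Abelian_group S)"
  then have "(\<Union>s\<in>Poly_Mapping.keys x. Poly_Mapping.keys (f s)) \<subseteq> T" using assms by auto
  then show "frag_extend f x \<in> carrier (free_Abelian_group T)"
    using keys_frag_extend[of f x] by auto
qed (simp add: frag_extend_add)

text \<open>Both sides of each module axiom are homomorphisms in the module element, so the axioms need checking
on generators only.\<close>

lemma G_latticeI:
  assumes "group G" "finite (carrier G)" "comm_group M" "finite A" "A \<subseteq> carrier M"
    and gen: "generate M A = carrier M"
    and hom: "\<And>g. g \<in> carrier G \<Longrightarrow> action M g \<in> hom M M"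
    and one: "\<And>m. m \<in> A \<Longrightarrow> action M \<one>\<^bsub>G\<^esub> m = m"
    and mult: "\<And>g h m. \<lbrakk>g \<in> carrier G; h \<in> carrier G; m \<in> A\<rbrakk> \<Longrightarrow>
      action M (g \<otimes>\<^bsub>G\<^esub> h) m = action M g (action M h m)"
    and tf: "\<And>m k. \<lbrakk>m \<in> carrier M; 0 < k; m [^]\<^bsub>M\<^esub> (k::nat) = \<one>\<^bsub>M\<^esub>\<rbrakk> \<Longrightarrow> m = \<one>\<^bsub>M\<^esub>"
  shows "G_lattice G M"
proof -
  interpret G: group G by fact
  interpret M: comm_group M by fact
  have one': "action M \<one>\<^bsub>G\<^esub> m = m" if "m \<in> carrier M" for m
    using hom_eq_on_generate[of M M "action M \<one>\<^bsub>G\<^esub>" id A m] assms that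
    by (auto simp: M.is_group id_iso iso_imp_homomorphism)
  have mult': "action M (g \<otimes>\<^bsub>G\<^esub> h) m = action M g (action M h m)"
    if "g \<in> carrier G" "h \<in> carrier G" "m \<in> carrier M" for g h m
    using hom_eq_on_generate[of M M "action M (g \<otimes>\<^bsub>G\<^esub> h)" "action M g \<circ> action M h" A m]
      assms that by (auto simp: M.is_group intro: Group.hom_compose)
  have clos: "action M g m \<in> carrier M" if "g \<in> carrier G" "m \<in> carrier M" for g m
    using hom[OF that(1)] that(2) by (auto simp: hom_def)
  have "generate M A \<subseteq> generate M (\<Union>g\<in>carrier G. action M g ` A)"
  proof (rule M.mono_generate, rule subsetI)
    fix a assume "a \<in> A"
    then show "a \<in> (\<Union>g\<in>carrier G. action M g ` A)"
      using one[of a] by (intro UN_I[of "\<one>\<^bsub>G\<^esub>"]) force+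
  qed
  moreover have "generate M (\<Union>g\<in>carrier G. action M g ` A) \<subseteq> carrier M"
    using assms clos by (intro M.generate_incl) auto
  ultimately have "generate M (\<Union>g\<in>carrier G. action M g ` A) = carrier M" using gen by auto
  then have fg: "\<exists>B. finite B \<and> B \<subseteq> carrier M \<and>
      generate M (\<Union>g\<in>carrier G. action M g ` B) = carrier M"
    using assms(4,5) by blast
  show ?thesis
    by (rule G_lattice.intro[OF assms(1,3)
      G_lattice_axioms.intro[OF assms(2) hom one' mult' fg tf]])
qed

lemma G_lattice_free:
  assumes "group G" "finite (carrier G)" "finite S"
    and hom: "\<And>g. g \<in> carrier G \<Longrightarrow> act g \<in> hom (free_Abelian_group S) (free_Abelian_group S)"
    and one: "\<And>s. s \<in> S \<Longrightarrow> act \<one>\<^bsub>G\<^esub> (frag_of s) = frag_of s"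
    and mult: "\<And>g h s. \<lbrakk>g \<in> carrier G; h \<in> carrier G; s \<in> S\<rbrakk> \<Longrightarrow>
      act (g \<otimes>\<^bsub>G\<^esub> h) (frag_of s) = act g (act h (frag_of s))"
  shows "G_lattice G (monoid.extend (free_Abelian_group S) \<lparr>action = act\<rparr>)"
proof (rule G_latticeI[where A = "frag_of ` S"])
  fix m and k :: nat
  assume "m [^]\<^bsub>monoid.extend (free_Abelian_group S) \<lparr>action = act\<rparr>\<^esub> k
    = \<one>\<^bsub>monoid.extend (free_Abelian_group S) \<lparr>action = act\<rparr>\<^esub>" "0 < k"
  then have k0: "frag_cmul (int k) m = 0" by simp
  have "m = 0"
  proof (rule poly_mapping_eqI)
    fix s
    have "int k * Poly_Mapping.lookup m s = 0"
      using arg_cong[OF k0, of "\<lambda>f. Poly_Mapping.lookup f s"] by simp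
    then show "Poly_Mapping.lookup m s = Poly_Mapping.lookup 0 s" using \<open>0 < k\<close> by simp
  qed
  then show "m = \<one>\<^bsub>monoid.extend (free_Abelian_group S) \<lparr>action = act\<rparr>\<^esub>" by simp
qed (use assms in \<open>auto simp: generate_free_Abelian_group abelian_free_Abelian_group\<close>)

lemma carrier_direct_sum [simp]: "carrier (M \<oplus>\<^sub>L N) = carrier M \<times> carrier N"
  and one_direct_sum [simp]: "\<one>\<^bsub>M \<oplus>\<^sub>L N\<^esub> = (\<one>\<^bsub>M\<^esub>, \<one>\<^bsub>N\<^esub>)"
  and mult_direct_sum [simp]: "(x, y) \<otimes>\<^bsub>M \<oplus>\<^sub>L N\<^esub> (x', y') = (x \<otimes>\<^bsub>M\<^esub> x', y \<otimes>\<^bsub>N\<^esub> y')"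
  and action_direct_sum [simp]: "action (M \<oplus>\<^sub>L N) g (x, y) = (action M g x, action N g y)"
  by (simp_all add: direct_sum_def)

lemma generate_direct_sum:
  assumes "group M" "group N" "A \<subseteq> carrier M" "B \<subseteq> carrier N"
    and "generate M A = carrier M" "generate N B = carrier N"
  shows "generate (M \<oplus>\<^sub>L N) ((\<lambda>x. (x, \<one>\<^bsub>N\<^esub>)) ` A \<union> (\<lambda>y. (\<one>\<^bsub>M\<^esub>, y)) ` B)
    = carrier (M \<oplus>\<^sub>L N)"
  using generate_DirProd[OF assms] by (simp add: direct_sum_def)

lemma comm_group_direct_sum: 
  assumes "comm_group M" "comm_group N" shows "comm_group (M \<oplus>\<^sub>L N)"
proof -
  interpret M: comm_group M by fact
  interpret N: comm_group N by fact
  have "comm_group (M \<times>\<times> N)"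
    by (rule group.group_comm_groupI[OF DirProd_group]) (auto simp: M.m_comm N.m_comm M.is_group N.is_group)
  then show ?thesis by (simp add: direct_sum_def)
qed

lemma pow_direct_sum: "(x, y) [^]\<^bsub>M \<oplus>\<^sub>L N\<^esub> (k::nat) = (x [^]\<^bsub>M\<^esub> k, y [^]\<^bsub>N\<^esub> k)"
  by (induction k) (simp_all add: nat_pow_def)

lemma G_lattice_imp_finite_generators:
  assumes "G_lattice G M"
  obtains A where "finite A" "A \<subseteq> carrier M" "generate M A = carrier M"
proof -
  interpret G_lattice G M by fact
  obtain A where A: "finite A" "A \<subseteq> carrier M" 
    "generate M (\<Union>g\<in>carrier G. action M g ` A) = carrier M"
    using finitely_generated by blast
  show thesis
  proof (rule that[of "\<Union>g\<in>carrier G. action M g ` A"])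
    show "finite (\<Union>g\<in>carrier G. action M g ` A)" using A finite_group by auto
    show "(\<Union>g\<in>carrier G. action M g ` A) \<subseteq> carrier M"
      using A(2) action_hom by (force simp: hom_def)
  qed (rule A(3))
qed

lemma G_lattice_direct_sum:
  assumes "G_lattice G M" "G_lattice G N"
  shows "G_lattice G (M \<oplus>\<^sub>L N)"
proof -
  interpret M: G_lattice G M by fact
  interpret N: G_lattice G N by fact
  obtain A where A: "finite A" "A \<subseteq> carrier M" "generate M A = carrier M"
    using G_lattice_imp_finite_generators[OF assms(1)] .
  obtain B where B: "finite B" "B \<subseteq> carrier N" "generate N B = carrier N"
    using G_lattice_imp_finite_generators[OF assms(2)] .
  show ?thesis
  proof (rule G_latticeI[OF _ _ comm_group_direct_sum _ _ generate_direct_sum[OF _ _ A(2) B(2) A(3) B(3)]])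
    show "action (M \<oplus>\<^sub>L N) g \<in> hom (M \<oplus>\<^sub>L N) (M \<oplus>\<^sub>L N)" if "g \<in> carrier G" for g
      using M.action_hom[OF that] N.action_hom[OF that]
      by (auto simp: hom_def Pi_iff)
  next
    fix m and k :: nat
    assume "m \<in> carrier (M \<oplus>\<^sub>L N)" "0 < k" "m [^]\<^bsub>M \<oplus>\<^sub>L N\<^esub> k = \<one>\<^bsub>M \<oplus>\<^sub>L N\<^esub>"
    then show "m = \<one>\<^bsub>M \<oplus>\<^sub>L N\<^esub>"
      using M.torsion_free N.torsion_free by (cases m) (auto simp: pow_direct_sum)
  next
    show "finite ((\<lambda>x. (x, \<one>\<^bsub>N\<^esub>)) ` A \<union> Pair \<one>\<^bsub>M\<^esub> ` B)" using A B by auto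
    show "(\<lambda>x. (x, \<one>\<^bsub>N\<^esub>)) ` A \<union> Pair \<one>\<^bsub>M\<^esub> ` B \<subseteq> carrier (M \<oplus>\<^sub>L N)" using A B by auto
    show "action (M \<oplus>\<^sub>L N) \<one>\<^bsub>G\<^esub> m = m" if "m \<in> (\<lambda>x. (x, \<one>\<^bsub>N\<^esub>)) ` A \<union> Pair \<one>\<^bsub>M\<^esub> ` B" for m
      using that A B M.action_one N.action_one by auto
    show "action (M \<oplus>\<^sub>L N) (g \<otimes>\<^bsub>G\<^esub> h) m = action (M \<oplus>\<^sub>L N) g (action (M \<oplus>\<^sub>L N) h m)"
      if "g \<in> carrier G" "h \<in> carrier G" "m \<in> (\<lambda>x. (x, \<one>\<^bsub>N\<^esub>)) ` A \<union> Pair \<one>\<^bsub>M\<^esub> ` B" for g h m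
      using that A B M.action_mult N.action_mult by auto
  qed (fact M.M.is_group N.M.is_group M.M.comm_group_axioms N.M.comm_group_axioms M.finite_group M.G.is_group)+
qed

lemma lattice_isoI:
  assumes "G_lattice G M" "G_lattice G N" "f \<in> iso M N"
    and "\<And>g m. \<lbrakk>g \<in> carrier G; m \<in> carrier M\<rbrakk> \<Longrightarrow> f (action M g m) = action N g (f m)"
  shows "lattice_iso G M N"
  unfolding lattice_iso_def using assms by (intro conjI bexI[of _ f] ballI)

lemma lattice_iso_refl: "G_lattice G M \<Longrightarrow> lattice_iso G M M"
  by (rule lattice_isoI[OF _ _ iso_set_refl]) simp_all

lemma G_lattice_action_closed:
  "\<lbrakk>G_lattice G M; g \<in> carrier G; m \<in> carrier M\<rbrakk> \<Longrightarrow> action M g m \<in> carrier M"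
  using G_lattice.action_hom[of G M g] by (simp add: hom_def Pi_iff)

lemma lattice_iso_sym:
  assumes "lattice_iso G M N" shows "lattice_iso G N M"
proof -
  obtain f where MN: "G_lattice G M" "G_lattice G N" and f: "f \<in> iso M N"
    and eq: "\<And>g m. \<lbrakk>g \<in> carrier G; m \<in> carrier M\<rbrakk> \<Longrightarrow> f (action M g m) = action N g (f m)"
    using assms by (auto simp: lattice_iso_def)
  interpret M: G_lattice G M by fact
  have bij: "bij_betw f (carrier M) (carrier N)" using f by (simp add: iso_def)
  have "inv_into (carrier M) f (action N g m) = action M g (inv_into (carrier M) f m)"
    if g: "g \<in> carrier G" and m: "m \<in> carrier N" for g m
  proof -
    obtain m' where m': "m' \<in> carrier M" "m = f m'"
      using bij m by (auto simp: bij_betw_def)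
    then show ?thesis using g m bij G_lattice_action_closed[OF MN(1) g]
      by (simp flip: eq add: bij_betw_def inv_into_f_f)
  qed
  then show ?thesis by (rule lattice_isoI[OF MN(2,1) M.M.iso_set_sym[OF f]])
qed

lemma lattice_iso_trans [trans]:
  assumes "lattice_iso G M N" "lattice_iso G N P" shows "lattice_iso G M P"
proof -
  obtain f where f: "G_lattice G M" "G_lattice G N" "f \<in> iso M N"
    "\<And>g m. \<lbrakk>g \<in> carrier G; m \<in> carrier M\<rbrakk> \<Longrightarrow> f (action M g m) = action N g (f m)"
    using assms(1) by (auto simp: lattice_iso_def)
  obtain h where h: "G_lattice G N" "G_lattice G P" "h \<in> iso N P"
    "\<And>g m. \<lbrakk>g \<in> carrier G; m \<in> carrier N\<rbrakk> \<Longrightarrow> h (action N g m) = action P g (h m)"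
    using assms(2) by (auto simp: lattice_iso_def)
  have "f m \<in> carrier N" if "m \<in> carrier M" for m
    using f(3) that by (auto simp: iso_def hom_def)
  then have "(h \<circ> f) (action M g m) = action P g ((h \<circ> f) m)"
    if "g \<in> carrier G" "m \<in> carrier M" for g m
    using f(4) h(4) that by simp
  then show ?thesis by (rule lattice_isoI[OF f(1) h(2) iso_set_trans[OF f(3) h(3)]])
qed

lemma lattice_iso_direct_sum:
  assumes "lattice_iso G M M'" "lattice_iso G N N'"
  shows "lattice_iso G (M \<oplus>\<^sub>L N) (M' \<oplus>\<^sub>L N')"
proof -
  obtain f where f: "G_lattice G M" "G_lattice G M'" "f \<in> iso M M'"
    "\<And>g m. \<lbrakk>g \<in> carrier G; m \<in> carrier M\<rbrakk> \<Longrightarrow> f (action M g m) = action M' g (f m)"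
    using assms(1) by (auto simp: lattice_iso_def)
  obtain h where h: "G_lattice G N" "G_lattice G N'" "h \<in> iso N N'"
    "\<And>g m. \<lbrakk>g \<in> carrier G; m \<in> carrier N\<rbrakk> \<Longrightarrow> h (action N g m) = action N' g (h m)"
    using assms(2) by (auto simp: lattice_iso_def)
  have "map_prod f h \<in> iso (M \<oplus>\<^sub>L N) (M' \<oplus>\<^sub>L N')"
    using f(3) h(3) by (auto simp: iso_def hom_def Pi_iff bij_betw_map_prod)
  moreover have "map_prod f h (action (M \<oplus>\<^sub>L N) g m) = action (M' \<oplus>\<^sub>L N') g (map_prod f h m)"
    if "g \<in> carrier G" "m \<in> carrier (M \<oplus>\<^sub>L N)" for g m
    using that f(4) h(4) by (cases m) auto
  ultimately show ?thesis
    by (rule lattice_isoI[OF G_lattice_direct_sum[OF f(1) h(1)] G_lattice_direct_sum[OF f(2) h(2)]])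
qed

lemma lattice_iso_direct_sum_assoc:
  assumes "G_lattice G M" "G_lattice G N" "G_lattice G P"
  shows "lattice_iso G ((M \<oplus>\<^sub>L N) \<oplus>\<^sub>L P) (M \<oplus>\<^sub>L (N \<oplus>\<^sub>L P))"
proof -
  let ?f = "\<lambda>((x, y), z). (x, (y, z))"
  have "bij_betw ?f ((carrier M \<times> carrier N) \<times> carrier P) (carrier M \<times> (carrier N \<times> carrier P))"
    by (rule bij_betwI[where g = "\<lambda>(x, (y, z)). ((x, y), z)"]) auto
  then have "?f \<in> iso ((M \<oplus>\<^sub>L N) \<oplus>\<^sub>L P) (M \<oplus>\<^sub>L (N \<oplus>\<^sub>L P))"
    by (auto simp: iso_def hom_def)
  then show ?thesis
    by (rule lattice_isoI[OF G_lattice_direct_sum[OF G_lattice_direct_sum[OF assms(1,2)] assms(3)]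
          G_lattice_direct_sum[OF assms(1) G_lattice_direct_sum[OF assms(2,3)]]]) auto
qed

lemma lattice_iso_direct_sum_commute:
  assumes "G_lattice G M" "G_lattice G N"
  shows "lattice_iso G (M \<oplus>\<^sub>L N) (N \<oplus>\<^sub>L M)"
proof -
  have "bij_betw prod.swap (carrier M \<times> carrier N) (carrier N \<times> carrier M)"
    by (rule bij_betwI[where g = prod.swap]) auto
  then have "prod.swap \<in> iso (M \<oplus>\<^sub>L N) (N \<oplus>\<^sub>L M)"
    by (auto simp: iso_def hom_def)
  then show ?thesis
    by (rule lattice_isoI[OF G_lattice_direct_sum[OF assms(1,2)] G_lattice_direct_sum[OF assms(2,1)]]) auto
qed

text \<open>Torsion-freeness of a relation module is not apparent from its construction as a quotient. It is
imported, with the rest of the lattice structure, along an isomorphism from a known lattice.\<close>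

lemma lattice_iso_transport:
  assumes "G_lattice G N" "comm_group M" and f: "f \<in> iso N M"
    and eq: "\<And>g m. g \<in> carrier G \<Longrightarrow> m \<in> carrier N \<Longrightarrow> f (action N g m) = action M g (f m)"
  shows "lattice_iso G N M"
proof -
  interpret N: G_lattice G N by fact
  interpret M: comm_group M by fact
  interpret f: group_hom N M f
    using f by (simp add: group_hom_def group_hom_axioms_def N.M.is_group M.is_group iso_def)
  have img: "f ` carrier N = carrier M" and inj: "inj_on f (carrier N)"
    using f by (auto simp: iso_def bij_betw_def)
  have ac: "action N g m \<in> carrier N" if "g \<in> carrier G" "m \<in> carrier N" for g m
    using N.action_hom[OF that(1)] that(2) by (auto simp: hom_def)
  obtain A where A: "finite A" "A \<subseteq> carrier N" "generate N A = carrier N"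
    using G_lattice_imp_finite_generators[OF assms(1)] .
  have "G_lattice G M"
  proof (rule G_latticeI[where A = "f ` A"])
    show "generate M (f ` A) = carrier M"
      using f.generate_img[OF A(2)] A(3) img by simp
    show "action M g \<in> hom M M" if g: "g \<in> carrier G" for g
    proof (rule homI)
      fix x y assume "x \<in> carrier M" "y \<in> carrier M"
      then obtain x' y' where "x' \<in> carrier N" "x = f x'" "y' \<in> carrier N" "y = f y'"
        using img by (metis imageE)
      moreover from this have "action N g (x' \<otimes>\<^bsub>N\<^esub> y') = action N g x' \<otimes>\<^bsub>N\<^esub> action N g y'"
        using N.action_hom[OF g] by (auto simp: hom_def)
      ultimately show "action M g (x \<otimes>\<^bsub>M\<^esub> y) = action M g x \<otimes>\<^bsub>M\<^esub> action M g y"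
        using g by (simp flip: eq f.hom_mult add: ac)
    next
      fix x assume "x \<in> carrier M"
      then obtain x' where "x' \<in> carrier N" "x = f x'" using img by (metis imageE)
      then show "action M g x \<in> carrier M" using g by (simp flip: eq add: ac)
    qed
    show "action M \<one>\<^bsub>G\<^esub> m = m" if m: "m \<in> f ` A" for m
    proof -
      obtain m' where "m' \<in> carrier N" "m = f m'" using m A(2) by auto
      then show ?thesis by (simp add: N.action_one flip: eq)
    qed
    show "action M (g \<otimes>\<^bsub>G\<^esub> h) m = action M g (action M h m)"
      if gh: "g \<in> carrier G" "h \<in> carrier G" and m: "m \<in> f ` A" for g h m
    proof -
      obtain m' where "m' \<in> carrier N" "m = f m'" using m A(2) by auto
      then show ?thesis using gh by (simp add: N.action_mult ac flip: eq)
    qed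
    show "m = \<one>\<^bsub>M\<^esub>" if m: "m \<in> carrier M" and k: "0 < k" and mk: "m [^]\<^bsub>M\<^esub> k = \<one>\<^bsub>M\<^esub>"
      for m and k :: nat
    proof -
      obtain m' where m': "m' \<in> carrier N" "m = f m'" using img m by auto
      then have "f (m' [^]\<^bsub>N\<^esub> k) = f \<one>\<^bsub>N\<^esub>" using mk by (simp add: f.hom_nat_pow)
      then have "m' [^]\<^bsub>N\<^esub> k = \<one>\<^bsub>N\<^esub>" by (rule inj_onD[OF inj]) (auto simp: m')
      then show ?thesis using N.torsion_free[OF m'(1) k] m' by simp
    qed
    show "f ` A \<subseteq> carrier M" using A(2) img by blast
  qed (use A(1) in \<open>simp_all add: N.G.is_group N.finite_group assms(2)\<close>)
  then show ?thesis using eq by (rule lattice_isoI[OF assms(1) _ f])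
qed

text \<open>The target is only asked to be a group with an action by automorphisms, so that the lemma applies to
a relation module before this is known to be a lattice.\<close>

lemma equivariant_on_generators:
  assumes "G_lattice G M" "group N" "f \<in> hom M N"
    and N: "\<And>g. g \<in> carrier G \<Longrightarrow> action N g \<in> hom N N"
     "\<And>g h m. \<lbrakk>g \<in> carrier G; h \<in> carrier G; m \<in> carrier N\<rbrakk> \<Longrightarrow>
      action N (g \<otimes>\<^bsub>G\<^esub> h) m = action N g (action N h m)"
     "\<And>m. m \<in> carrier N \<Longrightarrow> action N \<one>\<^bsub>G\<^esub> m = m"
    and "T \<subseteq> carrier G" and T: "generate G T = carrier G"
    and "A \<subseteq> carrier M" and A: "generate M A = carrier M"
    and eq: "\<And>t x. \<lbrakk>t \<in> T; x \<in> A\<rbrakk> \<Longrightarrow> f (action M t x) = action N t (f x)"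
    and "g \<in> carrier G" "m \<in> carrier M"
  shows "f (action M g m) = action N g (f m)"
proof -
  interpret M: G_lattice G M by fact
  have fc: "f m \<in> carrier N" if "m \<in> carrier M" for m using assms(3) that by (auto simp: hom_def)
  have ac: "action M g m \<in> carrier M" if "g \<in> carrier G" "m \<in> carrier M" for g m
    using M.action_hom[OF that(1)] that(2) by (auto simp: hom_def)
  have anc: "action N g m \<in> carrier N" if "g \<in> carrier G" "m \<in> carrier N" for g m
    using N(1)[OF that(1)] that(2) by (auto simp: hom_def)
  have eqT: "f (action M t m) = action N t (f m)" if t: "t \<in> T" and m: "m \<in> carrier M" for t m
  proof -
    have tG: "t \<in> carrier G" using t \<open>T \<subseteq> carrier G\<close> by auto
    have "f \<circ> action M t \<in> hom M N" using Group.hom_compose[OF M.action_hom[OF tG] assms(3)] .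
    moreover have "action N t \<circ> f \<in> hom M N" using Group.hom_compose[OF assms(3) N(1)[OF tG]] .
    ultimately have "(f \<circ> action M t) m = (action N t \<circ> f) m"
      by (rule hom_eq_on_generate[OF M.M.is_group assms(2) _ _ \<open>A \<subseteq> carrier M\<close>])
        (use m t eq A in auto)
    then show ?thesis by simp
  qed
  have "g \<in> generate G T" using T assms by simp
  then show ?thesis using \<open>m \<in> carrier M\<close>
  proof (induction arbitrary: m rule: generate.induct)
    case one
    then show ?case using M.action_one N(3) fc by simp
  next
    case (incl h)
    then show ?case using eqT by simp
  next
    case (inv h)
    have h: "h \<in> carrier G" using inv assms by auto
    let ?m = "action M (inv\<^bsub>G\<^esub> h) m"
    have "f m = f (action M h ?m)"
      using M.action_mult[of h "inv\<^bsub>G\<^esub> h" m] h inv by (simp add: M.action_one)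
    also have "\<dots> = action N h (f ?m)" using eqT[OF inv(1)] ac h inv by simp
    finally have "action N (inv\<^bsub>G\<^esub> h) (f m) = action N (inv\<^bsub>G\<^esub> h) (action N h (f ?m))" by simp
    also have "\<dots> = f ?m" using N(2)[of "inv\<^bsub>G\<^esub> h" h "f ?m"] h inv N(3) fc ac by simp
    finally show ?case by simp
  next
    case (eng h1 h2)
    then have "h1 \<in> carrier G" "h2 \<in> carrier G" using T by auto
    then show ?case using eng N(2) fc ac M.action_mult by simp
  qed
qed

section \<open>The dihedral group and the lattices of rank n and n + 1\<close>

lemma dihedral_simps [simp]:
  "carrier (dihedral n) = {0..<int n} \<times> UNIV"
  "(i, a) \<otimes>\<^bsub>dihedral n\<^esub> (j, b) = ((if a then i - j else i + j) mod int n, a \<noteq> b)"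
  "\<one>\<^bsub>dihedral n\<^esub> = (0, False)"
  by (simp_all add: dihedral_def)

lemma inv_dihedral:
  assumes "0 < n" "0 \<le> i" "i < int n"
  shows "inv\<^bsub>dihedral n\<^esub> (i, a) = (if a then (i, a) else ((- i) mod int n, a))"
  using assms by (intro group.inv_equality[OF group_dihedral]) (auto simp: mod_simps)

text \<open>Von Dyck's theorem for the dihedral presentation. The relation \<open>(ST)\<^sup>2 = 1\<close> enters in the form
\<open>STS = T\<close>, which iterates to \<open>S\<^sup>kTS\<^sup>k = T\<close> and so moves \<open>T\<close> past every power of \<open>S\<close>.\<close>

lemma dihedral_hom:
  assumes n: "0 < n" and Q: "group Q" and S: "S \<in> carrier Q" and T: "T \<in> carrier Q"
    and Sn: "S [^]\<^bsub>Q\<^esub> n = \<one>\<^bsub>Q\<^esub>" and TT: "T \<otimes>\<^bsub>Q\<^esub> T = \<one>\<^bsub>Q\<^esub>"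
    and STS: "S \<otimes>\<^bsub>Q\<^esub> T \<otimes>\<^bsub>Q\<^esub> S = T"
  shows "(\<lambda>(i, a). S [^]\<^bsub>Q\<^esub> i \<otimes>\<^bsub>Q\<^esub> (if a then T else \<one>\<^bsub>Q\<^esub>)) \<in> hom (dihedral n) Q"
proof -
  interpret Q: group Q by fact
  have pmod: "S [^]\<^bsub>Q\<^esub> (i mod int n) = S [^]\<^bsub>Q\<^esub> i" for i :: int
  proof -
    have "S [^]\<^bsub>Q\<^esub> i = S [^]\<^bsub>Q\<^esub> (int n * (i div int n) + i mod int n)" by simp
    also have "\<dots> = S [^]\<^bsub>Q\<^esub> (int n * (i div int n)) \<otimes>\<^bsub>Q\<^esub> S [^]\<^bsub>Q\<^esub> (i mod int n)"
      using S by (rule Q.int_pow_mult)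
    also have "S [^]\<^bsub>Q\<^esub> (int n * (i div int n)) = (S [^]\<^bsub>Q\<^esub> int n) [^]\<^bsub>Q\<^esub> (i div int n)"
      using S by (simp add: Q.int_pow_pow)
    also have "S [^]\<^bsub>Q\<^esub> int n = \<one>\<^bsub>Q\<^esub>" using Sn by (simp add: int_pow_int)
    finally show ?thesis using S by simp
  qed
  have "S [^]\<^bsub>Q\<^esub> k \<otimes>\<^bsub>Q\<^esub> T \<otimes>\<^bsub>Q\<^esub> S [^]\<^bsub>Q\<^esub> k = T" for k :: nat
  proof (induction k)
    case (Suc k)
    have c: "S [^]\<^bsub>Q\<^esub> k \<in> carrier Q" using S by simp
    have "S [^]\<^bsub>Q\<^esub> k \<otimes>\<^bsub>Q\<^esub> S \<otimes>\<^bsub>Q\<^esub> T \<otimes>\<^bsub>Q\<^esub> (S \<otimes>\<^bsub>Q\<^esub> S [^]\<^bsub>Q\<^esub> k)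
      = S [^]\<^bsub>Q\<^esub> k \<otimes>\<^bsub>Q\<^esub> (S \<otimes>\<^bsub>Q\<^esub> T \<otimes>\<^bsub>Q\<^esub> S) \<otimes>\<^bsub>Q\<^esub> S [^]\<^bsub>Q\<^esub> k"
      using S T c by (simp add: Q.m_assoc del: Q.nat_pow_closed)
    then have "S [^]\<^bsub>Q\<^esub> Suc k \<otimes>\<^bsub>Q\<^esub> T \<otimes>\<^bsub>Q\<^esub> S [^]\<^bsub>Q\<^esub> Suc k
      = S [^]\<^bsub>Q\<^esub> k \<otimes>\<^bsub>Q\<^esub> (S \<otimes>\<^bsub>Q\<^esub> T \<otimes>\<^bsub>Q\<^esub> S) \<otimes>\<^bsub>Q\<^esub> S [^]\<^bsub>Q\<^esub> k"
      using Q.nat_pow_Suc[of S k] Q.nat_pow_Suc2[OF S, of k] by metis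
    then show ?case using Suc STS by simp
  qed (use T in simp)
  note STS' = this
  have TS: "T \<otimes>\<^bsub>Q\<^esub> S [^]\<^bsub>Q\<^esub> j = S [^]\<^bsub>Q\<^esub> (- j) \<otimes>\<^bsub>Q\<^esub> T" if "0 \<le> j" for j :: int
  proof -
    obtain k where j: "j = int k" using \<open>0 \<le> j\<close> by (metis nonneg_int_cases)
    have "S [^]\<^bsub>Q\<^esub> k \<otimes>\<^bsub>Q\<^esub> (T \<otimes>\<^bsub>Q\<^esub> S [^]\<^bsub>Q\<^esub> k) = T" using STS'[of k] S T by (simp add: Q.m_assoc)
    then show ?thesis using S T
      by (simp add: j Q.int_pow_neg int_pow_int Q.inv_solve_left)
  qed
  have shuffle: "(p \<otimes>\<^bsub>Q\<^esub> q) \<otimes>\<^bsub>Q\<^esub> (t \<otimes>\<^bsub>Q\<^esub> u) = (p \<otimes>\<^bsub>Q\<^esub> t) \<otimes>\<^bsub>Q\<^esub> (q' \<otimes>\<^bsub>Q\<^esub> u)"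
    if "t \<otimes>\<^bsub>Q\<^esub> q' = q \<otimes>\<^bsub>Q\<^esub> t" and c: "p \<in> carrier Q" "q \<in> carrier Q" "q' \<in> carrier Q" "t \<in> carrier Q"
      "u \<in> carrier Q" for p q q' t u
  proof -
    have "(p \<otimes>\<^bsub>Q\<^esub> t) \<otimes>\<^bsub>Q\<^esub> (q' \<otimes>\<^bsub>Q\<^esub> u) = p \<otimes>\<^bsub>Q\<^esub> ((t \<otimes>\<^bsub>Q\<^esub> q') \<otimes>\<^bsub>Q\<^esub> u)"
      using c by (simp add: Q.m_assoc)
    also have "\<dots> = (p \<otimes>\<^bsub>Q\<^esub> q) \<otimes>\<^bsub>Q\<^esub> (t \<otimes>\<^bsub>Q\<^esub> u)"
      unfolding that(1) using c by (simp add: Q.m_assoc)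
    finally show ?thesis by simp
  qed
  show ?thesis
  proof (rule homI)
    fix x y assume xy: "x \<in> carrier (dihedral n)" "y \<in> carrier (dihedral n)"
    obtain i a j b where ij: "x = (i, a)" "y = (j, b)" by (cases x, cases y)
    let ?T = "\<lambda>a. if a then T else \<one>\<^bsub>Q\<^esub>"
    have Tc: "?T a \<in> carrier Q" for a using T by simp
    have comm: "?T a \<otimes>\<^bsub>Q\<^esub> S [^]\<^bsub>Q\<^esub> j = S [^]\<^bsub>Q\<^esub> (if a then - j else j) \<otimes>\<^bsub>Q\<^esub> ?T a"
      using TS xy S by (auto simp: ij)
    have "?T a \<otimes>\<^bsub>Q\<^esub> ?T b = ?T (a \<noteq> b)" using TT T by auto
    moreover have "S [^]\<^bsub>Q\<^esub> ((if a then i - j else i + j) mod int n)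
      = S [^]\<^bsub>Q\<^esub> i \<otimes>\<^bsub>Q\<^esub> S [^]\<^bsub>Q\<^esub> (if a then - j else j)"
      unfolding pmod using Q.int_pow_mult[OF S, of i "if a then - j else j"] by (cases a) simp_all
    ultimately have "S [^]\<^bsub>Q\<^esub> ((if a then i - j else i + j) mod int n) \<otimes>\<^bsub>Q\<^esub> ?T (a \<noteq> b)
      = (S [^]\<^bsub>Q\<^esub> i \<otimes>\<^bsub>Q\<^esub> ?T a) \<otimes>\<^bsub>Q\<^esub> (S [^]\<^bsub>Q\<^esub> j \<otimes>\<^bsub>Q\<^esub> ?T b)"
      using shuffle[OF comm _ _ _ Tc Tc, of "S [^]\<^bsub>Q\<^esub> i" b] S by simp
    then show "(\<lambda>(i, a). S [^]\<^bsub>Q\<^esub> i \<otimes>\<^bsub>Q\<^esub> ?T a) (x \<otimes>\<^bsub>dihedral n\<^esub> y) =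
      (\<lambda>(i, a). S [^]\<^bsub>Q\<^esub> i \<otimes>\<^bsub>Q\<^esub> ?T a) x \<otimes>\<^bsub>Q\<^esub> (\<lambda>(i, a). S [^]\<^bsub>Q\<^esub> i \<otimes>\<^bsub>Q\<^esub> ?T a) y"
      by (simp only: ij dihedral_simps prod.case)
  qed (use S T in auto)
qed

text \<open>The relations are asked for on an invariant set \<open>C\<close> only: the operators of the two lattices are
defined on formal combinations of arbitrary integer indices, but have the right orders only on those
with indices in \<open>{0..<n}\<close>.\<close>

lemma dihedral_action_mult:
  assumes n: "0 < n" and g: "g \<in> carrier (dihedral n)" and h: "h \<in> carrier (dihedral n)"
    and sC: "\<And>m. m \<in> C \<Longrightarrow> s m \<in> C" and tC: "\<And>m. m \<in> C \<Longrightarrow> t m \<in> C"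
    and sn: "\<And>m. m \<in> C \<Longrightarrow> (s ^^ n) m = m" and tt: "\<And>m. m \<in> C \<Longrightarrow> t (t m) = m"
    and sts: "\<And>m. m \<in> C \<Longrightarrow> s (t (s m)) = t m" and m: "m \<in> C"
  shows "dihedral_action s t (g \<otimes>\<^bsub>dihedral n\<^esub> h) m =
    dihedral_action s t g (dihedral_action s t h m)"
proof -
  have pC: "(s ^^ k) x \<in> C" if "x \<in> C" for k x
    using that by (induction k) (auto simp: sC)
  have pn: "(s ^^ (k + n * l)) x = (s ^^ k) x" if "x \<in> C" for k l x
    using that by (induction l) (simp_all add: funpow_add sn add.commute[of n] flip: add.assoc)
  have pmod: "(s ^^ k) x = (s ^^ l) x" if x: "x \<in> C" and kl: "k mod n = l mod n" for k l x
    using pn[OF x, of "k mod n" "k div n"] pn[OF x, of "l mod n" "l div n"] kl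
    by (metis mod_mult_div_eq)
  have st: "(s ^^ k) (t ((s ^^ k) x)) = t x" if x: "x \<in> C" for k x
  proof (induction k)
    case (Suc k)
    have "(s ^^ Suc k) (t ((s ^^ Suc k) x)) = (s ^^ k) (s (t (s ((s ^^ k) x))))"
      by (simp add: funpow_swap1)
    then show ?case using Suc sts[OF pC[OF x]] by simp
  qed simp
  have ts: "t ((s ^^ k) x) = (s ^^ l) (t x)" if x: "x \<in> C" and kl: "(k + l) mod n = 0" for k l x
  proof -
    have "(s ^^ l) (t x) = (s ^^ (l + k)) (t ((s ^^ k) x))"
      by (simp add: funpow_add st[OF x])
    also have "\<dots> = (s ^^ 0) (t ((s ^^ k) x))"
      by (rule pmod) (use pC[OF x] tC kl in \<open>auto simp: add.commute\<close>)
    finally show ?thesis by simp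
  qed
  obtain i a j b where gh: "g = (i, a)" "h = (j, b)" by (cases g, cases h)
  have ij: "0 \<le> i" "i < int n" "0 \<le> j" "j < int n" using g h gh by auto
  define m' where "m' = (if b then t m else m)"
  have m': "m' \<in> C" using m tC by (simp add: m'_def)
  show ?thesis
  proof (cases a)
    case False
    have "(s ^^ nat ((i + j) mod int n)) m' = (s ^^ (nat i + nat j)) m'"
      by (rule pmod[OF m']) (use ij in \<open>simp add: nat_mod_distrib nat_add_distrib\<close>)
    then show ?thesis
      using False by (cases b) (simp_all add: gh dihedral_action_def m'_def funpow_add)
  next
    case True
    let ?l = "nat ((- j) mod int n)"
    have "int ((nat j + ?l) mod n) = 0"
      using ij n by (simp add: zmod_int mod_simps)
    then have "t ((s ^^ nat j) m') = (s ^^ ?l) (t m')" by (intro ts[OF m']) simp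
    moreover have "(s ^^ nat ((i - j) mod int n)) (t m') = (s ^^ (nat i + ?l)) (t m')"
    proof (rule pmod[OF tC[OF m']])
      have "int (nat ((i - j) mod int n) mod n) = int ((nat i + ?l) mod n)"
        using ij n by (simp add: zmod_int mod_simps)
      then show "nat ((i - j) mod int n) mod n = (nat i + ?l) mod n" by linarith
    qed
    moreover have "t m' = (if \<not> b then t m else m)" using tt[OF m] by (simp add: m'_def)
    ultimately show ?thesis
      using True by (cases b) (simp_all add: gh dihedral_action_def m'_def funpow_add)
  qed
qed

lemma hom_funpow:
  assumes "s \<in> hom M M" shows "s ^^ k \<in> hom M M"
proof (induction k)
  case 0
  then show ?case by (simp add: hom_def)
next
  case (Suc k)
  then show ?case using Group.hom_compose[OF Suc assms] by (simp add: comp_def)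
qed

lemma G_lattice_dihedral_action:
  assumes n: "0 < n" and fin: "finite S"
    and s: "s \<in> hom (free_Abelian_group S) (free_Abelian_group S)"
    and t: "t \<in> hom (free_Abelian_group S) (free_Abelian_group S)"
    and sn: "\<And>x. x \<in> S \<Longrightarrow> (s ^^ n) (frag_of x) = frag_of x"
    and tt: "\<And>x. x \<in> S \<Longrightarrow> t (t (frag_of x)) = frag_of x"
    and sts: "\<And>x. x \<in> S \<Longrightarrow> s (t (s (frag_of x))) = t (frag_of x)"
  shows "G_lattice (dihedral n)
    (monoid.extend (free_Abelian_group S) \<lparr>action = dihedral_action s t\<rparr>)"
proof (rule G_lattice_free[OF group_dihedral[OF n] _ fin])
  let ?F = "free_Abelian_group S"
  show "dihedral_action s t g \<in> hom ?F ?F" for g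
  proof (cases g)
    case (Pair i a)
    have "id \<in> hom ?F ?F" by (simp add: hom_def)
    then have "(s ^^ nat i) \<circ> (if a then t else id) \<in> hom ?F ?F"
      by (intro Group.hom_compose[OF _ hom_funpow[OF s]]) (simp add: t)
    then show ?thesis by (simp add: Pair dihedral_action_def)
  qed
  have eqI: "f m = f' m" if "f \<in> hom ?F ?F" "f' \<in> hom ?F ?F" "m \<in> carrier ?F"
    "\<And>x. x \<in> S \<Longrightarrow> f (frag_of x) = f' (frag_of x)" for f f' m
    by (rule hom_eq_on_generate[of ?F ?F f f' "frag_of ` S"])
      (use that in \<open>auto simp: generate_free_Abelian_group\<close>)
  have cl: "f m \<in> carrier ?F" if "f \<in> hom ?F ?F" "m \<in> carrier ?F" for f m
    using that by (simp add: hom_def Pi_iff)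
  fix g h x assume gh: "g \<in> carrier (dihedral n)" "h \<in> carrier (dihedral n)" and x: "x \<in> S"
  show "dihedral_action s t (g \<otimes>\<^bsub>dihedral n\<^esub> h) (frag_of x) =
    dihedral_action s t g (dihedral_action s t h (frag_of x))"
  proof (rule dihedral_action_mult[OF n gh cl[OF s] cl[OF t]])
    show "(s ^^ n) m = m" if "m \<in> carrier ?F" for m
      using eqI[of "s ^^ n" id m] that sn hom_funpow[OF s] by (simp add: hom_def)
    show "t (t m) = m" if "m \<in> carrier ?F" for m
      using eqI[of "t \<circ> t" id m] that tt Group.hom_compose[OF t t] by (simp add: hom_def)
    show "s (t (s m)) = t m" if "m \<in> carrier ?F" for m
      using eqI[of "s \<circ> (t \<circ> s)" t m] that sts t Group.hom_compose[OF Group.hom_compose[OF s t] s]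
      by simp
    show "frag_of x \<in> carrier ?F" using x by simp
  qed
qed (simp_all add: dihedral_action_def)

lemma M_plus_sigma_pow:
  assumes "i \<in> {0..<int n}"
  shows "(frag_extend (\<lambda>i. frag_of ((i + 1) mod int n)) ^^ k) (frag_of i) = frag_of ((i + int k) mod int n)"
  using assms by (induction k) (simp_all add: mod_simps ac_simps)

lemma G_lattice_M_plus:
  assumes "0 < n" shows "G_lattice (dihedral n) (M_plus n)"
  unfolding M_plus_def
proof (rule G_lattice_dihedral_action)
  show "(frag_extend (\<lambda>i. frag_of ((i + 1) mod int n)) ^^ n) (frag_of x) = frag_of x"
    if "x \<in> {0..<int n}" for x
    using that by (simp add: M_plus_sigma_pow)
qed (use assms in \<open>auto intro!: frag_extend_hom simp: mod_simps\<close>)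

lemma M_tilde_plus_sigma_pow:
  fixes n :: nat
  defines "s \<equiv> frag_extend (\<lambda>b. case b of
          Some i \<Rightarrow> frag_of (Some ((i + 1) mod int n))
        | None \<Rightarrow> frag_of None)"
  shows "i \<in> {0..<int n} \<Longrightarrow> (s ^^ k) (frag_of (Some i)) = frag_of (Some ((i + int k) mod int n))"
    and "(s ^^ k) (frag_of None) = frag_of None"
  by (induction k) (simp_all add: mod_simps ac_simps s_def)

lemma bij_betw_add_mod:
  assumes "0 < n"
  shows "bij_betw (\<lambda>i. (i + c) mod int n) {0..<int n} {0..<int n}"
  by (rule bij_betwI[where g = "\<lambda>i. (i - c) mod int n"]) (use assms in \<open>auto simp: mod_simps\<close>)

lemma bij_betw_uminus_mod:
  assumes "0 < n"
  shows "bij_betw (\<lambda>i. (- i) mod int n) {0..<int n} {0..<int n}"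
  by (rule bij_betwI[where g = "\<lambda>i. (- i) mod int n"]) (use assms in \<open>auto simp: mod_simps\<close>)

lemma keys_sum_frag_of:
  "finite I \<Longrightarrow> Poly_Mapping.keys (\<Sum>i\<in>I. frag_of (f i)) \<subseteq> f ` I"
  by (rule order.trans[OF keys_sum]) auto

lemma G_lattice_M_tilde_plus:
  assumes n: "0 < n" shows "G_lattice (dihedral n) (M_tilde_plus n)"
  unfolding M_tilde_plus_def
proof (rule G_lattice_dihedral_action)
  let ?S = "insert None (Some ` {0..<int n})"
  let ?s = "frag_extend (\<lambda>b. case b of
          Some i \<Rightarrow> frag_of (Some ((i + 1) mod int n))
        | None \<Rightarrow> frag_of None)"
  let ?N = "\<Sum>i\<in>{0..<int n}. frag_of (Some i)"
  let ?t = "frag_extend (\<lambda>b. case b of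
          Some i \<Rightarrow> frag_of (Some ((- i) mod int n))
        | None \<Rightarrow> - frag_of None + ?N)"
  have sN: "?s ?N = ?N"
    using sum.reindex_bij_betw[OF bij_betw_add_mod[OF n, of 1], of "\<lambda>i. frag_of (Some i)"]
    by (simp add: frag_extend_sum)
  have tN: "?t ?N = ?N"
    using sum.reindex_bij_betw[OF bij_betw_uminus_mod[OF n], of "\<lambda>i. frag_of (Some i)"]
    by (simp add: frag_extend_sum)
  show "(?s ^^ n) (frag_of x) = frag_of x" if "x \<in> ?S" for x
    using that M_tilde_plus_sigma_pow by auto
  show "?s \<in> hom (free_Abelian_group ?S) (free_Abelian_group ?S)"
    using n by (intro frag_extend_hom) auto
  show "?t \<in> hom (free_Abelian_group ?S) (free_Abelian_group ?S)"
  proof (rule frag_extend_hom)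
    fix b assume "b \<in> ?S"
    moreover have "Poly_Mapping.keys (- frag_of None + ?N) \<subseteq> ?S"
      using keys_add[of "- frag_of None" ?N] keys_sum_frag_of[of "{0..<int n}" Some] by auto
    ultimately show "Poly_Mapping.keys (case b of
          Some i \<Rightarrow> frag_of (Some ((- i) mod int n))
        | None \<Rightarrow> - frag_of None + ?N) \<subseteq> ?S"
      using n by (auto simp del: Un_insert_left)
  qed
  show "?t (?t (frag_of x)) = frag_of x" if "x \<in> ?S" for x
    using that tN
    by (auto simp: frag_extend_add frag_extend_minus frag_extend_diff mod_simps)
  show "?s (?t (?s (frag_of x))) = ?t (frag_of x)" if "x \<in> ?S" for x
    using that sN
    by (auto simp: frag_extend_add frag_extend_minus frag_extend_diff mod_simps)
qed (use n in auto)

lemma G_lattice_trivial: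
  assumes "group G" "finite (carrier G)" shows "G_lattice G trivial_lattice"
  unfolding trivial_lattice_def
proof (rule G_latticeI[where A = "{1}"])
  show "generate (monoid.extend integer_group \<lparr>action = \<lambda>_ x. x\<rparr>) {1}
    = carrier (monoid.extend integer_group \<lparr>action = \<lambda>_ x. x\<rparr>)"
    using group.generate_pow[OF group_integer_group, of 1] by simp
qed (use assms in \<open>auto simp: abelian_integer_group hom_def\<close>)

lemma G_lattice_permutation:
  assumes G: "group G" "finite (carrier G)" and H: "subgroup H G"
  shows "G_lattice G (permutation_lattice G H)"
  unfolding permutation_lattice_def
proof (rule G_lattice_free[OF G])
  interpret group G by fact
  have Hc: "H \<subseteq> carrier G" using H by (rule subgroup.subset)
  show "finite (lcosets\<^bsub>G\<^esub> H)" using G(2) by (simp add: LCOSETS_def)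
  have cl: "g <#\<^bsub>G\<^esub> C \<in> lcosets\<^bsub>G\<^esub> H" if "g \<in> carrier G" "C \<in> lcosets\<^bsub>G\<^esub> H" for g C
    using that Hc by (auto simp: LCOSETS_def lcos_m_assoc)
  show "frag_extend (\<lambda>C. frag_of (g <#\<^bsub>G\<^esub> C))
    \<in> hom (free_Abelian_group (lcosets\<^bsub>G\<^esub> H)) (free_Abelian_group (lcosets\<^bsub>G\<^esub> H))"
    if "g \<in> carrier G" for g
    using cl[OF that] by (intro frag_extend_hom) auto
  have CG: "C \<subseteq> carrier G" if "C \<in> lcosets\<^bsub>G\<^esub> H" for C
    using that l_coset_subset_G[OF Hc] by (auto simp: LCOSETS_def)
  show "frag_extend (\<lambda>C. frag_of (\<one>\<^bsub>G\<^esub> <#\<^bsub>G\<^esub> C)) (frag_of C) = frag_of C"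
    if "C \<in> lcosets\<^bsub>G\<^esub> H" for C
    using lcos_mult_one[OF CG[OF that]] by simp
  show "frag_extend (\<lambda>C. frag_of (g \<otimes>\<^bsub>G\<^esub> h <#\<^bsub>G\<^esub> C)) (frag_of C)
    = frag_extend (\<lambda>C. frag_of (g <#\<^bsub>G\<^esub> C)) (frag_extend (\<lambda>C. frag_of (h <#\<^bsub>G\<^esub> C)) (frag_of C))"
    if "g \<in> carrier G" "h \<in> carrier G" "C \<in> lcosets\<^bsub>G\<^esub> H" for g h C
    using lcos_m_assoc[OF CG] that by simp
qed

section \<open>Comparison with permutation lattices\<close>

lemma action_M_plus:
  assumes "2 \<le> n" "i \<in> {0..<int n}"
  shows "action (M_plus n) (dih_sigma n) (frag_of i) = frag_of ((i + 1) mod int n)"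
    "action (M_plus n) dih_tau (frag_of i) = frag_of ((- i) mod int n)"
  using assms by (simp_all add: M_plus_def dihedral_action_def dih_sigma_def dih_tau_def)

lemma action_M_tilde_plus:
  assumes "2 \<le> n"
  shows "action (M_tilde_plus n) (dih_sigma n) (frag_of (Some i)) = frag_of (Some ((i + 1) mod int n))"
    "action (M_tilde_plus n) (dih_sigma n) (frag_of None) = frag_of None"
    "action (M_tilde_plus n) dih_tau (frag_of (Some i)) = frag_of (Some ((- i) mod int n))"
    "action (M_tilde_plus n) dih_tau (frag_of None) = - frag_of None + (\<Sum>i\<in>{0..<int n}. frag_of (Some i))"
  using assms by (simp_all add: M_tilde_plus_def dihedral_action_def dih_sigma_def dih_tau_def)

text \<open>The coset \<open>\<sigma>\<^sup>i\<langle>\<tau>\<rangle>\<close> is the pair \<open>{\<sigma>\<^sup>i, \<sigma>\<^sup>i\<tau>}\<close>, which determines \<open>i\<close>; the action of \<open>\<tau>\<close> sends it to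
\<open>\<sigma>\<^sup>-\<^sup>i\<tau>\<langle>\<tau>\<rangle> = \<sigma>\<^sup>-\<^sup>i\<langle>\<tau>\<rangle>\<close>, as it sends \<open>x\<^sub>i\<close> to \<open>x\<^sub>-\<^sub>i\<close>.\<close>

lemma lattice_iso_M_plus_permutation:
  assumes n: "2 \<le> n"
  shows "lattice_iso (dihedral n) (M_plus n)
    (permutation_lattice (dihedral n) (generate (dihedral n) {dih_tau}))"
proof -
  let ?G = "dihedral n" and ?S = "{0..<int n}"
  interpret group ?G using n by (intro group_dihedral) simp
  let ?H = "generate ?G {dih_tau}"
  let ?P = "permutation_lattice ?G ?H"
  have tau: "dih_tau \<in> carrier ?G" using n by (simp add: dih_tau_def)
  have sigma: "dih_sigma n \<in> carrier ?G" using n by (simp add: dih_sigma_def)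
  have sub: "subgroup ?H ?G" using tau by (intro generate_is_subgroup) auto
  have H: "?H = {(0, False), (0, True)}"
  proof
    have "subgroup {(0, False), (0, True)} ?G"
      by (rule subgroupI) (use n in \<open>auto simp: inv_dihedral\<close>)
    then show "?H \<subseteq> {(0, False), (0, True)}"
      by (intro generate_subgroup_incl) (auto simp: dih_tau_def)
    show "{(0, False), (0, True)} \<subseteq> ?H"
      using subgroup.one_closed[OF sub] generate.incl[of dih_tau "{dih_tau}" ?G]
      by (simp add: dih_tau_def)
  qed
  have coset: "(i, a) <#\<^bsub>?G\<^esub> ?H = {(i, False), (i, True)}" if "i \<in> ?S" for i a
    using that by (auto simp: H l_coset_def)
  let ?L = "lcosets\<^bsub>?G\<^esub> ?H"
  have L: "?L = (\<lambda>i. {(i, False), (i, True)}) ` ?S"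
  proof
    show "?L \<subseteq> (\<lambda>i. {(i, False), (i, True)}) ` ?S" using coset by (auto simp: LCOSETS_def)
    have "(i, False) <#\<^bsub>?G\<^esub> ?H \<in> ?L" if "i \<in> ?S" for i
      unfolding LCOSETS_def using that by (intro UN_I[of "(i, False)"]) simp_all
    then show "(\<lambda>i. {(i, False), (i, True)}) ` ?S \<subseteq> ?L"
      using coset[of _ False] by auto
  qed
  have act: "g <#\<^bsub>?G\<^esub> {(i, False), (i, True)} = (g \<otimes>\<^bsub>?G\<^esub> (i, False)) <#\<^bsub>?G\<^esub> ?H"
    if "g \<in> carrier ?G" "i \<in> ?S" for g i
    using lcos_m_assoc[of ?H g "(i, False)"] coset[of i False] subgroup.subset[OF sub] that by simp
  let ?f = "frag_extend (\<lambda>i. frag_of {(i, False), (i, True)})"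
  let ?h = "frag_extend (\<lambda>C. frag_of (THE i. (i, False) \<in> C))"
  have f: "?f \<in> hom (M_plus n) ?P"
    unfolding M_plus_def permutation_lattice_def hom_extend
    by (rule frag_extend_hom) (auto simp: L)
  have h: "?h \<in> hom ?P (M_plus n)"
    unfolding M_plus_def permutation_lattice_def hom_extend
    by (rule frag_extend_hom) (auto simp: L)
  have gM: "generate (M_plus n) (frag_of ` ?S) = carrier (M_plus n)"
    by (simp add: M_plus_def generate_free_Abelian_group)
  have gP: "generate ?P (frag_of ` ?L) = carrier ?P"
    by (simp add: permutation_lattice_def generate_free_Abelian_group)
  have cM: "frag_of ` ?S \<subseteq> carrier (M_plus n)" and cP: "frag_of ` ?L \<subseteq> carrier ?P"
    by (auto simp: M_plus_def permutation_lattice_def)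
  have GM: "G_lattice ?G (M_plus n)" using n by (intro G_lattice_M_plus) simp
  have GP: "G_lattice ?G ?P" by (rule G_lattice_permutation[OF is_group _ sub]) simp
  interpret M: G_lattice ?G "M_plus n" by (rule GM)
  interpret P: G_lattice ?G ?P by (rule GP)
  have hf: "?h (?f m) = m" if m: "m \<in> carrier (M_plus n)" for m
  proof -
    have "(?h \<circ> ?f) m = id m"
      by (rule hom_eq_on_generate[OF M.M.is_group M.M.is_group Group.hom_compose[OF f h]
          iso_imp_homomorphism[OF id_iso] cM]) (use m gM in auto)
    then show ?thesis by simp
  qed
  have fh: "?f (?h m) = m" if m: "m \<in> carrier ?P" for m
  proof -
    have "(?f \<circ> ?h) m = id m"
      by (rule hom_eq_on_generate[OF P.M.is_group P.M.is_group Group.hom_compose[OF h f]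
          iso_imp_homomorphism[OF id_iso] cP]) (use m gP L in auto)
    then show ?thesis by simp
  qed
  have iso: "?f \<in> iso (M_plus n) ?P"
    by (rule group_isomorphisms_imp_iso[of _ _ _ ?h]) (simp add: group_isomorphisms_def f h hf fh)
  show ?thesis
  proof (rule lattice_isoI[OF GM GP iso])
    show "?f (action (M_plus n) g m) = action ?P g (?f m)"
      if "g \<in> carrier ?G" "m \<in> carrier (M_plus n)" for g m
    proof (rule equivariant_on_generators[OF GM P.M.is_group f P.action_hom P.action_mult P.action_one _
          generate_dihedral cM gM _ that])
      have "dih_sigma n \<otimes>\<^bsub>?G\<^esub> (i, False) = ((i + 1) mod int n, False)"
        and "dih_tau \<otimes>\<^bsub>?G\<^esub> (i, False) = ((- i) mod int n, True)" for i
        using n by (simp_all add: dih_sigma_def dih_tau_def add.commute)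
      moreover fix t x assume "t \<in> {dih_sigma n, dih_tau}" "x \<in> frag_of ` ?S"
      ultimately show "?f (action (M_plus n) t x) = action ?P t (?f x)"
        using n tau sigma
        by (auto simp: action_M_plus permutation_lattice_def act coset
            simp del: dihedral_simps)
    qed (use n tau in \<open>auto simp: dih_sigma_def\<close>)
  qed
qed

lemma carrier_free_Abelian_group:
  "carrier (free_Abelian_group S) = {p. Poly_Mapping.keys p \<subseteq> S}"
  by (rule Set.set_eqI) simp

lemma keys_frag_extend_subset:
  assumes "Poly_Mapping.keys p \<subseteq> U" "\<And>x. x \<in> U \<Longrightarrow> Poly_Mapping.keys (f x) \<subseteq> T"
  shows "Poly_Mapping.keys (frag_extend f p) \<subseteq> T"
  using keys_frag_extend[of f p] assms by blast

lemma frag_sum_const: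
  fixes x :: "'a \<Rightarrow>\<^sub>0 int"
  shows "(\<Sum>i\<in>I. x) = frag_cmul (int (card I)) x"
  by (induction I rule: infinite_finite_induct) (simp_all add: frag_cmul_distrib del: sum_constant)

text \<open>The sum of the coefficients, as the extension of the map to a point: this form inherits additivity
from \<open>frag_extend\<close> and does not refer to a support.\<close>

definition augmentation :: "('a \<Rightarrow>\<^sub>0 int) \<Rightarrow> int" where
  "augmentation q = Poly_Mapping.lookup (frag_extend (\<lambda>_. frag_of ()) q) ()"

lemma augmentation_simps [simp]:
  "augmentation 0 = 0"
  "augmentation (frag_of x) = 1"
  "augmentation (- p) = - augmentation p"
  "augmentation (p + q) = augmentation p + augmentation q"
  "augmentation (p - q) = augmentation p - augmentation q"
  "augmentation (frag_cmul k p) = k * augmentation p"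
  by (simp_all add: augmentation_def frag_extend_add frag_extend_diff frag_extend_minus frag_extend_cmul lookup_add lookup_minus)

lemma augmentation_sum [simp]: "augmentation (\<Sum>i\<in>I. f i) = (\<Sum>i\<in>I. augmentation (f i))"
  by (induction I rule: infinite_finite_induct) auto

lemma action_M_tilde_plus_conjugate:
  assumes n: "2 \<le> n"
  shows "action (M_tilde_plus n) (dih_sigma n) (- frag_of None + (\<Sum>i\<in>{0..<int n}. frag_of (Some i)))
      = - frag_of None + (\<Sum>i\<in>{0..<int n}. frag_of (Some i))"
    and "action (M_tilde_plus n) dih_tau (- frag_of None + (\<Sum>i\<in>{0..<int n}. frag_of (Some i)))
      = frag_of None"
proof -
  have n0: "0 < n" using n by simp
  show "action (M_tilde_plus n) (dih_sigma n) (- frag_of None + (\<Sum>i\<in>{0..<int n}. frag_of (Some i)))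
      = - frag_of None + (\<Sum>i\<in>{0..<int n}. frag_of (Some i))"
    using sum.reindex_bij_betw[OF bij_betw_add_mod[OF n0, of 1], of "\<lambda>i. frag_of (Some i)"] n
    by (simp add: M_tilde_plus_def dihedral_action_def dih_sigma_def frag_extend_add
        frag_extend_minus frag_extend_diff frag_extend_sum)
  show "action (M_tilde_plus n) dih_tau (- frag_of None + (\<Sum>i\<in>{0..<int n}. frag_of (Some i)))
      = frag_of None"
    using sum.reindex_bij_betw[OF bij_betw_uminus_mod[OF n0], of "\<lambda>i. frag_of (Some i)"] n
    by (simp add: M_tilde_plus_def dihedral_action_def dih_tau_def frag_extend_add
        frag_extend_minus frag_extend_diff frag_extend_sum)
qed

text \<open>The isomorphism sends \<open>x\<^sub>i\<close> to \<open>(x\<^sub>i, 1)\<close> and the two cosets of \<open>\<langle>\<sigma>\<rangle>\<close> to \<open>(w, c)\<close> and \<open>(\<tau>w, c)\<close>; it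
is equivariant for every integer \<open>c\<close>. Modulo the images of the \<open>x\<^sub>i\<close> and of the first coset, the
target is generated by \<open>(0, 1)\<close>, and as \<open>w + \<tau>w = \<Sum>x\<^sub>i\<close> the sum of the two cosets becomes
\<open>2c - n\<close> times this generator. So the map is invertible when \<open>2c = n + 1\<close>.\<close>

lemma lattice_iso_M_tilde_plus_trivial:
  assumes n: "2 \<le> n" "odd n"
  shows "lattice_iso (dihedral n)
    (permutation_lattice (dihedral n) (generate (dihedral n) {dih_sigma n}) \<oplus>\<^sub>L M_plus n)
    (M_tilde_plus n \<oplus>\<^sub>L trivial_lattice)"
proof -
  let ?G = "dihedral n" and ?S = "{0..<int n}"
  interpret group ?G using n by (intro group_dihedral) simp
  let ?H = "generate ?G {dih_sigma n}"
  let ?P = "permutation_lattice ?G ?H"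
  let ?A = "?P \<oplus>\<^sub>L M_plus n" and ?B = "M_tilde_plus n \<oplus>\<^sub>L trivial_lattice"
  have sigma: "dih_sigma n \<in> carrier ?G" using n by (simp add: dih_sigma_def)
  have sub: "subgroup ?H ?G" using sigma by (intro generate_is_subgroup) auto
  \<comment> \<open>The rotations and the reflections are the two cosets.\<close>
  define C where "C a = ?S \<times> {a}" for a :: bool
  have H: "?H = C False"
  proof
    have "subgroup (C False) ?G"
      by (rule subgroupI) (use n in \<open>auto simp: inv_dihedral C_def\<close>)
    then show "?H \<subseteq> C False"
      using n by (intro generate_subgroup_incl) (auto simp: dih_sigma_def C_def)
    show "C False \<subseteq> ?H"
    proof
      fix x assume x: "x \<in> C False"
      have "dih_sigma n [^]\<^bsub>?G\<^esub> (k::nat) \<in> ?H" for k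
        by (induction k) (auto intro: subgroup.one_closed[OF sub] subgroup.m_closed[OF sub]
            generate.incl simp del: dihedral_simps)
      then have "dih_sigma n [^]\<^bsub>?G\<^esub> nat (fst x) \<in> ?H" .
      moreover have "dih_sigma n [^]\<^bsub>?G\<^esub> nat (fst x) = x"
        using x n by (subst dihedral_pow_sigma) (auto simp: C_def)
      ultimately show "x \<in> ?H" by simp
    qed
  qed
  have coset: "(i, a) <#\<^bsub>?G\<^esub> C b = C (a \<noteq> b)" if "i \<in> ?S" for i a b
  proof -
    have "(k, a \<noteq> b) \<in> (i, a) <#\<^bsub>?G\<^esub> C b" if "k \<in> ?S" for k
      unfolding l_coset_def
    proof (rule UN_I)
      show "((if a then i - k else k - i) mod int n, b) \<in> C b" using n by (simp add: C_def)
      show "(k, a \<noteq> b) \<in> {(i, a) \<otimes>\<^bsub>?G\<^esub> ((if a then i - k else k - i) mod int n, b)}"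
        using that by (simp add: mod_simps)
    qed
    then have "C (a \<noteq> b) \<subseteq> (i, a) <#\<^bsub>?G\<^esub> C b" by (auto simp: C_def)
    moreover have "(i, a) <#\<^bsub>?G\<^esub> C b \<subseteq> C (a \<noteq> b)"
      using n by (auto simp: C_def l_coset_def)
    ultimately show ?thesis by blast
  qed
  let ?L = "lcosets\<^bsub>?G\<^esub> ?H"
  have L: "?L = {C False, C True}"
  proof
    have "C a \<in> {C False, C True}" for a by (cases a) simp_all
    moreover have "K \<in> range C" if "K \<in> ?L" for K
      using that unfolding LCOSETS_def H by (auto simp: coset)
    ultimately show "?L \<subseteq> {C False, C True}" by blast
    have mem: "(0, a) <#\<^bsub>?G\<^esub> ?H \<in> ?L" for a
      unfolding LCOSETS_def using n by (intro UN_I[of "(0, a)"]) simp_all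
    have "C a \<in> ?L" for a using mem[of a] coset[of 0 a False] n by (simp add: H)
    then show "{C False, C True} \<subseteq> ?L" by simp
  qed
  have C_eq: "C a = C b \<longleftrightarrow> a = b" for a b
  proof -
    have mem: "(0, x) \<in> C y \<longleftrightarrow> x = y" for x y using n by (simp add: C_def)
    show ?thesis
    proof
      assume "C a = C b"
      then show "a = b" using mem[of a a] mem[of a b] by simp
    qed simp
  qed
  define c where "c = (int n + 1) div 2"
  have c: "2 * c = int n + 1" using n by (auto simp: c_def elim!: oddE)
  define N :: "int \<Rightarrow>\<^sub>0 int" where "N = (\<Sum>i\<in>?S. frag_of i)"
  define N' :: "int option \<Rightarrow>\<^sub>0 int" where "N' = (\<Sum>i\<in>?S. frag_of (Some i))"
  have keysN: "Poly_Mapping.keys N \<subseteq> ?S"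
    using keys_sum_frag_of[of ?S "\<lambda>i. i"] by (simp add: N_def)
  have keysN': "Poly_Mapping.keys N' \<subseteq> Some ` ?S"
    using keys_sum_frag_of[of ?S Some] by (simp add: N'_def)
  have augN: "augmentation N = int n" "augmentation N' = int n"
    by (simp_all add: N_def N'_def)
  define \<theta>1 where "\<theta>1 = frag_extend (\<lambda>K. if K = C False then frag_of None else - frag_of None + N')"
  define \<theta>2 where "\<theta>2 = frag_extend (\<lambda>i::int. frag_of (Some i))"
  define \<theta> where "\<theta> = (\<lambda>(p, q). (\<theta>1 p + \<theta>2 q, c * augmentation p + augmentation q))"
  \<comment> \<open>The inverse, found by solving for the preimages of \<open>(w, 0)\<close>, \<open>(x\<^sub>i, 0)\<close> and \<open>(0, 1)\<close>.\<close>
  define \<kappa>1 where "\<kappa>1 = frag_extend (\<lambda>b. case b of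
      None \<Rightarrow> frag_cmul (1 - c) (frag_of (C False)) - frag_cmul c (frag_of (C True))
    | Some (i::int) \<Rightarrow> - frag_of (C False) - frag_of (C True))"
  define \<kappa>2 where "\<kappa>2 = frag_extend (\<lambda>b. case b of
      None \<Rightarrow> frag_cmul c N | Some i \<Rightarrow> frag_of i + N)"
  define \<kappa> where "\<kappa> = (\<lambda>(m, z).
    (\<kappa>1 m + frag_cmul z (frag_of (C False) + frag_of (C True)), \<kappa>2 m - frag_cmul z N))"
  have carA: "carrier ?A = {p. Poly_Mapping.keys p \<subseteq> ?L} \<times> {q. Poly_Mapping.keys q \<subseteq> ?S}"
    by (simp add: permutation_lattice_def M_plus_def carrier_free_Abelian_group)
  have carB: "carrier ?B = {m. Poly_Mapping.keys m \<subseteq> insert None (Some ` ?S)} \<times> UNIV"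
    by (simp add: M_tilde_plus_def trivial_lattice_def carrier_free_Abelian_group)
  have mults: "p \<otimes>\<^bsub>?P\<^esub> p' = p + p'" "q \<otimes>\<^bsub>M_plus n\<^esub> q' = q + q'"
    "m \<otimes>\<^bsub>M_tilde_plus n\<^esub> m' = m + m'" "z \<otimes>\<^bsub>trivial_lattice\<^esub> z' = z + z'"
    for p p' q q' m m' z z'
    by (simp_all add: permutation_lattice_def M_plus_def M_tilde_plus_def trivial_lattice_def)
  have \<theta>_hom: "\<theta> \<in> hom ?A ?B"
  proof (rule homI)
    fix x y assume xy: "x \<in> carrier ?A" "y \<in> carrier ?A"
    show "\<theta> (x \<otimes>\<^bsub>?A\<^esub> y) = \<theta> x \<otimes>\<^bsub>?B\<^esub> \<theta> y"
      by (cases x; cases y) (simp add: \<theta>_def \<theta>1_def \<theta>2_def mults frag_extend_add algebra_simps)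
    have "Poly_Mapping.keys (\<theta>1 (fst x)) \<subseteq> insert None (Some ` ?S)"
      unfolding \<theta>1_def
    proof (rule keys_frag_extend_subset)
      show "Poly_Mapping.keys (fst x) \<subseteq> ?L" using xy unfolding carA by (cases x) simp
      fix K
      show "Poly_Mapping.keys (if K = C False then frag_of None else - frag_of None + N') \<subseteq> insert None (Some ` ?S)"
        using keys_add[of "- frag_of None" N'] keysN' by auto
    qed
    moreover have "Poly_Mapping.keys (\<theta>2 (snd x)) \<subseteq> insert None (Some ` ?S)"
      unfolding \<theta>2_def
    proof (rule keys_frag_extend_subset)
      show "Poly_Mapping.keys (snd x) \<subseteq> ?S" using xy unfolding carA by (cases x) simp
    qed auto
    ultimately show "\<theta> x \<in> carrier ?B"
      unfolding carB using order.trans[OF keys_add[of "\<theta>1 (fst x)" "\<theta>2 (snd x)"]]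
      by (cases x) (simp add: \<theta>_def)
  qed
  have \<kappa>_hom: "\<kappa> \<in> hom ?B ?A"
  proof (rule homI)
    fix x y assume xy: "x \<in> carrier ?B" "y \<in> carrier ?B"
    show "\<kappa> (x \<otimes>\<^bsub>?B\<^esub> y) = \<kappa> x \<otimes>\<^bsub>?A\<^esub> \<kappa> y"
      by (cases x; cases y)
        (simp add: \<kappa>_def \<kappa>1_def \<kappa>2_def mults frag_extend_add frag_cmul_distrib algebra_simps)
    have "Poly_Mapping.keys (\<kappa>1 (fst x)) \<subseteq> ?L"
      unfolding \<kappa>1_def
    proof (rule keys_frag_extend_subset)
      show "Poly_Mapping.keys (fst x) \<subseteq> insert None (Some ` ?S)" using xy unfolding carB by (cases x) simp
      fix b
      show "Poly_Mapping.keys (case b of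
          None \<Rightarrow> frag_cmul (1 - c) (frag_of (C False)) - frag_cmul c (frag_of (C True))
        | Some (i::int) \<Rightarrow> - frag_of (C False) - frag_of (C True)) \<subseteq> ?L"
        by (auto split: option.splits simp: L dest!: subsetD[OF keys_diff])
    qed
    moreover have "Poly_Mapping.keys (\<kappa>2 (fst x)) \<subseteq> ?S"
      unfolding \<kappa>2_def
    proof (rule keys_frag_extend_subset)
      show "Poly_Mapping.keys (fst x) \<subseteq> insert None (Some ` ?S)" using xy unfolding carB by (cases x) simp
      fix b :: "int option" assume "b \<in> insert None (Some ` ?S)"
      then show "Poly_Mapping.keys (case b of None \<Rightarrow> frag_cmul c N | Some i \<Rightarrow> frag_of i + N) \<subseteq> ?S"
      proof (cases b)
        case None
        then show ?thesis using order.trans[OF keys_cmul keysN] by simp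
      next
        case (Some i)
        with \<open>b \<in> _\<close> have "Poly_Mapping.keys (frag_of i) \<subseteq> ?S" by auto
        then have "Poly_Mapping.keys (frag_of i + N) \<subseteq> ?S"
          by (intro order.trans[OF keys_add Un_least] keysN)
        with Some show ?thesis by simp
      qed
    qed
    moreover have "Poly_Mapping.keys (frag_cmul k (frag_of (C False) + frag_of (C True))) \<subseteq> ?L" for k
      using keys_cmul[of k "frag_of (C False) + frag_of (C True)"]
        keys_add[of "frag_of (C False)" "frag_of (C True)"] by (auto simp: L)
    moreover have "Poly_Mapping.keys (frag_cmul k N) \<subseteq> ?S" for k
      using keys_cmul[of k N] keysN by auto
    ultimately show "\<kappa> x \<in> carrier ?A"
      unfolding carA using order.trans[OF keys_add[of "\<kappa>1 (fst x)" "frag_cmul (snd x) (frag_of (C False) + frag_of (C True))"]]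
        order.trans[OF keys_diff[of "\<kappa>2 (fst x)" "frag_cmul (snd x) N"]]
      by (cases x) (simp add: \<kappa>_def)
  qed
  have GP: "G_lattice ?G ?P" by (rule G_lattice_permutation[OF is_group _ sub]) simp
  have GA: "G_lattice ?G ?A" using n by (intro G_lattice_direct_sum GP G_lattice_M_plus) simp
  have GB: "G_lattice ?G ?B"
    using n by (intro G_lattice_direct_sum G_lattice_M_tilde_plus G_lattice_trivial is_group) auto
  interpret A: G_lattice ?G ?A by (rule GA)
  interpret B: G_lattice ?G ?B by (rule GB)
  define gA where "gA = {(frag_of (C False), 0), (frag_of (C True), 0)} \<union> (\<lambda>i. (0, frag_of i)) ` ?S"
  define gB where "gB = insert (frag_of None, 0) ((\<lambda>i. (frag_of (Some i), 0)) ` ?S \<union> range (\<lambda>z::int. (0, z)))"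
  have gA: "generate ?A gA = carrier ?A" "gA \<subseteq> carrier ?A"
  proof -
    have "generate ?A ((\<lambda>x. (x, \<one>\<^bsub>M_plus n\<^esub>)) ` (frag_of ` ?L) \<union> (\<lambda>y. (\<one>\<^bsub>?P\<^esub>, y)) ` (frag_of ` ?S)) = carrier ?A"
      by (rule generate_direct_sum)
        (auto simp: permutation_lattice_def M_plus_def generate_free_Abelian_group)
    moreover have "(\<lambda>x. (x, \<one>\<^bsub>M_plus n\<^esub>)) ` (frag_of ` ?L) \<union> (\<lambda>y. (\<one>\<^bsub>?P\<^esub>, y)) ` (frag_of ` ?S) = gA"
      by (auto simp: gA_def L permutation_lattice_def M_plus_def)
    ultimately show "generate ?A gA = carrier ?A" by simp
    show "gA \<subseteq> carrier ?A" unfolding carA by (auto simp: gA_def L)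
  qed
  have gB: "generate ?B gB = carrier ?B" "gB \<subseteq> carrier ?B"
  proof -
    let ?T = "insert None (Some ` ?S)"
    let ?Z = "trivial_lattice :: (int, int \<times> bool) gmodule"
    have "generate integer_group UNIV = UNIV"
      by (auto intro: generate.incl)
    then have "generate integer_group UNIV = carrier integer_group" by simp
    then have "generate ?B ((\<lambda>x. (x, \<one>\<^bsub>?Z\<^esub>)) ` (frag_of ` ?T) \<union> (\<lambda>y. (\<one>\<^bsub>M_tilde_plus n\<^esub>, y)) ` UNIV) = carrier ?B"
      by (intro generate_direct_sum)
        (auto simp: M_tilde_plus_def trivial_lattice_def generate_free_Abelian_group
         simp del: Un_insert_left image_insert)
    moreover have "(\<lambda>x. (x, \<one>\<^bsub>?Z\<^esub>)) ` (frag_of ` ?T) \<union> (\<lambda>y. (\<one>\<^bsub>M_tilde_plus n\<^esub>, y)) ` UNIV = gB"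
      by (auto simp: gB_def M_tilde_plus_def trivial_lattice_def)
    ultimately show "generate ?B gB = carrier ?B" by simp
    show "gB \<subseteq> carrier ?B" unfolding carB by (auto simp: gB_def)
  qed
  have \<theta>2N: "\<theta>2 N = N'"
    by (simp add: \<theta>2_def N_def N'_def frag_extend_sum)
  have \<kappa>2N: "\<kappa>2 N' = frag_cmul (int n + 1) N"
    by (simp add: \<kappa>2_def N'_def frag_extend_sum sum.distrib frag_sum_const frag_cmul_distrib
        del: sum_constant flip: N_def)
  have \<kappa>1N: "\<kappa>1 N' = frag_cmul (int n) (- frag_of (C False) - frag_of (C True))"
  proof -
    have "\<kappa>1 N' = (\<Sum>i\<in>?S. - frag_of (C False) - frag_of (C True))"
      by (simp add: \<kappa>1_def N'_def frag_extend_sum)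
    then show ?thesis by (simp only: frag_sum_const) simp
  qed
  have lookup_double: "Poly_Mapping.lookup (2 * p) k = 2 * Poly_Mapping.lookup p k"
    for p :: "int \<Rightarrow>\<^sub>0 int" and k
    by (simp only: mult_2 lookup_add)
  have n_c: "int n = 2 * c - 1" using c by simp
  note lin = frag_extend_add frag_extend_diff frag_extend_minus frag_extend_cmul
  have \<theta>1_lin: "\<theta>1 (p + q) = \<theta>1 p + \<theta>1 q" "\<theta>1 (p - q) = \<theta>1 p - \<theta>1 q" "\<theta>1 (- p) = - \<theta>1 p"
    "\<theta>1 (frag_cmul k p) = frag_cmul k (\<theta>1 p)" for p q k
    by (simp_all add: \<theta>1_def lin)
  have \<theta>2_lin: "\<theta>2 (p + q) = \<theta>2 p + \<theta>2 q" "\<theta>2 (p - q) = \<theta>2 p - \<theta>2 q" "\<theta>2 (- p) = - \<theta>2 p"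
    "\<theta>2 (frag_cmul k p) = frag_cmul k (\<theta>2 p)" "\<theta>2 0 = 0" for p q k
    by (simp_all add: \<theta>2_def lin)
  have \<kappa>1_lin: "\<kappa>1 (p + q) = \<kappa>1 p + \<kappa>1 q" "\<kappa>1 (p - q) = \<kappa>1 p - \<kappa>1 q" "\<kappa>1 (- p) = - \<kappa>1 p" for p q
    by (simp_all add: \<kappa>1_def lin)
  have \<kappa>2_lin: "\<kappa>2 (p + q) = \<kappa>2 p + \<kappa>2 q" "\<kappa>2 (p - q) = \<kappa>2 p - \<kappa>2 q" "\<kappa>2 (- p) = - \<kappa>2 p" for p q
    by (simp_all add: \<kappa>2_def lin)
  have \<theta>_gen: "\<theta>1 (frag_of (C False)) = frag_of None" "\<theta>1 (frag_of (C True)) = - frag_of None + N'"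
    "\<theta>2 (frag_of i) = frag_of (Some i)" "\<theta>1 0 = 0" for i
    by (simp_all add: \<theta>1_def \<theta>2_def C_eq)
  have \<kappa>_gen: "\<kappa>1 (frag_of None) = frag_cmul (1 - c) (frag_of (C False)) - frag_cmul c (frag_of (C True))"
    "\<kappa>1 (frag_of (Some i)) = - frag_of (C False) - frag_of (C True)"
    "\<kappa>2 (frag_of None) = frag_cmul c N" "\<kappa>2 (frag_of (Some i)) = frag_of i + N" "\<kappa>1 0 = 0" "\<kappa>2 0 = 0" for i
    by (simp_all add: \<kappa>1_def \<kappa>2_def)
  have \<kappa>\<theta>: "\<kappa> (\<theta> x) = x" if x: "x \<in> carrier ?A" for x
  proof -
    have "(\<kappa> \<circ> \<theta>) x = id x"
    proof (rule hom_eq_on_generate[OF A.M.is_group A.M.is_group Group.hom_compose[OF \<theta>_hom \<kappa>_hom]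
          iso_imp_homomorphism[OF id_iso] gA(2)])
      fix y assume "y \<in> gA"
      then show "(\<kappa> \<circ> \<theta>) y = id y"
        unfolding gA_def
        by (auto simp: \<theta>_def \<kappa>_def \<theta>1_lin \<theta>2_lin \<kappa>1_lin \<kappa>2_lin \<theta>_gen \<kappa>_gen \<theta>2N \<kappa>2N \<kappa>1N augN
            intro!: poly_mapping_eqI simp: lookup_add lookup_minus)
          (simp_all add: n_c lookup_double algebra_simps)
    qed (use x gA(1) in simp)
    then show ?thesis by simp
  qed
  have \<theta>\<kappa>: "\<theta> (\<kappa> x) = x" if x: "x \<in> carrier ?B" for x
  proof -
    have "(\<theta> \<circ> \<kappa>) x = id x"
    proof (rule hom_eq_on_generate[OF B.M.is_group B.M.is_group Group.hom_compose[OF \<kappa>_hom \<theta>_hom]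
          iso_imp_homomorphism[OF id_iso] gB(2)])
      fix y assume "y \<in> gB"
      then show "(\<theta> \<circ> \<kappa>) y = id y"
        unfolding gB_def
        by (auto simp: \<theta>_def \<kappa>_def \<theta>1_lin \<theta>2_lin \<kappa>1_lin \<kappa>2_lin \<theta>_gen \<kappa>_gen \<theta>2N \<kappa>2N \<kappa>1N augN
            intro!: poly_mapping_eqI simp: lookup_add lookup_minus)
          (simp_all add: n_c lookup_double algebra_simps)
    qed (use x gB(1) in simp)
    then show ?thesis by simp
  qed
  have iso: "\<theta> \<in> iso ?A ?B"
    by (rule group_isomorphisms_imp_iso[of _ _ _ \<kappa>])
      (unfold group_isomorphisms_def, intro conjI ballI \<theta>_hom \<kappa>_hom \<kappa>\<theta> \<theta>\<kappa>)
  show ?thesis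
  proof (rule lattice_isoI[OF GA GB iso])
    have tau: "dih_tau \<in> carrier ?G" using n by (simp add: dih_tau_def)
    have cosets: "dih_sigma n <#\<^bsub>?G\<^esub> C b = C b" "dih_tau <#\<^bsub>?G\<^esub> C b = C (\<not> b)" for b
      using coset[of 1 False b] coset[of 0 True b] n
      by (simp_all add: dih_sigma_def dih_tau_def)
    have acts: "action ?P g p = frag_extend (\<lambda>K. frag_of (g <#\<^bsub>?G\<^esub> K)) p"
      "action trivial_lattice g z = z" for g p z
      by (simp_all add: permutation_lattice_def trivial_lattice_def)
    have act0: "action (M_plus n) t 0 = 0" "action (M_tilde_plus n) t 0 = 0"
      if "t \<in> {dih_sigma n, dih_tau}" for t
      using that n
      by (auto simp: M_plus_def M_tilde_plus_def dihedral_action_def dih_sigma_def dih_tau_def)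
    show "\<theta> (action ?A g m) = action ?B g (\<theta> m)"
      if "g \<in> carrier ?G" "m \<in> carrier ?A" for g m
    proof (rule equivariant_on_generators[OF GA B.M.is_group \<theta>_hom B.action_hom B.action_mult B.action_one _
          generate_dihedral gA(2,1) _ that])
      fix t x assume "t \<in> {dih_sigma n, dih_tau}" "x \<in> gA"
      then show "\<theta> (action ?A t x) = action ?B t (\<theta> x)"
        using n action_M_tilde_plus_conjugate[OF n(1), folded N'_def]
        by (auto simp: gA_def \<theta>_def acts cosets action_M_plus action_M_tilde_plus \<theta>_gen act0 \<theta>2_lin simp flip: N'_def)
    qed (use n tau sigma in auto)
  qed
qed

section \<open>Relation modules\<close>

definition relation_class :: "('a, 'b) monoid_scheme \<Rightarrow> ('g, 'c) monoid_scheme \<Rightarrow> ('a \<Rightarrow> 'g) \<Rightarrow> 'a \<Rightarrow> 'a set"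
  where "relation_class F G \<epsilon> r = derived F (kernel F G \<epsilon>) #>\<^bsub>F\<^esub> r"

context
  fixes F :: "('a, 'b) monoid_scheme" and G :: "('g, 'c) monoid_scheme" and \<epsilon>
  assumes hom: "group_hom F G \<epsilon>"
begin

interpretation group_hom F G \<epsilon> by (rule hom)

lemma kernel_subgroup: "subgroup (kernel F G \<epsilon>) F"
  using normal_kernel by (rule normal_imp_subgroup)

lemma carrier_relation_module:
  "carrier (relation_module F G \<epsilon>) = relation_class F G \<epsilon> ` kernel F G \<epsilon>"
  by (auto simp: relation_module_def relation_class_def FactGroup_def RCOSETS_def r_coset_def)

lemma comm_group_relation_module: "comm_group (relation_module F G \<epsilon>)"
  using G.derived_quot_of_subgroup_is_comm_group[OF kernel_subgroup]
    G.derived_consistent[OF _ kernel_subgroup, of "kernel F G \<epsilon>"]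
  by (simp add: relation_module_def)

lemma relation_class_mult:
  assumes "r \<in> kernel F G \<epsilon>" "r' \<in> kernel F G \<epsilon>"
  shows "relation_class F G \<epsilon> (r \<otimes>\<^bsub>F\<^esub> r') =
    relation_class F G \<epsilon> r \<otimes>\<^bsub>relation_module F G \<epsilon>\<^esub> relation_class F G \<epsilon> r'"
proof -
  have "derived F (kernel F G \<epsilon>) \<lhd> F" by (rule G.derived_is_normal[OF normal_kernel])
  then show ?thesis using normal.rcos_sum[of _ F r r'] assms
    by (simp add: relation_module_def relation_class_def FactGroup_def kernel_def set_mult_def)
qed

lemma relation_class_one: "relation_class F G \<epsilon> \<one>\<^bsub>F\<^esub> = \<one>\<^bsub>relation_module F G \<epsilon>\<^esub>"
  using G.coset_mult_one[OF G.derived_in_carrier[OF subgroup.subset[OF kernel_subgroup]]]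
  by (simp add: relation_class_def relation_module_def)

lemma conj_by_kernel:
  "\<lbrakk>x \<in> carrier F; r \<in> kernel F G \<epsilon>\<rbrakk> \<Longrightarrow> conj_by F x r \<in> kernel F G \<epsilon>"
  using normal.inv_op_closed2[OF normal_kernel] by (simp add: conj_by_def)

lemma action_relation_class:
  "\<lbrakk>x \<in> carrier F; r \<in> kernel F G \<epsilon>\<rbrakk> \<Longrightarrow>
    action (relation_module F G \<epsilon>) (\<epsilon> x) (relation_class F G \<epsilon> r)
      = relation_class F G \<epsilon> (conj_by F x r)"
  unfolding relation_class_def by (rule relation_module_action[OF hom])

lemma relation_module_laws:
  assumes surj: "\<epsilon> ` carrier F = carrier G"
  shows "g \<in> carrier G \<Longrightarrow>
      action (relation_module F G \<epsilon>) g \<in> hom (relation_module F G \<epsilon>) (relation_module F G \<epsilon>)"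
    and "\<lbrakk>g \<in> carrier G; h \<in> carrier G; m \<in> carrier (relation_module F G \<epsilon>)\<rbrakk> \<Longrightarrow>
      action (relation_module F G \<epsilon>) (g \<otimes>\<^bsub>G\<^esub> h) m =
      action (relation_module F G \<epsilon>) g (action (relation_module F G \<epsilon>) h m)"
    and "m \<in> carrier (relation_module F G \<epsilon>) \<Longrightarrow> action (relation_module F G \<epsilon>) \<one>\<^bsub>G\<^esub> m = m"
proof -
  let ?M = "relation_module F G \<epsilon>" and ?R = "kernel F G \<epsilon>"
  have Rc: "r \<in> carrier F" if "r \<in> ?R" for r using that by (simp add: kernel_def)
  show "action ?M g \<in> hom ?M ?M" if "g \<in> carrier G"
  proof -
    obtain x where x: "x \<in> carrier F" "g = \<epsilon> x" using surj \<open>g \<in> carrier G\<close> by auto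
    show ?thesis
    proof (rule homI)
      fix m m' assume "m \<in> carrier ?M" "m' \<in> carrier ?M"
      then obtain r r' where r: "r \<in> ?R" "m = relation_class F G \<epsilon> r"
        "r' \<in> ?R" "m' = relation_class F G \<epsilon> r'" by (auto simp: carrier_relation_module)
      have "conj_by F x (r \<otimes>\<^bsub>F\<^esub> r') = conj_by F x r \<otimes>\<^bsub>F\<^esub> conj_by F x r'"
        using x r Rc by (simp add: conj_by_def G.m_assoc G.inv_solve_left)
      moreover have "r \<otimes>\<^bsub>F\<^esub> r' \<in> ?R" using r subgroup.m_closed[OF kernel_subgroup] by simp
      ultimately show "action ?M g (m \<otimes>\<^bsub>?M\<^esub> m') = action ?M g m \<otimes>\<^bsub>?M\<^esub> action ?M g m'"
        using x r by (simp add: action_relation_class conj_by_kernel flip: relation_class_mult)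
    next
      fix m assume "m \<in> carrier ?M"
      then show "action ?M g m \<in> carrier ?M"
        using x by (auto simp: carrier_relation_module action_relation_class conj_by_kernel)
    qed
  qed
  show "action ?M (g \<otimes>\<^bsub>G\<^esub> h) m = action ?M g (action ?M h m)"
    if gh: "g \<in> carrier G" "h \<in> carrier G" and m: "m \<in> carrier ?M"
  proof -
    obtain x y where x: "x \<in> carrier F" "g = \<epsilon> x" and y: "y \<in> carrier F" "h = \<epsilon> y"
      using surj gh by (metis imageE)
    obtain r where r: "r \<in> ?R" "m = relation_class F G \<epsilon> r" using m by (auto simp: carrier_relation_module)
    have "conj_by F (x \<otimes>\<^bsub>F\<^esub> y) r = conj_by F x (conj_by F y r)"
      using x y Rc[OF r(1)] by (simp add: conj_by_def G.m_assoc G.inv_mult_group)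
    then show ?thesis
      using x y r action_relation_class[of "x \<otimes>\<^bsub>F\<^esub> y" r] by (simp add: action_relation_class conj_by_kernel)
  qed
  show "action ?M \<one>\<^bsub>G\<^esub> m = m" if "m \<in> carrier ?M"
  proof -
    obtain r where r: "r \<in> ?R" "m = relation_class F G \<epsilon> r"
      using \<open>m \<in> carrier ?M\<close> by (auto simp: carrier_relation_module)
    have "conj_by F \<one>\<^bsub>F\<^esub> r = r" using Rc[OF r(1)] by (simp add: conj_by_def)
    then show ?thesis using action_relation_class[of "\<one>\<^bsub>F\<^esub>" r] r by simp
  qed
qed

text \<open>A homomorphism to a commutative group kills commutators, so it is defined on \<open>R / [R,R]\<close> as soon as
it is defined on \<open>R\<close>. This is how the coefficients of Fox derivatives become functionals on the
relation module.\<close>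

lemma relation_module_hom_to_comm_group:
  assumes N: "comm_group N" and f: "f \<in> hom (F\<lparr>carrier := kernel F G \<epsilon>\<rparr>) N"
  obtains \<phi> where "\<phi> \<in> hom (relation_module F G \<epsilon>) N"
    "\<And>r. r \<in> kernel F G \<epsilon> \<Longrightarrow> \<phi> (relation_class F G \<epsilon> r) = f r"
proof -
  let ?R = "kernel F G \<epsilon>"
  let ?K = "F\<lparr>carrier := ?R\<rparr>"
  let ?D = "derived F ?R"
  interpret K: group ?K by (rule G.subgroup_imp_group[OF kernel_subgroup])
  interpret N: comm_group N by fact
  interpret f: group_hom ?K N f using f by unfold_locales
  have D: "?D = derived ?K (carrier ?K)"
    using G.derived_consistent[OF _ kernel_subgroup, of ?R] by simp
  have Dn: "?D \<lhd> ?K" unfolding D by (rule K.derived_self_is_normal)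
  have "?D \<subseteq> kernel ?K N f"
    unfolding D unfolding derived_def
  proof (rule K.generate_subgroup_incl)
    show "subgroup (kernel ?K N f) ?K" by (rule f.subgroup_kernel)
    show "(\<Union>h1\<in>carrier ?K. \<Union>h2\<in>carrier ?K.
        {h1 \<otimes>\<^bsub>?K\<^esub> h2 \<otimes>\<^bsub>?K\<^esub> inv\<^bsub>?K\<^esub> h1 \<otimes>\<^bsub>?K\<^esub> inv\<^bsub>?K\<^esub> h2}) \<subseteq> kernel ?K N f"
    proof (rule subsetI, elim UN_E)
      fix x h1 h2 assume h: "h1 \<in> carrier ?K" "h2 \<in> carrier ?K"
        and x: "x \<in> {h1 \<otimes>\<^bsub>?K\<^esub> h2 \<otimes>\<^bsub>?K\<^esub> inv\<^bsub>?K\<^esub> h1 \<otimes>\<^bsub>?K\<^esub> inv\<^bsub>?K\<^esub> h2}"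
      have c: "h1 \<otimes>\<^bsub>?K\<^esub> h2 \<otimes>\<^bsub>?K\<^esub> inv\<^bsub>?K\<^esub> h1 \<otimes>\<^bsub>?K\<^esub> inv\<^bsub>?K\<^esub> h2 \<in> carrier ?K"
        by (intro K.m_closed K.inv_closed h)
      have "f (h1 \<otimes>\<^bsub>?K\<^esub> h2 \<otimes>\<^bsub>?K\<^esub> inv\<^bsub>?K\<^esub> h1 \<otimes>\<^bsub>?K\<^esub> inv\<^bsub>?K\<^esub> h2)
        = f h1 \<otimes>\<^bsub>N\<^esub> f h2 \<otimes>\<^bsub>N\<^esub> inv\<^bsub>N\<^esub> f h1 \<otimes>\<^bsub>N\<^esub> inv\<^bsub>N\<^esub> f h2"
        using f.hom_mult f.hom_inv h K.m_closed K.inv_closed by metis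
      also have "\<dots> = \<one>\<^bsub>N\<^esub>"
        using f.hom_closed[OF h(1)] f.hom_closed[OF h(2)]
        by (simp add: N.m_comm[of "f h1" "f h2"] N.m_assoc N.inv_solve_left)
      finally show "x \<in> kernel ?K N f" using c x by (simp add: kernel_def)
    qed
  qed
  from f.FactGroup_universal_kernel[OF Dn this]
  obtain \<phi> where \<phi>: "\<phi> \<in> hom (?K Mod ?D) N" "\<And>x. x \<in> carrier ?K \<Longrightarrow> \<phi> (?D #>\<^bsub>?K\<^esub> x) = f x"
    by metis
  show thesis
    by (rule that[of \<phi>]) (use \<phi> in \<open>simp_all add: relation_module_def relation_class_def r_coset_def\<close>)
qed

end

section \<open>Free differential calculus\<close>

text \<open>\<open>fox G s w b h\<close> is the coefficient at \<open>h\<close> of the image in \<open>\<int>[G]\<close> of the Fox derivative \<open>\<partial>w/\<partial>b\<close>, where the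
letter \<open>a\<close> acts as \<open>s a\<close>. Equivalently, it is the signed number of times that the path spelled by \<open>w\<close>
in the Cayley graph, starting at \<open>1\<close>, runs through the edge labelled \<open>b\<close> that leaves \<open>h\<close>.\<close>

fun fox :: "('g, 'c) monoid_scheme \<Rightarrow> ('a \<Rightarrow> 'g) \<Rightarrow> ('a \<times> bool) list \<Rightarrow> 'a \<Rightarrow> 'g \<Rightarrow> int" where
  "fox G s [] b h = 0"
| "fox G s ((a, e) # w) b h =
    (if e then of_bool (b = a \<and> h = \<one>\<^bsub>G\<^esub>) else - of_bool (b = a \<and> h = inv\<^bsub>G\<^esub> (s a)))
    + fox G s w b (inv\<^bsub>G\<^esub> (if e then s a else inv\<^bsub>G\<^esub> (s a)) \<otimes>\<^bsub>G\<^esub> h)"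

lemma free_lift_closed:
  assumes "group G" "s \<in> S \<rightarrow> carrier G" "fst ` set w \<subseteq> S"
  shows "free_lift G s w \<in> carrier G"
proof -
  interpret group G by fact
  show ?thesis using assms(2,3)
    by (induction w) (auto simp: free_lift_def intro!: m_closed inv_closed)
qed

text \<open>Free reduction removes a passage back and forth along one edge, which contributes zero.\<close>

lemma fox_prepend:
  fixes G (structure)
  assumes G: "group G" and s: "s \<in> S \<rightarrow> carrier G" and x: "fst x \<in> S" and w: "fst ` set w \<subseteq> S"
    and h: "h \<in> carrier G"
  shows "fox G s (prepend x w) b h = fox G s (x # w) b h"
proof (cases w)
  case (Cons y ys)
  interpret group G by fact
  obtain a e where xa: "x = (a, e)" by (cases x)
  have sa: "s a \<in> carrier G" using s x xa by auto
  show ?thesis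
  proof (cases "cancels x y")
    case True
    then have y: "y = (a, \<not> e)" using xa by (cases y) (auto simp: cancels_def)
    have "inv s a \<otimes> h = inv s a \<longleftrightarrow> h = \<one>" using sa h by simp
    moreover have "s a \<otimes> h = \<one> \<longleftrightarrow> h = inv s a"
      using sa h by (metis inv_equality inv_inv r_inv)
    moreover have "inv s a \<otimes> (s a \<otimes> h) = h" "s a \<otimes> (inv s a \<otimes> h) = h"
      using sa h by (simp_all flip: m_assoc)
    ultimately show ?thesis using True sa by (cases e) (auto simp: Cons xa y)
  qed (simp add: Cons)
qed simp

lemma fox_foldr_prepend:
  fixes G (structure)
  assumes G: "group G" and s: "s \<in> S \<rightarrow> carrier G" and v: "fst ` set v \<subseteq> S"
  shows "fst ` set u \<subseteq> S \<Longrightarrow> h \<in> carrier G \<Longrightarrow> fox G s (foldr prepend u v) b h =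
    fox G s u b h + fox G s v b (inv\<^bsub>G\<^esub> (free_lift G s u) \<otimes>\<^bsub>G\<^esub> h)"
proof (induction u arbitrary: h)
  case Nil
  interpret group G by fact
  show ?case using Nil by (simp add: free_lift_def)
next
  case (Cons x u)
  interpret group G by fact
  obtain a e where x: "x = (a, e)" by (cases x)
  have sa: "s a \<in> carrier G" using s Cons.prems x by auto
  have u: "fst ` set u \<subseteq> S" and a: "a \<in> S" using Cons.prems x by auto
  have lu: "free_lift G s u \<in> carrier G" by (rule free_lift_closed[OF G s u])
  have sub: "fst ` set (foldr prepend u v) \<subseteq> S"
    using order.trans[OF image_mono[OF set_foldr_prepend[of u v], of fst]] u v
    by (simp add: image_Un)
  define g where "g = (if e then s a else inv s a)"
  have g: "g \<in> carrier G" using sa by (simp add: g_def)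
  have lift: "free_lift G s (x # u) = g \<otimes> free_lift G s u"
    by (simp add: free_lift_def x g_def)
  have "inv (free_lift G s (x # u)) \<otimes> h = inv (free_lift G s u) \<otimes> (inv g \<otimes> h)"
    using g lu Cons.prems(2) by (simp add: lift inv_mult_group m_assoc)
  then show ?case
    using fox_prepend[OF G s _ sub Cons.prems(2), of x b] a Cons.IH[OF u, of "inv g \<otimes> h"] g Cons.prems(2)
    by (simp add: x g_def)
qed

context
  fixes S :: "'a set" and G :: "('g, 'c) monoid_scheme" and \<epsilon> :: "('a \<times> bool) list \<Rightarrow> 'g"
  assumes hom: "group_hom (free_group S) G \<epsilon>"
begin

interpretation group_hom "free_group S" G \<epsilon> by (rule hom)

abbreviation "fox\<epsilon> \<equiv> fox G (\<lambda>a. \<epsilon> (free_gen a))"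

text \<open>The product rule \<open>\<partial>(uv) = \<partial>u + u \<partial>v\<close>: the second path starts where the first one ends. On the kernel
of \<open>\<epsilon>\<close> the derivatives are therefore additive.\<close>

lemma fox_mult:
  assumes u: "u \<in> carrier (free_group S)" and v: "v \<in> carrier (free_group S)" and h: "h \<in> carrier G"
  shows "fox\<epsilon> (u \<otimes>\<^bsub>free_group S\<^esub> v) b h
    = fox\<epsilon> u b h + fox\<epsilon> v b (inv\<^bsub>G\<^esub> (\<epsilon> u) \<otimes>\<^bsub>G\<^esub> h)"
proof -
  let ?s = "\<lambda>a. \<epsilon> (free_gen a)"
  have gen: "free_gen ` S \<subseteq> carrier (free_group S)"
    by (auto simp: free_gen_def free_group_def)
  have s: "?s \<in> S \<rightarrow> carrier G" using gen by auto
  have "free_lift G ?s u = \<epsilon> u"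
  proof (rule hom_eq_on_generate[OF G.is_group H.is_group free_lift_hom(1)[OF H.is_group s] homh gen])
    show "free_lift G ?s x = \<epsilon> x" if "x \<in> free_gen ` S" for x
      using that free_lift_hom(2)[OF H.is_group s] by auto
    show "u \<in> generate (free_group S) (free_gen ` S)" using u by (simp add: generate_free_group)
  qed
  then show ?thesis
    using fox_foldr_prepend[OF H.is_group s, of v u h b] u v h by (simp add: free_group_def)
qed

lemma fox_one: "fox\<epsilon> \<one>\<^bsub>free_group S\<^esub> b h = 0"
  by (simp add: free_group_def)

text \<open>The paths of \<open>u\<close> and of its inverse around the loop \<open>r\<close> cancel, because the loop returns to its
starting point. So Fox derivatives are equivariant on the kernel.\<close>

lemma fox_conj_by:
  assumes u: "u \<in> carrier (free_group S)" and r: "r \<in> kernel (free_group S) G \<epsilon>" and h: "h \<in> carrier G"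
  shows "fox\<epsilon> (conj_by (free_group S) u r) b h = fox\<epsilon> r b (inv\<^bsub>G\<^esub> (\<epsilon> u) \<otimes>\<^bsub>G\<^esub> h)"
proof -
  have rc: "r \<in> carrier (free_group S)" "\<epsilon> r = \<one>\<^bsub>G\<^esub>" using r by (auto simp: kernel_def)
  have "fox\<epsilon> u b h + fox\<epsilon> (inv\<^bsub>free_group S\<^esub> u) b (inv\<^bsub>G\<^esub> (\<epsilon> u) \<otimes>\<^bsub>G\<^esub> h) = 0"
    using fox_mult[OF u _ h, of "inv\<^bsub>free_group S\<^esub> u" b] u fox_one by simp
  then show ?thesis
    using u rc h by (simp add: conj_by_def fox_mult)
qed

lemma fox_relation_module:
  assumes h: "h \<in> carrier G"
  obtains \<phi> where "\<phi> \<in> hom (relation_module (free_group S) G \<epsilon>) integer_group"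
    "\<And>r. r \<in> kernel (free_group S) G \<epsilon> \<Longrightarrow>
      \<phi> (relation_class (free_group S) G \<epsilon> r) = fox\<epsilon> r b h"
proof (rule relation_module_hom_to_comm_group[OF hom abelian_integer_group])
  show "(\<lambda>r. fox\<epsilon> r b h) \<in> hom (free_group S\<lparr>carrier := kernel (free_group S) G \<epsilon>\<rparr>) integer_group"
    by (rule homI) (use h in \<open>auto simp: kernel_def fox_mult\<close>)
qed (rule that)

end

lemma hom_free_Abelian_group_int:
  assumes f: "f \<in> hom (free_Abelian_group S) integer_group" and S: "finite S" and p: "Poly_Mapping.keys p \<subseteq> S"
  shows "f p = (\<Sum>i\<in>S. Poly_Mapping.lookup p i * f (frag_of i))"
proof (rule hom_eq_on_generate[OF group_free_Abelian_group group_integer_group f])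
  show "(\<lambda>p. \<Sum>i\<in>S. Poly_Mapping.lookup p i * f (frag_of i)) \<in> hom (free_Abelian_group S) integer_group"
    by (rule homI) (simp_all add: lookup_add algebra_simps sum.distrib)
  show "frag_of ` S \<subseteq> carrier (free_Abelian_group S)" by auto
  show "p \<in> generate (free_Abelian_group S) (frag_of ` S)"
    using p by (simp add: generate_free_Abelian_group)
  fix x assume "x \<in> frag_of ` S"
  then obtain s where s: "s \<in> S" "x = frag_of s" by auto
  have "(\<Sum>i\<in>S. Poly_Mapping.lookup x i * f (frag_of i)) = (\<Sum>i\<in>S. if i = s then f (frag_of i) else 0)"
    by (rule sum.cong) (auto simp: s(2))
  then show "f x = (\<Sum>i\<in>S. Poly_Mapping.lookup x i * f (frag_of i))" using S s by simp
qed

lemma hom_sum_free_Abelian_group: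
  assumes "comm_group M" and f: "f \<in> hom (free_Abelian_group S) M" and "finite I"
    and x: "\<And>i. i \<in> I \<Longrightarrow> Poly_Mapping.keys (x i) \<subseteq> S"
  shows "f (\<Sum>i\<in>I. x i) = finprod M (\<lambda>i. f (x i)) I"
proof -
  interpret M: comm_group M by fact
  interpret f: group_hom "free_Abelian_group S" M f
    by (intro group_hom.intro group_free_Abelian_group M.is_group group_hom_axioms.intro f)
  from \<open>finite I\<close> x show ?thesis
  proof (induction I rule: finite_induct)
    case empty
    then show ?case using f.hom_one by simp
  next
    case (insert i I)
    have s: "(\<Sum>i\<in>I. x i) \<in> carrier (free_Abelian_group S)"
      by (rule sum_closed_free_Abelian_group) (use insert in simp)
    have "f (x i + (\<Sum>i\<in>I. x i)) = f (x i) \<otimes>\<^bsub>M\<^esub> f (\<Sum>i\<in>I. x i)"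
      using f.hom_mult[of "x i" "\<Sum>i\<in>I. x i"] s insert by simp
    moreover have "f (x k) \<in> carrier M" if "k \<in> insert i I" for k
      using f.hom_closed[of "x k"] insert.prems[OF that] by simp
    ultimately show ?case using insert by (simp add: Pi_iff)
  qed
qed

section \<open>Generators of the relation module\<close>

locale dihedral_presentation =
  fixes n :: nat and \<alpha> \<beta> :: 'a and \<epsilon> :: "('a \<times> bool) list \<Rightarrow> int \<times> bool"
  assumes n: "3 \<le> n" and distinct: "\<alpha> \<noteq> \<beta>"
    and hom: "\<epsilon> \<in> hom (free_group {\<alpha>, \<beta>}) (dihedral n)"
    and \<epsilon>1: "\<epsilon> (free_gen \<alpha>) = dih_sigma n"
    and \<epsilon>2: "\<epsilon> (free_gen \<beta>) = dih_tau"
begin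

abbreviation "F \<equiv> free_group {\<alpha>, \<beta>}"
abbreviation "G \<equiv> dihedral n"
abbreviation "R \<equiv> kernel F G \<epsilon>"
abbreviation "M \<equiv> relation_module F G \<epsilon>"
abbreviation "cls \<equiv> relation_class F G \<epsilon>"
abbreviation "act \<equiv> action M"
abbreviation "s1 \<equiv> free_gen \<alpha>"
abbreviation "s2 \<equiv> free_gen \<beta>"
abbreviation "sigma_pow i \<equiv> (i mod int n, False)"

lemma n0: "0 < n" using n by simp

sublocale F: group F by (rule group_free_group)
sublocale G: group G by (rule group_dihedral[OF n0])
sublocale \<epsilon>: group_hom F G \<epsilon>
  by (intro group_hom.intro F.is_group G.is_group group_hom_axioms.intro hom)
sublocale M: comm_group M by (rule comm_group_relation_module[OF \<epsilon>.group_hom_axioms])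

lemmas \<epsilon>_group_hom = \<epsilon>.group_hom_axioms

lemma s_closed [simp]: "s1 \<in> carrier F" "s2 \<in> carrier F"
  by (auto simp: free_gen_def free_group_def)

lemma sigma_tau: "dih_sigma n = (1, False)" "dih_tau = (0, True)"
  using n by (simp_all add: dih_sigma_def dih_tau_def)

lemma generate_s: "generate F {s1, s2} = carrier F"
  using generate_free_group[of "{\<alpha>, \<beta>}"] by simp

lemma \<epsilon>_pow: "\<epsilon> (s1 [^]\<^bsub>F\<^esub> (k::nat)) = sigma_pow (int k)"
  by (simp add: \<epsilon>.hom_nat_pow \<epsilon>1 dihedral_pow_sigma[OF n0] del: dihedral_simps)

lemma \<epsilon>_surj: "\<epsilon> ` carrier F = carrier G"
proof -
  have "\<epsilon> ` generate F {s1, s2} = generate G (\<epsilon> ` {s1, s2})"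
    by (rule \<epsilon>.generate_img[symmetric]) simp
  then show ?thesis
    using generate_dihedral[OF n0] by (simp add: generate_s \<epsilon>1 \<epsilon>2 del: dihedral_simps)
qed

lemmas act_laws = relation_module_laws[OF \<epsilon>_group_hom \<epsilon>_surj]

lemma act_closed: "g \<in> carrier G \<Longrightarrow> m \<in> carrier M \<Longrightarrow> act g m \<in> carrier M"
  using act_laws(1)[of g] by (simp add: hom_def Pi_iff del: dihedral_simps)

lemma act_group_hom: "g \<in> carrier G \<Longrightarrow> group_hom M M (act g)"
  by (intro group_hom.intro M.is_group group_hom_axioms.intro act_laws(1))

lemma cls_closed: "r \<in> R \<Longrightarrow> cls r \<in> carrier M"
  by (simp add: carrier_relation_module[OF \<epsilon>_group_hom])

lemma R_carrier: "r \<in> R \<Longrightarrow> r \<in> carrier F" by (simp add: kernel_def)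

lemma R_I: "r \<in> carrier F \<Longrightarrow> \<epsilon> r = (0, False) \<Longrightarrow> r \<in> R"
  by (simp add: kernel_def)

definition "a_word = s2 \<otimes>\<^bsub>F\<^esub> s2"
definition "b_word = s1 \<otimes>\<^bsub>F\<^esub> s2 \<otimes>\<^bsub>F\<^esub> s1 \<otimes>\<^bsub>F\<^esub> s2"
definition "w_word = s1 [^]\<^bsub>F\<^esub> n"

lemma words_R: "a_word \<in> R" "b_word \<in> R" "w_word \<in> R"
  using n by (auto intro!: R_I simp: a_word_def b_word_def w_word_def \<epsilon>1 \<epsilon>2 sigma_tau \<epsilon>_pow)

lemma act_cls:
  "\<lbrakk>u \<in> carrier F; r \<in> R; conj_by F u r = r'; \<epsilon> u = g\<rbrakk> \<Longrightarrow> act g (cls r) = cls r'"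
  using action_relation_class[OF \<epsilon>_group_hom, of u r] by simp

text \<open>The three classes, and the element \<open>y\<close>, whose orbit will be the image of the basis elements \<open>x\<^sub>i\<close>
of the second summand. As \<open>2j + 1 = n\<close>, conjugation by \<open>\<sigma>\<^sup>j\<close> turns the stabiliser \<open>\<langle>\<sigma>\<tau>\<rangle>\<close> of \<open>b\<close> into
\<open>\<langle>\<sigma>\<^sup>2\<^sup>j\<^sup>+\<^sup>1\<tau>\<rangle> = \<langle>\<tau>\<rangle>\<close>. Dividing by \<open>a\<close> removes the contribution of \<open>a\<close> from the product over the orbit.\<close>

definition "a0 = cls a_word"
definition "b0 = cls b_word"
definition "w0 = cls w_word"
definition "j0 = (int n - 1) div 2"
definition "y0 = act (j0, False) b0 \<otimes>\<^bsub>M\<^esub> inv\<^bsub>M\<^esub> a0"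

lemma j0: "0 \<le> j0" "j0 < int n" using n by (auto simp: j0_def)

lemma abw_closed [simp]: "a0 \<in> carrier M" "b0 \<in> carrier M" "w0 \<in> carrier M"
  using words_R by (simp_all add: a0_def b0_def w0_def cls_closed)

lemma y0_closed [simp]: "y0 \<in> carrier M"
  using j0 by (simp add: y0_def act_closed)

lemma tau_a0: "act (0, True) a0 = a0"
  unfolding a0_def
  by (rule act_cls[of s2]) (simp_all add: words_R \<epsilon>2 sigma_tau, simp add: a_word_def conj_by_def F.m_assoc)

lemma sigma_w0: "act (1, False) w0 = w0"
proof -
  have "s1 \<otimes>\<^bsub>F\<^esub> s1 [^]\<^bsub>F\<^esub> n \<otimes>\<^bsub>F\<^esub> inv\<^bsub>F\<^esub> s1 = s1 [^]\<^bsub>F\<^esub> n"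
    using F.nat_pow_comm[of s1 1 n] by (simp add: F.m_assoc)
  then show ?thesis unfolding w0_def
    by (intro act_cls[of s1]) (simp_all add: words_R(3) \<epsilon>1 sigma_tau, simp add: w_word_def conj_by_def)
qed

lemma sigma_tau_b0: "act (1, True) b0 = b0"
  unfolding b0_def
proof (rule act_cls[of "s1 \<otimes>\<^bsub>F\<^esub> s2"])
  show "\<epsilon> (s1 \<otimes>\<^bsub>F\<^esub> s2) = (1, True)" using n by (simp add: \<epsilon>1 \<epsilon>2 sigma_tau)
  have "b_word = (s1 \<otimes>\<^bsub>F\<^esub> s2) \<otimes>\<^bsub>F\<^esub> (s1 \<otimes>\<^bsub>F\<^esub> s2)" by (simp add: b_word_def F.m_assoc)
  moreover have "conj_by F u (u \<otimes>\<^bsub>F\<^esub> u) = u \<otimes>\<^bsub>F\<^esub> u" if "u \<in> carrier F" for u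
    using that by (simp add: conj_by_def F.m_assoc)
  ultimately show "conj_by F (s1 \<otimes>\<^bsub>F\<^esub> s2) b_word = b_word" by simp
qed (simp_all add: words_R)

lemma act_act: "\<lbrakk>g \<in> carrier G; h \<in> carrier G; m \<in> carrier M\<rbrakk> \<Longrightarrow> act g (act h m) = act (g \<otimes>\<^bsub>G\<^esub> h) m"
  using act_laws(2) by (simp del: dihedral_simps)

lemma act_one: "m \<in> carrier M \<Longrightarrow> act (0, False) m = m"
  using act_laws(3) by simp

lemma tau_y0:
  assumes "odd n" shows "act (0, True) y0 = y0"
proof -
  have j: "int n = 2 * j0 + 1" using \<open>odd n\<close> n by (auto simp: j0_def elim!: oddE)
  interpret t: group_hom M M "act (0, True)" using n by (intro act_group_hom) simp
  have "act (0, True) (act (j0, False) b0) = act ((- j0) mod int n, True) b0"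
    using act_act[of "(0, True)" "(j0, False)" b0] j0 n by simp
  also have "(- j0) mod int n = (j0 + 1) mod int n"
    using j by (metis add.commute add_diff_cancel_left' diff_minus_eq_add mod_add_self2 minus_diff_eq mult_2 add.assoc uminus_add_conv_diff)
  also have "act ((j0 + 1) mod int n, True) b0 = act (j0, False) (act (1, True) b0)"
    using act_act[of "(j0, False)" "(1, True)" b0] j0 n by simp
  also have "\<dots> = act (j0, False) b0" by (simp add: sigma_tau_b0)
  finally show ?thesis
    using j0 by (simp add: y0_def tau_a0 act_closed)
qed

lemma sigma_orbit:
  "m \<in> carrier M \<Longrightarrow> i \<in> {0..<int n} \<Longrightarrow> act (1, False) (act (i, False) m) = act ((i + 1) mod int n, False) m"
  using act_act[of "(1, False)" "(i, False)" m] n by (simp add: add.commute)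

text \<open>For \<open>m\<close> fixed by \<open>\<tau>\<close>, the orbit under \<open>\<sigma>\<close> is permuted by \<open>\<tau>\<close> like the basis of \<open>M\<^sub>+\<close>, because
\<open>\<tau>\<sigma>\<^sup>i = \<sigma>\<^sup>-\<^sup>i\<tau>\<close>.\<close>

lemma tau_orbit:
  assumes "m \<in> carrier M" "i \<in> {0..<int n}" "act (0, True) m = m"
  shows "act (0, True) (act (i, False) m) = act ((- i) mod int n, False) m"
proof -
  have "act (0, True) (act (i, False) m) = act ((- i) mod int n, True) m"
    using act_act[of "(0, True)" "(i, False)" m] assms n by simp
  also have "\<dots> = act ((- i) mod int n, False) (act (0, True) m)"
    using act_act[of "((- i) mod int n, False)" "(0, True)" m] assms n by simp
  finally show ?thesis using assms(3) by simp
qed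

definition "orbit_prod m = finprod M (\<lambda>i. act (i, False) m) {0..<int n}"

lemma orbit_closed: "m \<in> carrier M \<Longrightarrow> (\<lambda>i. act (i, False) m) \<in> {0..<int n} \<rightarrow> carrier M"
  by (auto intro!: act_closed)

lemma orbit_prod_closed [simp]: "m \<in> carrier M \<Longrightarrow> orbit_prod m \<in> carrier M"
  unfolding orbit_prod_def by (rule M.finprod_closed[OF orbit_closed])

lemma orbit_prod_mult:
  assumes "m \<in> carrier M" "m' \<in> carrier M"
  shows "orbit_prod (m \<otimes>\<^bsub>M\<^esub> m') = orbit_prod m \<otimes>\<^bsub>M\<^esub> orbit_prod m'"
proof -
  have "orbit_prod (m \<otimes>\<^bsub>M\<^esub> m') = finprod M (\<lambda>i. act (i, False) m \<otimes>\<^bsub>M\<^esub> act (i, False) m') {0..<int n}"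
    unfolding orbit_prod_def
  proof (rule M.finprod_cong')
    show "act (i, False) (m \<otimes>\<^bsub>M\<^esub> m') = act (i, False) m \<otimes>\<^bsub>M\<^esub> act (i, False) m'"
      if "i \<in> {0..<int n}" for i
      using group_hom.hom_mult[OF act_group_hom, of "(i, False)" m m'] that assms by simp
  qed (use assms in \<open>auto intro!: act_closed\<close>)
  also have "\<dots> = orbit_prod m \<otimes>\<^bsub>M\<^esub> orbit_prod m'"
    unfolding orbit_prod_def by (rule M.finprod_multf[OF orbit_closed orbit_closed]) (use assms in auto)
  finally show ?thesis .
qed

lemma orbit_prod_act:
  assumes m: "m \<in> carrier M" and j: "j \<in> {0..<int n}"
  shows "orbit_prod (act (j, False) m) = orbit_prod m"
proof -
  let ?h = "\<lambda>i. (i + j) mod int n"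
  have bij: "bij_betw ?h {0..<int n} {0..<int n}" by (rule bij_betw_add_mod[OF n0])
  then have img: "?h ` {0..<int n} = {0..<int n}" and inj: "inj_on ?h {0..<int n}"
    by (auto simp: bij_betw_def)
  have "orbit_prod (act (j, False) m) = finprod M (\<lambda>i. act (?h i, False) m) {0..<int n}"
    unfolding orbit_prod_def
  proof (rule M.finprod_cong')
    show "act (i, False) (act (j, False) m) = act (?h i, False) m" if "i \<in> {0..<int n}" for i
      using act_act[of "(i, False)" "(j, False)" m] that m j by simp
  qed (use m n in \<open>auto intro!: act_closed\<close>)
  also have "\<dots> = finprod M (\<lambda>i. act (i, False) m) (?h ` {0..<int n})"
    by (rule M.finprod_reindex[symmetric]) (use inj m n in \<open>auto intro!: act_closed\<close>)
  finally show ?thesis by (simp only: img orbit_prod_def)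
qed

definition "t_word = s2 \<otimes>\<^bsub>F\<^esub> s1 \<otimes>\<^bsub>F\<^esub> inv\<^bsub>F\<^esub> s2"

lemma t_word: "t_word \<in> carrier F" "\<epsilon> t_word = sigma_pow (- 1)"
  using n by (auto simp: t_word_def \<epsilon>1 \<epsilon>2 sigma_tau inv_dihedral)

lemma t_pow: "\<epsilon> (t_word [^]\<^bsub>F\<^esub> (k::nat)) = sigma_pow (- int k)"
proof (induction k)
  case (Suc k)
  then show ?case using t_word by (simp add: mod_simps algebra_simps)
qed simp

lemma conj_pow: "conj_by F s2 (s1 [^]\<^bsub>F\<^esub> (k::nat)) = t_word [^]\<^bsub>F\<^esub> k"
proof (induction k)
  case (Suc k)
  have "conj_by F s2 (s1 [^]\<^bsub>F\<^esub> Suc k) = conj_by F s2 (s1 [^]\<^bsub>F\<^esub> k) \<otimes>\<^bsub>F\<^esub> t_word"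
    by (simp add: conj_by_def t_word_def F.m_assoc F.inv_solve_left)
  then show ?case using Suc by simp
qed (simp add: conj_by_def)

lemma st_R: "s1 [^]\<^bsub>F\<^esub> k \<otimes>\<^bsub>F\<^esub> t_word [^]\<^bsub>F\<^esub> k \<in> R" for k :: nat
  by (rule R_I) (simp_all add: t_word \<epsilon>_pow t_pow mod_simps)

text \<open>One step of the telescope is \<open>s\<^sub>1\<^sup>k\<^sup>+\<^sup>1t\<^sup>k\<^sup>+\<^sup>1 = s\<^sub>1\<^sup>k(s\<^sub>1t)s\<^sub>1\<^sup>-\<^sup>k \<cdot> s\<^sub>1\<^sup>kt\<^sup>k\<close>. Both factors are relations, since
\<open>t\<close> maps to the inverse of \<open>\<sigma>\<close>.\<close>

lemma st_telescope:
  "k \<le> n \<Longrightarrow> cls (s1 [^]\<^bsub>F\<^esub> k \<otimes>\<^bsub>F\<^esub> t_word [^]\<^bsub>F\<^esub> k) =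
    finprod M (\<lambda>i. act (i, False) (cls (s1 \<otimes>\<^bsub>F\<^esub> t_word))) {0..<int k}"
proof (induction k)
  case 0
  then show ?case by (simp add: relation_class_one[OF \<epsilon>_group_hom])
next
  case (Suc k)
  let ?r = "s1 \<otimes>\<^bsub>F\<^esub> t_word" and ?p = "s1 [^]\<^bsub>F\<^esub> k" and ?q = "t_word [^]\<^bsub>F\<^esub> k"
  have c: "?p \<in> carrier F" "?q \<in> carrier F" "t_word \<in> carrier F" using t_word by simp_all
  have r: "?r \<in> R" using st_R[of 1] t_word by simp
  have "conj_by F ?p ?r \<otimes>\<^bsub>F\<^esub> (?p \<otimes>\<^bsub>F\<^esub> ?q) = ?p \<otimes>\<^bsub>F\<^esub> s1 \<otimes>\<^bsub>F\<^esub> (t_word \<otimes>\<^bsub>F\<^esub> ?q)"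
  proof -
    have "inv\<^bsub>F\<^esub> ?p \<otimes>\<^bsub>F\<^esub> (?p \<otimes>\<^bsub>F\<^esub> ?q) = ?q" using c by (simp flip: F.m_assoc)
    then show ?thesis using c by (simp add: conj_by_def F.m_assoc)
  qed
  also have "\<dots> = s1 [^]\<^bsub>F\<^esub> Suc k \<otimes>\<^bsub>F\<^esub> t_word [^]\<^bsub>F\<^esub> Suc k"
    using F.nat_pow_Suc[of s1 k] F.nat_pow_Suc2[OF c(3), of k] by metis
  finally have "cls (s1 [^]\<^bsub>F\<^esub> Suc k \<otimes>\<^bsub>F\<^esub> t_word [^]\<^bsub>F\<^esub> Suc k)
    = cls (conj_by F ?p ?r) \<otimes>\<^bsub>M\<^esub> cls (?p \<otimes>\<^bsub>F\<^esub> ?q)"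
    using relation_class_mult[OF \<epsilon>_group_hom conj_by_kernel[OF \<epsilon>_group_hom c(1) r] st_R[of k]] by simp
  also have "cls (conj_by F ?p ?r) = act (int k, False) (cls ?r)"
    by (rule act_cls[symmetric, OF c(1) r refl]) (use Suc.prems in \<open>simp add: \<epsilon>_pow\<close>)
  finally have eq: "cls (s1 [^]\<^bsub>F\<^esub> Suc k \<otimes>\<^bsub>F\<^esub> t_word [^]\<^bsub>F\<^esub> Suc k)
    = act (int k, False) (cls ?r) \<otimes>\<^bsub>M\<^esub> finprod M (\<lambda>i. act (i, False) (cls ?r)) {0..<int k}"
    using Suc by simp
  have "{0..<int (Suc k)} = insert (int k) {0..<int k}" by auto
  moreover have "act (i, False) (cls ?r) \<in> carrier M" if "i \<in> {0..int k}" for i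
    using that Suc.prems by (intro act_closed cls_closed r) auto
  ultimately show ?case using eq by (simp add: Pi_iff)
qed

text \<open>The relation \<open>w + \<tau>w = \<Sum>x\<^sub>i\<close> of the extension of \<open>M\<^sub>+\<close>. The full telescope \<open>s\<^sub>1\<^sup>nt\<^sup>n\<close> represents
\<open>w + \<tau>w\<close>, as \<open>t\<^sup>n\<close> is the conjugate of \<open>s\<^sub>1\<^sup>n\<close> by \<open>s\<^sub>2\<close>. Its factors form the orbit of \<open>[s\<^sub>1t] = b - a\<close>,
by \<open>(s\<^sub>1t)s\<^sub>2\<^sup>2 = (s\<^sub>1s\<^sub>2)\<^sup>2\<close>, and \<open>y = \<sigma>\<^sup>jb - a\<close> has the same product over its orbit, because \<open>\<sigma>\<^sup>j\<close> only
permutes the orbit of \<open>b\<close>.\<close>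

lemma orbit_prod_y0: "orbit_prod y0 = w0 \<otimes>\<^bsub>M\<^esub> act (0, True) w0"
proof -
  let ?r = "s1 \<otimes>\<^bsub>F\<^esub> t_word"
  have r: "?r \<in> R" using st_R[of 1] t_word by simp
  have tau_w: "act (0, True) w0 = cls (t_word [^]\<^bsub>F\<^esub> n)"
    unfolding w0_def
    by (rule act_cls[of s2]) (simp_all add: words_R(3) \<epsilon>2 sigma_tau, simp add: w_word_def conj_pow)
  have tR: "t_word [^]\<^bsub>F\<^esub> n \<in> R" by (rule R_I) (simp_all add: t_word t_pow)
  have "orbit_prod (cls ?r) = cls (s1 [^]\<^bsub>F\<^esub> n \<otimes>\<^bsub>F\<^esub> t_word [^]\<^bsub>F\<^esub> n)"
    using st_telescope[of n] by (simp add: orbit_prod_def)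
  also have "\<dots> = w0 \<otimes>\<^bsub>M\<^esub> act (0, True) w0"
    unfolding tau_w using relation_class_mult[OF \<epsilon>_group_hom words_R(3) tR] by (simp add: w0_def w_word_def)
  finally have norm_r: "orbit_prod (cls ?r) = w0 \<otimes>\<^bsub>M\<^esub> act (0, True) w0" .
  have "inv\<^bsub>F\<^esub> s2 \<otimes>\<^bsub>F\<^esub> (s2 \<otimes>\<^bsub>F\<^esub> s2) = s2" by (simp flip: F.m_assoc)
  then have "?r \<otimes>\<^bsub>F\<^esub> a_word = b_word"
    by (simp add: t_word_def a_word_def b_word_def F.m_assoc)
  then have b0: "b0 = cls ?r \<otimes>\<^bsub>M\<^esub> a0"
    using relation_class_mult[OF \<epsilon>_group_hom r words_R(1)] by (simp add: b0_def a0_def)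
  have "orbit_prod (y0 \<otimes>\<^bsub>M\<^esub> a0) = orbit_prod (act (j0, False) b0)"
    using j0 by (simp add: y0_def M.m_assoc act_closed)
  also have "\<dots> = orbit_prod (cls ?r) \<otimes>\<^bsub>M\<^esub> orbit_prod a0"
    using j0 r by (simp add: orbit_prod_act orbit_prod_mult b0 cls_closed)
  finally have "orbit_prod y0 \<otimes>\<^bsub>M\<^esub> orbit_prod a0 = orbit_prod (cls ?r) \<otimes>\<^bsub>M\<^esub> orbit_prod a0"
    by (simp add: orbit_prod_mult)
  then have "orbit_prod y0 = orbit_prod (cls ?r)" using r by (simp add: cls_closed)
  then show ?thesis by (simp only: norm_r)
qed

text \<open>The preimage \<open>H\<close> of \<open>K\<close> in \<open>F\<close> is normal, by stability, and contains the dihedral relators. By von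
Dyck's theorem the projection \<open>F \<rightarrow> F / H\<close> then factors through \<open>\<epsilon>\<close>, so it kills the kernel of \<open>\<epsilon>\<close>.\<close>

lemma stable_subgroup_eq_carrier:
  assumes K: "subgroup K M" and stable: "\<And>g m. \<lbrakk>g \<in> carrier G; m \<in> K\<rbrakk> \<Longrightarrow> act g m \<in> K"
    and abw: "a0 \<in> K" "b0 \<in> K" "w0 \<in> K"
  shows "K = carrier M"
proof -
  define H where "H = {r \<in> R. cls r \<in> K}"
  have Rs: "subgroup R F" by (rule kernel_subgroup[OF \<epsilon>_group_hom])
  have H_mult: "r \<otimes>\<^bsub>F\<^esub> r' \<in> H" if "r \<in> H" "r' \<in> H" for r r'
    using that subgroup.m_closed[OF Rs] subgroup.m_closed[OF K] by (simp add: H_def relation_class_mult[OF \<epsilon>_group_hom])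
  have H_inv: "inv\<^bsub>F\<^esub> r \<in> H" if "r \<in> H" for r
  proof -
    have r: "r \<in> R" "cls r \<in> K" "inv\<^bsub>F\<^esub> r \<in> R"
      using that subgroup.m_inv_closed[OF Rs] by (auto simp: H_def)
    have "cls r \<otimes>\<^bsub>M\<^esub> cls (inv\<^bsub>F\<^esub> r) = \<one>\<^bsub>M\<^esub>"
      using relation_class_mult[OF \<epsilon>_group_hom r(1,3)] relation_class_one[OF \<epsilon>_group_hom] R_carrier[OF r(1)] by simp
    then have "cls (inv\<^bsub>F\<^esub> r) = inv\<^bsub>M\<^esub> (cls r)"
      using r by (intro M.comm_inv_char[symmetric]) (auto intro: cls_closed)
    then show ?thesis using r subgroup.m_inv_closed[OF K] by (simp add: H_def)
  qed
  have H_sub: "subgroup H F"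
  proof (rule F.subgroupI)
    show "H \<subseteq> carrier F" using R_carrier by (auto simp: H_def)
    show "H \<noteq> {}"
      using subgroup.one_closed[OF Rs] subgroup.one_closed[OF K] relation_class_one[OF \<epsilon>_group_hom] by (auto simp: H_def)
  qed (use H_mult H_inv in auto)
  have H_normal: "H \<lhd> F"
    unfolding F.normal_inv_iff
  proof (intro conjI H_sub ballI)
    fix u r assume u: "u \<in> carrier F" and r: "r \<in> H"
    have "cls (conj_by F u r) = act (\<epsilon> u) (cls r)"
      using r u by (intro act_cls[symmetric]) (auto simp: H_def)
    then show "u \<otimes>\<^bsub>F\<^esub> r \<otimes>\<^bsub>F\<^esub> inv\<^bsub>F\<^esub> u \<in> H"
      using stable[OF \<epsilon>.hom_closed[OF u]] conj_by_kernel[OF \<epsilon>_group_hom u] r by (simp add: H_def conj_by_def)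
  qed
  let ?Q = "F Mod H"
  let ?\<pi> = "\<lambda>u. H #>\<^bsub>F\<^esub> u"
  have Q: "group ?Q" by (rule normal.factorgroup_is_group[OF H_normal])
  have \<pi>: "?\<pi> \<in> hom F ?Q" by (rule normal.r_coset_hom_Mod[OF H_normal])
  interpret \<pi>: group_hom F ?Q ?\<pi>
    by (intro group_hom.intro F.is_group Q group_hom_axioms.intro \<pi>)
  have one: "?\<pi> u = \<one>\<^bsub>?Q\<^esub> \<longleftrightarrow> u \<in> H" if "u \<in> carrier F" for u
    using F.coset_join1[OF _ that H_sub] F.coset_join2[OF that H_sub]
    by (auto simp del: \<pi>.hom_one)
  define \<delta> where "\<delta> = (\<lambda>(i, a). ?\<pi> s1 [^]\<^bsub>?Q\<^esub> (i::int) \<otimes>\<^bsub>?Q\<^esub> (if a then ?\<pi> s2 else \<one>\<^bsub>?Q\<^esub>))"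
  have words_H: "a_word \<in> H" "b_word \<in> H" "w_word \<in> H"
    using abw words_R by (auto simp: H_def a0_def b0_def w0_def)
  have "?\<pi> s1 [^]\<^bsub>?Q\<^esub> n = \<one>\<^bsub>?Q\<^esub>"
    using one[of w_word] words_H(3) by (simp add: w_word_def \<pi>.hom_nat_pow)
  moreover have TT: "?\<pi> s2 \<otimes>\<^bsub>?Q\<^esub> ?\<pi> s2 = \<one>\<^bsub>?Q\<^esub>"
    using one[of a_word] words_H(1) by (simp add: a_word_def del: mult_FactGroup)
  moreover have "?\<pi> s1 \<otimes>\<^bsub>?Q\<^esub> ?\<pi> s2 \<otimes>\<^bsub>?Q\<^esub> ?\<pi> s1 = ?\<pi> s2"
  proof -
    have "(?\<pi> s1 \<otimes>\<^bsub>?Q\<^esub> ?\<pi> s2 \<otimes>\<^bsub>?Q\<^esub> ?\<pi> s1) \<otimes>\<^bsub>?Q\<^esub> ?\<pi> s2 = \<one>\<^bsub>?Q\<^esub>"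
      using one[of b_word] words_H(2) by (simp add: b_word_def del: mult_FactGroup)
    then have "(?\<pi> s1 \<otimes>\<^bsub>?Q\<^esub> ?\<pi> s2 \<otimes>\<^bsub>?Q\<^esub> ?\<pi> s1) \<otimes>\<^bsub>?Q\<^esub> ?\<pi> s2 = ?\<pi> s2 \<otimes>\<^bsub>?Q\<^esub> ?\<pi> s2"
      by (simp only: TT)
    then show ?thesis
      by (rule \<pi>.H.right_cancel[THEN iffD1, rotated 3])
        (simp_all del: mult_FactGroup one_FactGroup)
  qed
  ultimately have \<delta>: "\<delta> \<in> hom G ?Q"
    unfolding \<delta>_def by (intro dihedral_hom[OF n0 Q]) (simp_all del: mult_FactGroup one_FactGroup)
  have "\<delta> \<circ> \<epsilon> \<in> hom F ?Q" by (rule Group.hom_compose[OF hom \<delta>])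
  then have \<pi>\<delta>: "?\<pi> u = (\<delta> \<circ> \<epsilon>) u" if "u \<in> carrier F" for u
  proof (rule hom_eq_on_generate[OF F.is_group Q \<pi>, of _ "{s1, s2}"])
    show "?\<pi> x = (\<delta> \<circ> \<epsilon>) x" if "x \<in> {s1, s2}" for x
      using that \<pi>.H.int_pow_1[of "?\<pi> s1"]
      by (auto simp: \<delta>_def \<epsilon>1 \<epsilon>2 sigma_tau simp del: mult_FactGroup one_FactGroup)
  qed (use that generate_s in auto)
  have "R \<subseteq> H"
  proof
    fix r assume r: "r \<in> R"
    then have "\<epsilon> r = \<one>\<^bsub>G\<^esub>" by (simp add: kernel_def)
    then have "?\<pi> r = \<one>\<^bsub>?Q\<^esub>"
      using \<pi>\<delta>[OF R_carrier[OF r]] hom_one[OF \<delta> G.is_group Q] by simp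
    then show "r \<in> H" using one R_carrier[OF r] by simp
  qed
  then show ?thesis
    using subgroup.subset[OF K] by (auto simp: carrier_relation_module[OF \<epsilon>_group_hom] H_def)
qed

section \<open>Linear independence of the generators\<close>

abbreviation "foxd \<equiv> fox G (\<lambda>a. \<epsilon> (free_gen a))"

lemma fox_\<alpha> [simp]: "foxd s1 b h = of_bool (b = \<alpha> \<and> h = (0, False))"
  and fox_\<beta> [simp]: "foxd s2 b h = of_bool (b = \<beta> \<and> h = (0, False))"
  by (simp_all add: free_gen_def)

lemma fox_a_word:
  assumes "i \<in> {0..<int n}"
  shows "foxd a_word b (i, c) = of_bool (b = \<beta> \<and> i = 0)"
  using assms n zmod_zminus1_not_zero[of i "int n"]
  by (cases c) (auto simp: a_word_def fox_mult[OF \<epsilon>_group_hom] \<epsilon>2 sigma_tau inv_dihedral zmod_zminus1_eq_if split: if_splits)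

lemma fox_b_word:
  assumes "i \<in> {0..<int n}"
  shows "foxd b_word \<alpha> (i, c) = of_bool (if c then i = 1 else i = 0)"
proof -
  have inv1: "inv\<^bsub>G\<^esub> (\<epsilon> s1) \<otimes>\<^bsub>G\<^esub> (k, e) = ((k - 1) mod int n, e)" for k e
    using n by (simp add: \<epsilon>1 sigma_tau inv_dihedral mod_simps)
  have inv2: "inv\<^bsub>G\<^esub> (\<epsilon> s2) \<otimes>\<^bsub>G\<^esub> (k, e) = ((- k) mod int n, \<not> e)" for k e
    using n by (simp add: \<epsilon>2 sigma_tau inv_dihedral)
  have "b_word = s1 \<otimes>\<^bsub>F\<^esub> (s2 \<otimes>\<^bsub>F\<^esub> (s1 \<otimes>\<^bsub>F\<^esub> s2))" by (simp add: b_word_def F.m_assoc)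
  then have "foxd b_word \<alpha> (i, c) = of_bool (i = 0 \<and> \<not> c) + of_bool ((1 - i) mod int n = 0 \<and> c)"
    using assms distinct n by (simp add: fox_mult[OF \<epsilon>_group_hom] inv1 inv2 mod_simps)
  moreover have "(1 - i) mod int n = 0 \<longleftrightarrow> i = 1"
  proof
    assume "(1 - i) mod int n = 0"
    then have "1 mod int n = i mod int n" by (simp add: mod_eq_dvd_iff mod_eq_0_iff_dvd)
    then show "i = 1" using assms n by simp
  qed simp
  ultimately show ?thesis by auto
qed

lemma fox_w_word:
  assumes "i \<in> {0..<int n}"
  shows "foxd w_word \<alpha> (i, c) = of_bool (\<not> c)"
proof -
  have "k \<le> n \<Longrightarrow> foxd (s1 [^]\<^bsub>F\<^esub> k) \<alpha> (i, c) = of_bool (\<not> c \<and> i < int k)" for k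
  proof (induction k)
    case 0
    then show ?case using assms fox_one[OF \<epsilon>_group_hom] by simp
  next
    case (Suc k)
    have "inv\<^bsub>G\<^esub> (\<epsilon> (s1 [^]\<^bsub>F\<^esub> k)) \<otimes>\<^bsub>G\<^esub> (i, c) = ((i - int k) mod int n, c)"
      using Suc.prems by (simp add: \<epsilon>_pow inv_dihedral mod_simps)
    moreover have "(i - int k) mod int n = 0 \<longleftrightarrow> i = int k"
      using assms Suc.prems by (simp add: mod_eq_dvd_iff flip: mod_eq_0_iff_dvd)
        (metis atLeastLessThan_iff less_eq_Suc_le mod_eq_dvd_iff mod_pos_pos_trivial of_nat_0_le_iff of_nat_less_iff mod_eq_0_iff_dvd)
    ultimately show ?case
      using Suc assms by (auto simp: fox_mult[OF \<epsilon>_group_hom])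
  qed
  then show ?thesis using assms by (simp add: w_word_def)
qed

text \<open>The coefficients of the Fox derivatives as integer-valued functionals \<open>\<phi> b h\<close> on the relation module,
indexed by the edges of the Cayley graph. Moving the module element by \<open>\<sigma>\<^sup>i\<close> moves the edge by \<open>\<sigma>\<^sup>-\<^sup>i\<close>,
so their values on orbits follow from those on the three relators.\<close>

lemma fox_functional:
  obtains \<phi> where "\<And>b h. h \<in> carrier G \<Longrightarrow> \<phi> b h \<in> hom M integer_group"
    and "\<And>b h r. h \<in> carrier G \<Longrightarrow> r \<in> R \<Longrightarrow> \<phi> b h (cls r) = foxd r b h"
    and "\<And>b i h m. i \<in> {0..<int n} \<Longrightarrow> h \<in> carrier G \<Longrightarrow> m \<in> carrier M \<Longrightarrow>
      \<phi> b h (act (i, False) m) = \<phi> b ((fst h - i) mod int n, snd h) m"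
proof -
  let ?P = "\<lambda>b h \<phi>. \<phi> \<in> hom M integer_group \<and> (\<forall>r\<in>R. \<phi> (cls r) = foxd r b h)"
  define \<phi> where "\<phi> b h = (SOME \<psi>. ?P b h \<psi>)" for b h
  have ex: "\<exists>\<psi>. ?P b h \<psi>" if h: "h \<in> carrier G" for b h
  proof (rule fox_relation_module[OF \<epsilon>_group_hom h, of b])
    fix \<psi> assume "\<psi> \<in> hom M integer_group" "\<And>r. r \<in> R \<Longrightarrow> \<psi> (cls r) = foxd r b h"
    then show "\<exists>\<psi>. ?P b h \<psi>" by (intro exI[of _ \<psi>]) simp
  qed
  have "?P b h (\<phi> b h)" if "h \<in> carrier G" for b h
    unfolding \<phi>_def by (rule someI_ex[OF ex[OF that]])
  then have \<phi>: "\<And>b h. h \<in> carrier G \<Longrightarrow> \<phi> b h \<in> hom M integer_group"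
    "\<And>b h r. h \<in> carrier G \<Longrightarrow> r \<in> R \<Longrightarrow> \<phi> b h (cls r) = foxd r b h"
    by simp_all
  show thesis
  proof (rule that[OF \<phi>])
    fix b i h m assume i: "i \<in> {0..<int n}" and h: "h \<in> carrier G" and m: "m \<in> carrier M"
    obtain k c where kc: "h = (k, c)" by (cases h)
    obtain r where r: "r \<in> R" "m = cls r" using m by (auto simp: carrier_relation_module[OF \<epsilon>_group_hom])
    obtain l where l: "i = int l" using i by (metis atLeastLessThan_iff nonneg_int_cases)
    let ?u = "s1 [^]\<^bsub>F\<^esub> l"
    have u: "?u \<in> carrier F" "\<epsilon> ?u = (i, False)" using i by (simp_all add: \<epsilon>_pow l)
    have k: "inv\<^bsub>G\<^esub> (\<epsilon> ?u) \<otimes>\<^bsub>G\<^esub> h = ((k - i) mod int n, c)"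
      unfolding u(2) kc using i by (simp add: inv_dihedral mod_simps)
    have "act (i, False) m = cls (conj_by F ?u r)"
      unfolding r(2) by (rule act_cls[OF u(1) r(1) refl u(2)])
    moreover have "((k - i) mod int n, c) \<in> carrier G" using n by simp
    ultimately show "\<phi> b h (act (i, False) m) = \<phi> b ((fst h - i) mod int n, snd h) m"
      using \<phi>(2)[OF h conj_by_kernel[OF \<epsilon>_group_hom u(1) r(1)]] \<phi>(2)[OF _ r(1)] fox_conj_by[OF \<epsilon>_group_hom u(1) r(1) h]
      by (simp add: r(2) k[unfolded kc] kc)
  qed
qed

section \<open>The isomorphisms\<close>

text \<open>The homomorphism \<open>f\<close> of the introduction is equivariant by the orbit relations and surjective by
\<open>stable_subgroup_eq_carrier\<close>. For injectivity three families of functionals are applied to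
a linear relation, in an order that isolates one kind of coefficient at a time. The edges labelled
\<open>s\<^sub>1\<close> that leave a reflection meet only the orbit of \<open>y\<close>, each of them a single member of it. Once the
coefficients of this orbit vanish, the edge labelled \<open>s\<^sub>1\<close> that leaves \<open>1\<close> meets only \<open>w\<close>, and after that
the edges labelled \<open>s\<^sub>2\<close> that leave the rotations separate the orbit of \<open>a\<close>.\<close>

lemma lattice_iso_relation_module:
  assumes odd: "odd n"
  shows "lattice_iso G M (M_plus n \<oplus>\<^sub>L M_tilde_plus n)"
proof -
  let ?S = "{0..<int n}"
  let ?T = "insert None (Some ` ?S)"
  let ?L = "M_plus n \<oplus>\<^sub>L M_tilde_plus n"
  have ac: "act (i, False) m \<in> carrier M" if "i \<in> ?S" "m \<in> carrier M" for i m
    using that by (intro act_closed) auto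
  have xc: "(\<lambda>i. act (i, False) a0) ` ?S \<subseteq> carrier M" using ac by auto
  obtain g1 where g1: "g1 \<in> hom (free_Abelian_group ?S) M"
    and g1x: "\<And>i. i \<in> ?S \<Longrightarrow> g1 (frag_of i) = act (i, False) a0"
    using M.free_Abelian_group_universal[OF xc] by metis
  let ?y = "\<lambda>b. case b of None \<Rightarrow> w0 | Some i \<Rightarrow> act (i, False) y0"
  have yc: "?y ` ?T \<subseteq> carrier M" using ac by auto
  obtain g2 where g2: "g2 \<in> hom (free_Abelian_group ?T) M"
    and g2y: "\<And>b. b \<in> ?T \<Longrightarrow> g2 (frag_of b) = ?y b"
    using M.free_Abelian_group_universal[OF yc] by metis
  have g2w: "g2 (frag_of None) = w0" using g2y[of None] by simp
  have g2x: "g2 (frag_of (Some i)) = act (i, False) y0" if "i \<in> ?S" for i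
    using g2y[of "Some i"] that by simp
  interpret g1: group_hom "free_Abelian_group ?S" M g1
    by (intro group_hom.intro group_free_Abelian_group M.is_group group_hom_axioms.intro g1)
  interpret g2: group_hom "free_Abelian_group ?T" M g2
    by (intro group_hom.intro group_free_Abelian_group M.is_group group_hom_axioms.intro g2)
  define f where "f = (\<lambda>(p, q). g1 p \<otimes>\<^bsub>M\<^esub> g2 q)"
  have carL: "carrier ?L = {p. Poly_Mapping.keys p \<subseteq> ?S} \<times> {q. Poly_Mapping.keys q \<subseteq> ?T}"
    by (simp add: M_plus_def M_tilde_plus_def carrier_free_Abelian_group)
  have multL: "p \<otimes>\<^bsub>M_plus n\<^esub> p' = p + p'" "q \<otimes>\<^bsub>M_tilde_plus n\<^esub> q' = q + q'" for p p' q q'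
    by (simp_all add: M_plus_def M_tilde_plus_def)
  have g1c: "g1 p \<in> carrier M" if "Poly_Mapping.keys p \<subseteq> ?S" for p
    using g1.hom_closed[of p] that by simp
  have g2c: "g2 q \<in> carrier M" if "Poly_Mapping.keys q \<subseteq> ?T" for q
    using g2.hom_closed[of q] that by simp
  have f: "f \<in> hom ?L M"
  proof (rule homI)
    fix l l' assume l: "l \<in> carrier ?L" "l' \<in> carrier ?L"
    obtain p q p' q' where pq: "l = (p, q)" "l' = (p', q')" by (cases l, cases l')
    have k: "Poly_Mapping.keys p \<subseteq> ?S" "Poly_Mapping.keys q \<subseteq> ?T"
      "Poly_Mapping.keys p' \<subseteq> ?S" "Poly_Mapping.keys q' \<subseteq> ?T"
      using l unfolding carL pq by auto
    have "g1 (p + p') = g1 p \<otimes>\<^bsub>M\<^esub> g1 p'" "g2 (q + q') = g2 q \<otimes>\<^bsub>M\<^esub> g2 q'"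
      using g1.hom_mult[of p p'] g2.hom_mult[of q q'] k by simp_all
    then show "f (l \<otimes>\<^bsub>?L\<^esub> l') = f l \<otimes>\<^bsub>M\<^esub> f l'"
      using g1c[OF k(1)] g1c[OF k(3)] g2c[OF k(2)] g2c[OF k(4)]
      by (simp add: f_def pq multL M.m_ac)
    show "f l \<in> carrier M"
      using g1c[OF k(1)] g2c[OF k(2)] by (simp add: f_def pq)
  qed
  have GL: "G_lattice G ?L"
    by (intro G_lattice_direct_sum G_lattice_M_plus G_lattice_M_tilde_plus n0)
  interpret L: G_lattice G ?L by (rule GL)
  interpret f: group_hom ?L M f
    by (intro group_hom.intro L.M.is_group M.is_group group_hom_axioms.intro f)
  define gen where "gen = (\<lambda>i. (frag_of i, 0)) ` ?S \<union> (\<lambda>b. (0, frag_of b)) ` ?T"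
  have gen: "generate ?L gen = carrier ?L" "gen \<subseteq> carrier ?L"
  proof -
    have "generate ?L ((\<lambda>x. (x, \<one>\<^bsub>M_tilde_plus n\<^esub>)) ` (frag_of ` ?S) \<union> (\<lambda>y. (\<one>\<^bsub>M_plus n\<^esub>, y)) ` (frag_of ` ?T))
      = carrier ?L"
      by (rule generate_direct_sum)
        (auto simp: M_plus_def M_tilde_plus_def generate_free_Abelian_group
          simp del: Un_insert_left image_insert)
    moreover have "(\<lambda>x. (x, \<one>\<^bsub>M_tilde_plus n\<^esub>)) ` (frag_of ` ?S) \<union> (\<lambda>y. (\<one>\<^bsub>M_plus n\<^esub>, y)) ` (frag_of ` ?T) = gen"
      by (simp add: gen_def M_plus_def M_tilde_plus_def image_image)
    ultimately show "generate ?L gen = carrier ?L" by simp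
    show "gen \<subseteq> carrier ?L" unfolding carL by (auto simp: gen_def)
  qed
  have g1_0: "g1 0 = \<one>\<^bsub>M\<^esub>" and g2_0: "g2 0 = \<one>\<^bsub>M\<^esub>" using g1.hom_one g2.hom_one by simp_all
  have tau_w: "g2 (- frag_of None + (\<Sum>i\<in>?S. frag_of (Some i))) = act (0, True) w0"
  proof -
    let ?N = "\<Sum>i\<in>?S. frag_of (Some i)"
    have "Poly_Mapping.keys ?N \<subseteq> ?T" using keys_sum_frag_of[of ?S Some] by auto
    then have "g2 (- frag_of None + ?N) = inv\<^bsub>M\<^esub> w0 \<otimes>\<^bsub>M\<^esub> g2 ?N"
      using g2.hom_mult[of "- frag_of None" ?N] g2.hom_inv[of "frag_of None"] g2w by simp
    also have "g2 ?N = finprod M (\<lambda>i. g2 (frag_of (Some i))) ?S"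
      by (rule hom_sum_free_Abelian_group[OF M.comm_group_axioms g2]) auto
    also have "\<dots> = orbit_prod y0"
      unfolding orbit_prod_def by (rule M.finprod_cong') (use ac g2x in auto)
    finally show ?thesis
      using act_closed[of "(0, True)" w0] n by (simp add: orbit_prod_y0 flip: M.m_assoc)
  qed
  have eq: "f (action ?L g l) = act g (f l)" if "g \<in> carrier G" "l \<in> carrier ?L" for g l
  proof (rule equivariant_on_generators[OF GL M.is_group f act_laws _ generate_dihedral[OF n0] gen(2,1) _ that])
    have n2: "2 \<le> n" using n by simp
    note acts = action_M_plus[OF n2, unfolded sigma_tau] action_M_tilde_plus[OF n2, unfolded sigma_tau]
    have act0: "action (M_plus n) t 0 = 0" "action (M_tilde_plus n) t 0 = 0"
      if "t \<in> {(1, False), (0, True)}" for t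
      using that by (auto simp: M_plus_def M_tilde_plus_def dihedral_action_def)
    have mod: "(i + 1) mod int n \<in> ?S" "(- i) mod int n \<in> ?S" for i using n by auto
    fix t l assume "t \<in> {dih_sigma n, dih_tau}" and l: "l \<in> gen"
    then have t: "t = (1, False) \<or> t = (0, True)" by (auto simp: sigma_tau)
    from l consider (x) i where "i \<in> ?S" "l = (frag_of i, 0)"
      | (y) i where "i \<in> ?S" "l = (0, frag_of (Some i))" | (w) "l = (0, frag_of None)"
      by (auto simp: gen_def)
    then show "f (action ?L t l) = act t (f l)"
    proof cases
      case x
      then show ?thesis
        using t mod[of i] sigma_orbit[of a0 i] tau_orbit[of a0 i] tau_a0 ac
        by (auto simp: f_def acts act0 g2_0 g1x)
    next
      case y
      then show ?thesis
        using t mod[of i] sigma_orbit[of y0 i] tau_orbit[of y0 i] tau_y0[OF odd] ac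
        by (auto simp: f_def acts act0 g1_0 g2x)
    next
      case w
      have "act (0, True) w0 \<in> carrier M" using n by (intro act_closed) auto
      then show ?thesis
        using t w sigma_w0 tau_w by (auto simp: f_def acts act0 g1_0 g2w)
    qed
  qed (use n in \<open>auto simp: sigma_tau\<close>)
  have surj: "f ` carrier ?L = carrier M"
  proof (rule stable_subgroup_eq_carrier)
    show K: "subgroup (f ` carrier ?L) M" by (rule f.img_is_subgroup)
    show stable: "act g m \<in> f ` carrier ?L" if g: "g \<in> carrier G" and m: "m \<in> f ` carrier ?L" for g m
    proof -
      obtain l where l: "l \<in> carrier ?L" "m = f l" using m by auto
      then show ?thesis
        using eq[OF g l(1)] G_lattice_action_closed[OF GL g l(1)] by (metis imageI)
    qed
    have "f (frag_of 0, 0) = a0" "f (0, frag_of None) = w0" and y0: "f (0, frag_of (Some 0)) = y0"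
      using n g1x[of 0] g2x[of 0] by (simp_all add: f_def g1_0 g2_0 g2w act_one)
    moreover have "(frag_of 0, 0) \<in> carrier ?L" "(0, frag_of None) \<in> carrier ?L" "(0, frag_of (Some 0)) \<in> carrier ?L"
      unfolding carL using n by auto
    ultimately have a: "a0 \<in> f ` carrier ?L" and w: "w0 \<in> f ` carrier ?L" and y: "y0 \<in> f ` carrier ?L"
      by (metis imageI)+
    show "a0 \<in> f ` carrier ?L" "w0 \<in> f ` carrier ?L" by (fact a w)+
    \<comment> \<open>The class \<open>b\<close> is recovered from \<open>y\<close> and \<open>a\<close> by undoing the rotation by \<open>\<sigma>\<^sup>j\<close>.\<close>
    have "act (j0, False) b0 = y0 \<otimes>\<^bsub>M\<^esub> a0"
      using j0 by (simp add: y0_def M.m_assoc act_closed)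
    then have b: "act (j0, False) b0 \<in> f ` carrier ?L"
      using subgroup.m_closed[OF K y a] by simp
    have "((- j0) mod int n, False) \<in> carrier G" using n by simp
    then have "act ((- j0) mod int n, False) (act (j0, False) b0) \<in> f ` carrier ?L"
      by (rule stable[OF _ b])
    moreover have "act ((- j0) mod int n, False) (act (j0, False) b0) = b0"
      using act_act[of "((- j0) mod int n, False)" "(j0, False)" b0] j0 n by (simp add: mod_simps act_one)
    ultimately show "b0 \<in> f ` carrier ?L" by simp
  qed
  have inj: "inj_on f (carrier ?L)"
    unfolding f.inj_on_one_iff
  proof (intro allI impI)
      fix l assume l: "l \<in> carrier ?L" and fl: "f l = \<one>\<^bsub>M\<^esub>"
      obtain p q where pq: "l = (p, q)" by (cases l)
      have kp: "Poly_Mapping.keys p \<subseteq> ?S" and kq: "Poly_Mapping.keys q \<subseteq> ?T"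
        using l unfolding carL pq by auto
      obtain \<phi> where \<phi>: "\<And>b h. h \<in> carrier G \<Longrightarrow> \<phi> b h \<in> hom M integer_group"
        and \<phi>_cls: "\<And>b h r. h \<in> carrier G \<Longrightarrow> r \<in> R \<Longrightarrow> \<phi> b h (cls r) = foxd r b h"
        and \<phi>_act: "\<And>b i h m. i \<in> {0..<int n} \<Longrightarrow> h \<in> carrier G \<Longrightarrow> m \<in> carrier M \<Longrightarrow>
          \<phi> b h (act (i, False) m) = \<phi> b ((fst h - i) mod int n, snd h) m"
        using fox_functional by metis
      have \<phi>hom: "group_hom M integer_group (\<phi> b h)" if "h \<in> carrier G" for b h
        by (intro group_hom.intro M.is_group group_integer_group group_hom_axioms.intro \<phi> that)
      \<comment> \<open>A relation \<open>f (p, q) = 0\<close>, evaluated by an arbitrary functional.\<close>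
      have expand: "0 = (\<Sum>i\<in>?S. Poly_Mapping.lookup p i * \<phi> b h (act (i, False) a0))
          + (Poly_Mapping.lookup q None * \<phi> b h w0
            + (\<Sum>i\<in>?S. Poly_Mapping.lookup q (Some i) * \<phi> b h (act (i, False) y0)))"
        if h: "h \<in> carrier G" for b h
      proof -
        interpret \<phi>: group_hom M integer_group "\<phi> b h" by (rule \<phi>hom[OF h])
        have "(\<phi> b h \<circ> g1) p = (\<Sum>i\<in>?S. Poly_Mapping.lookup p i * (\<phi> b h \<circ> g1) (frag_of i))"
          by (rule hom_free_Abelian_group_int[OF Group.hom_compose[OF g1 \<phi>[OF h]] _ kp]) simp
        moreover have "(\<phi> b h \<circ> g2) q = (\<Sum>i\<in>?T. Poly_Mapping.lookup q i * (\<phi> b h \<circ> g2) (frag_of i))"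
          by (rule hom_free_Abelian_group_int[OF Group.hom_compose[OF g2 \<phi>[OF h]] _ kq]) simp
        moreover have "\<phi> b h (g1 p \<otimes>\<^bsub>M\<^esub> g2 q) = 0"
          using fl \<phi>.hom_one by (simp add: f_def pq)
        ultimately have "0 = (\<Sum>i\<in>?S. Poly_Mapping.lookup p i * (\<phi> b h \<circ> g1) (frag_of i))
          + (\<Sum>i\<in>?T. Poly_Mapping.lookup q i * (\<phi> b h \<circ> g2) (frag_of i))"
          using g1c[OF kp] g2c[OF kq] by simp
        moreover have "None \<notin> Some ` ?S" by auto
        ultimately show ?thesis
          by (simp add: sum.reindex g1x g2x g2w)
      qed
      have \<phi>a: "\<phi> b (k, c) (act (i, False) a0) = of_bool (b = \<beta> \<and> (k - i) mod int n = 0)"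
        if "i \<in> ?S" "k \<in> ?S" for b i k c
      proof -
        have "\<phi> b ((k - i) mod int n, c) a0 = of_bool (b = \<beta> \<and> (k - i) mod int n = 0)"
          using \<phi>_cls[OF _ words_R(1)] n by (simp add: fox_a_word a0_def)
        then show ?thesis using that \<phi>_act[of i "(k, c)" a0 b] by simp
      qed
      have \<phi>w: "\<phi> \<alpha> (k, c) w0 = of_bool (\<not> c)" if "k \<in> ?S" for k c
        using that words_R(3) by (simp add: \<phi>_cls fox_w_word w0_def)
      have \<phi>y: "\<phi> \<alpha> (k, True) (act (i, False) y0) = of_bool ((k - i - j0) mod int n = 1)"
        if i: "i \<in> ?S" and k: "k \<in> ?S" for i k
      proof -
        let ?h = "((k - i) mod int n, True)"
        have h: "?h \<in> carrier G" using n by simp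
        interpret \<phi>: group_hom M integer_group "\<phi> \<alpha> ?h" by (rule \<phi>hom[OF h])
        have j0S: "j0 \<in> ?S" using j0 by simp
        have "\<phi> \<alpha> ?h a0 = 0"
          using \<phi>_cls[OF h words_R(1)] n distinct by (simp add: a0_def fox_a_word)
        moreover have "\<phi> \<alpha> ?h (act (j0, False) b0) = of_bool ((k - i - j0) mod int n = 1)"
          using \<phi>_act[OF j0S h abw_closed(2)] \<phi>_cls[OF _ words_R(2)] n
          by (simp add: b0_def fox_b_word mod_simps)
        ultimately have "\<phi> \<alpha> ?h y0 = of_bool ((k - i - j0) mod int n = 1)"
          using ac[OF j0S abw_closed(2)] by (simp add: y0_def)
        then show ?thesis using \<phi>_act[OF i _ y0_closed, of "(k, True)"] k by simp
      qed
      have q_Some: "Poly_Mapping.lookup q (Some i) = 0" if i: "i \<in> ?S" for i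
      proof -
        \<comment> \<open>Of the orbit of \<open>y\<close>, only \<open>\<sigma>\<^sup>iy\<close> runs through the edge labelled \<open>s\<^sub>1\<close> that leaves \<open>\<sigma>\<^sup>k\<tau>\<close>.\<close>
        let ?k = "(i + j0 + 1) mod int n"
        have k: "?k \<in> ?S" using n by simp
        have one: "(?k - i' - j0) mod int n = 1 \<longleftrightarrow> i' = i" if i': "i' \<in> ?S" for i'
        proof -
          have "(?k - i' - j0) mod int n = (i - i' + 1) mod int n" by (simp add: mod_simps algebra_simps)
          then have "(?k - i' - j0) mod int n = 1 \<longleftrightarrow> (i - i' + 1) mod int n = 1 mod int n"
            using n by simp
          also have "\<dots> \<longleftrightarrow> i mod int n = i' mod int n" by (simp add: mod_eq_dvd_iff)
          also have "\<dots> \<longleftrightarrow> i' = i" using i i' by auto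
          finally show ?thesis .
        qed
        have "(\<Sum>i'\<in>?S. Poly_Mapping.lookup q (Some i') * \<phi> \<alpha> (?k, True) (act (i', False) y0))
          = (\<Sum>i'\<in>?S. if i' = i then Poly_Mapping.lookup q (Some i') else 0)"
          by (rule sum.cong) (simp_all add: \<phi>y k one)
        then show ?thesis
          using expand[of "(?k, True)" \<alpha>] k i distinct by (simp add: \<phi>a \<phi>w)
      qed
      have q_None: "Poly_Mapping.lookup q None = 0"
        using expand[of "(0, False)" \<alpha>] n distinct by (simp add: \<phi>a \<phi>w q_Some)
      have q0: "q = 0"
      proof (rule poly_mapping_eqI)
        fix b show "Poly_Mapping.lookup q b = Poly_Mapping.lookup 0 b"
          using q_None q_Some kq by (cases "b \<in> ?T") (auto simp: in_keys_iff)
      qed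
      have p_k: "Poly_Mapping.lookup p k = 0" if k: "k \<in> ?S" for k
      proof -
        have zero: "(k - i) mod int n = 0 \<longleftrightarrow> i = k" if i: "i \<in> ?S" for i
        proof -
          have "(k - i) mod int n = 0 \<longleftrightarrow> k mod int n = i mod int n"
            by (simp add: mod_eq_dvd_iff mod_eq_0_iff_dvd)
          then show ?thesis using i k by auto
        qed
        have "(\<Sum>i\<in>?S. Poly_Mapping.lookup p i * \<phi> \<beta> (k, False) (act (i, False) a0))
          = (\<Sum>i\<in>?S. if i = k then Poly_Mapping.lookup p i else 0)"
          by (rule sum.cong) (use k in \<open>simp_all add: \<phi>a zero\<close>)
        then show ?thesis using expand[of "(k, False)" \<beta>] k by (simp add: q0)
      qed
      have p0: "p = 0"
      proof (rule poly_mapping_eqI)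
        fix k show "Poly_Mapping.lookup p k = Poly_Mapping.lookup 0 k"
        proof (cases "k \<in> ?S")
          case True
          then show ?thesis using p_k by simp
        next
          case False
          then have "k \<notin> Poly_Mapping.keys p" using kp by blast
          then show ?thesis by (simp add: in_keys_iff)
        qed
      qed
      show "l = \<one>\<^bsub>?L\<^esub>" by (simp add: pq p0 q0 M_plus_def M_tilde_plus_def)
  qed
  have "f \<in> iso ?L M" using f inj surj by (simp add: iso_def bij_betw_def)
  from lattice_iso_transport[OF GL M.comm_group_axioms this eq]
  show ?thesis by (rule lattice_iso_sym)
qed

lemma lattice_iso_relation_module_trivial:
  assumes odd: "odd n"
  shows "lattice_iso G (M \<oplus>\<^sub>L trivial_lattice)
    (permutation_lattice G (generate G {dih_sigma n})
      \<oplus>\<^sub>L (permutation_lattice G (generate G {dih_tau}) \<oplus>\<^sub>L permutation_lattice G (generate G {dih_tau})))"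
proof -
  let ?Ps = "permutation_lattice G (generate G {dih_sigma n})"
  let ?Pt = "permutation_lattice G (generate G {dih_tau})"
  have n2: "2 \<le> n" using n by simp
  have lat: "G_lattice G (M_plus n)" "G_lattice G (M_tilde_plus n)"
    "G_lattice G (trivial_lattice :: (int, int \<times> bool) gmodule)" "G_lattice G ?Ps"
    using n
    by (intro G_lattice_M_plus G_lattice_M_tilde_plus G_lattice_trivial G_lattice_permutation
        G.is_group G.generate_is_subgroup n0; simp add: sigma_tau)+
  have "lattice_iso G (M \<oplus>\<^sub>L trivial_lattice) ((M_plus n \<oplus>\<^sub>L M_tilde_plus n) \<oplus>\<^sub>L trivial_lattice)"
    by (intro lattice_iso_direct_sum lattice_iso_relation_module odd lattice_iso_refl lat)
  also have "lattice_iso G ((M_plus n \<oplus>\<^sub>L M_tilde_plus n) \<oplus>\<^sub>L trivial_lattice)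
      (M_plus n \<oplus>\<^sub>L (M_tilde_plus n \<oplus>\<^sub>L trivial_lattice))"
    by (intro lattice_iso_direct_sum_assoc lat)
  also have "lattice_iso G (M_plus n \<oplus>\<^sub>L (M_tilde_plus n \<oplus>\<^sub>L trivial_lattice))
      ((M_tilde_plus n \<oplus>\<^sub>L trivial_lattice) \<oplus>\<^sub>L M_plus n)"
    by (intro lattice_iso_direct_sum_commute G_lattice_direct_sum lat)
  also have "lattice_iso G ((M_tilde_plus n \<oplus>\<^sub>L trivial_lattice) \<oplus>\<^sub>L M_plus n)
      ((?Ps \<oplus>\<^sub>L M_plus n) \<oplus>\<^sub>L M_plus n)"
    by (intro lattice_iso_direct_sum lattice_iso_refl lat
        lattice_iso_sym[OF lattice_iso_M_tilde_plus_trivial[OF n2 odd]])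
  also have "lattice_iso G ((?Ps \<oplus>\<^sub>L M_plus n) \<oplus>\<^sub>L M_plus n) (?Ps \<oplus>\<^sub>L (M_plus n \<oplus>\<^sub>L M_plus n))"
    by (intro lattice_iso_direct_sum_assoc lat)
  also have "lattice_iso G (?Ps \<oplus>\<^sub>L (M_plus n \<oplus>\<^sub>L M_plus n)) (?Ps \<oplus>\<^sub>L (?Pt \<oplus>\<^sub>L ?Pt))"
    by (intro lattice_iso_direct_sum lattice_iso_refl lat lattice_iso_M_plus_permutation n2)
  finally show ?thesis .
qed

end

theorem theorem4p8:
  fixes n :: nat and \<epsilon> :: "(nat \<times> bool) list \<Rightarrow> int \<times> bool"
  assumes "n \<ge> 3" and "odd n"
    and "\<epsilon> \<in> hom (free_group {1, 2}) (dihedral n)"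
    and "\<epsilon> (free_gen 1) = dih_sigma n"
    and "\<epsilon> (free_gen 2) = dih_tau"
  shows "lattice_iso (dihedral n)
      (relation_module (free_group {1, 2}) (dihedral n) \<epsilon>)
      (M_plus n \<oplus>\<^sub>L M_tilde_plus n)
    \<and> lattice_iso (dihedral n)
      (relation_module (free_group {1, 2}) (dihedral n) \<epsilon> \<oplus>\<^sub>L trivial_lattice)
      (permutation_lattice (dihedral n) (generate (dihedral n) {dih_sigma n})
        \<oplus>\<^sub>L (permutation_lattice (dihedral n) (generate (dihedral n) {dih_tau})
          \<oplus>\<^sub>L permutation_lattice (dihedral n) (generate (dihedral n) {dih_tau})))"
proof -
  interpret dihedral_presentation n 1 2 \<epsilon>
    by (rule dihedral_presentation.intro) (use assms in simp_all)
  show ?thesis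
    using lattice_iso_relation_module lattice_iso_relation_module_trivial \<open>odd n\<close> by blast
qed

end
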